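(* Let $0<s<1$ and $a=1-2s$. Let $Q,B$ be real constant $N\times N$ matrices with $Q=Q^\star\ge 0$, let $\mathscr K u=\operatorname{tr}(Q\nabla^2u)+\langle BX,\nabla u\rangle-\partial_t u$, and assume $K(t)>0$ for every $t>0$. Let $u\in\mathscr S(\mathbb R^{N+1})$ and, for $(X,t)\in\mathbb R^{N+1}$, $z>0$, set $$U(X,t,z)=\int_{-\infty}^t\int_{\mathbb R^N}P^{(a)}_z(X,Y,t-\tau)\,u(Y,\tau)\,dY\,d\tau=\int_0^\infty\int_{\mathbb R^N}P^{(a)}_z(X,Y,\tau)\,u(Y,t-\tau)\,dY\,d\tau .$$ Then $U\in C^\infty(\mathbb R^{N+1}\times(0,\infty))$, $\mathscr K_aU=0$ in $\mathbb R^{N+1}\times(0,\infty)$, and $$\lim_{z\to0^+}\|U(\cdot,\cdot,z)-u\|_{L^\infty(\mathbb R^{N+1})}=0 .$$ Furthermore, with the limit taken in $L^\infty(\mathbb R^{N+1})$, $$-\frac{2^{-a}\,\Gamma\left(\frac{1-a}{2}\right)}{\Gamma\left(\frac{1+a}{2}\right)}\lim_{z\to0^+}z^a\partial_zU(\cdot,\cdot,z)=(-\mathscr K)^su .$$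
   Context: Points of $\mathbb R^{N+1}$ are written $(X,t)$ with $X\in\mathbb R^N$, $t\in\mathbb R$; $\star$ denotes transpose; $\mathscr S(\mathbb R^{N+1})$ is the Schwartz space; $\nabla,\nabla^2$ are the gradient and Hessian in $X$. Set $\mathscr A u=\operatorname{tr}(Q\nabla^2u)+\langle BX,\nabla u\rangle$, so $\mathscr K=\mathscr A-\partial_t$. For $t>0$, $$K(t)=\frac1t\int_0^te^{\sigma B}Qe^{\sigma B^\star}d\sigma,$$ and $$p(X,Y,t)=(4\pi)^{-N/2}\big(\det(tK(t))\big)^{-1/2}\exp\Big(-\frac{\langle K(t)^{-1}(Y-e^{tB}X),\,Y-e^{tB}X\rangle}{4t}\Big).$$ The evolutive semigroup is $P^{\mathscr K}_\tau u(X,t)=\int_{\mathbb R^N}p(X,Y,\tau)u(Y,t-\tau)\,dY$, $\tau>0$. For $0<s<1$ and $u\in\mathscr S(\mathbb R^{N+1})$, $$(-\mathscr K)^su(X,t)=-\frac{s}{\Gamma(1-s)}\int_0^\infty\tau^{-1-s}\big[P^{\mathscr K}_\tau u(X,t)-u(X,t)\big]d\tau$$ (a convergent integral). For $a\in(-1,1)$ the Bessel operator is $\mathscr B^{(a)}_z=\partial_z^2+\frac az\partial_z$ on $z>0$, the extension operator is $\mathscr K_a=z^a(\mathscr A+\mathscr B^{(a)}_z-\partial_t)$ on $\mathbb R^{N+1}\times(0,\infty)$, and the Poisson kernel is, for $X,Y\in\mathbb R^N$, $t>0$, $z>0$, $$P^{(a)}_z(X,Y,t)=\frac{1}{2^{1-a}\Gamma\left(\frac{1-a}{2}\right)}\,\frac{z^{1-a}}{t^{\frac{3-a}{2}}}\,e^{-\frac{z^2}{4t}}\,p(X,Y,t).$$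 *)

theory Defs
  imports "HOL-Probability.Probability"
begin

text \<open>
  Points of \<open>\<real>\<^sup>N\<close> are of type \<^typ>\<open>real^'n\<close>, points \<open>(X,t)\<close> of \<open>\<real>\<^sup>N\<^sup>+\<^sup>1\<close> of type
  \<^typ>\<open>(real^'n) \<times> real\<close>. Functions are real-valued.
\<close>

subsection \<open>Matrices\<close>

text \<open>The class operations \<open>*\<close>, \<open>^\<close> on \<^typ>\<open>real^'n^'n\<close> are componentwise, so the powers
  in the exponential series are formed with \<open>**\<close>.\<close>

primrec matrix_power :: "real^'n^'n \<Rightarrow> nat \<Rightarrow> real^'n^'n" where
  "matrix_power A 0 = mat 1"
| "matrix_power A (Suc k) = A ** matrix_power A k"

definition matrix_exp :: "real^'n^'n \<Rightarrow> real^'n^'n" where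
  "matrix_exp A = (\<Sum>k. (1 / fact k) *\<^sub>R matrix_power A k)"

definition pos_semidef :: "real^'n^'n \<Rightarrow> bool" where
  "pos_semidef A \<longleftrightarrow> (\<forall>x. (A *v x) \<bullet> x \<ge> 0)"

definition pos_def :: "real^'n^'n \<Rightarrow> bool" where
  "pos_def A \<longleftrightarrow> (\<forall>x. x \<noteq> 0 \<longrightarrow> (A *v x) \<bullet> x > 0)"

subsection \<open>Smooth functions, the Schwartz space and \<open>L\<^sup>\<infinity>\<close>\<close>

text \<open>For open \<open>S\<close>, \<open>higher_differentiable_on S f n\<close> says that \<open>f\<close> is of class \<open>C\<^sup>n\<close> on \<open>S\<close>
  (the definition used in the AFP entry on smooth manifolds).\<close>

primrec higher_differentiable_on ::
    "'a::real_normed_vector set \<Rightarrow> ('a \<Rightarrow> real) \<Rightarrow> nat \<Rightarrow> bool" where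
  "higher_differentiable_on S f 0 \<longleftrightarrow> continuous_on S f"
| "higher_differentiable_on S f (Suc n) \<longleftrightarrow>
     (\<forall>x\<in>S. f differentiable (at x)) \<and>
     (\<forall>v. higher_differentiable_on S (\<lambda>x. frechet_derivative f (at x) v) n)"

definition smooth_on :: "'a::real_normed_vector set \<Rightarrow> ('a \<Rightarrow> real) \<Rightarrow> bool" where
  "smooth_on S f \<longleftrightarrow> (\<forall>n. higher_differentiable_on S f n)"

primrec iter_deriv :: "'a::real_normed_vector list \<Rightarrow> ('a \<Rightarrow> real) \<Rightarrow> 'a \<Rightarrow> real" where
  "iter_deriv [] f = f"
| "iter_deriv (v # vs) f = (\<lambda>x. frechet_derivative (iter_deriv vs f) (at x) v)"

text \<open>A list of basis vectors encodes a multi-index of partial derivatives.\<close>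

definition schwartz :: "('a::euclidean_space \<Rightarrow> real) set" where
  "schwartz = {f. smooth_on UNIV f \<and>
     (\<forall>k. \<forall>vs \<in> lists Basis. bounded (range (\<lambda>x. norm x ^ k * iter_deriv vs f x)))}"

definition Linf_norm :: "('a::euclidean_space \<Rightarrow> real) \<Rightarrow> ereal" where
  "Linf_norm f = esssup lebesgue (\<lambda>x. ereal \<bar>f x\<bar>)"

definition Linf :: "('a::euclidean_space \<Rightarrow> real) set" where
  "Linf = {f \<in> borel_measurable lebesgue. Linf_norm f < \<infinity>}"

definition Linf_limit ::
    "('i \<Rightarrow> 'a::euclidean_space \<Rightarrow> real) \<Rightarrow> ('a \<Rightarrow> real) \<Rightarrow> 'i filter \<Rightarrow> bool" where
  "Linf_limit f g F \<longleftrightarrow> (\<forall>\<^sub>F i in F. f i \<in> Linf) \<and> g \<in> Linf \<and>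
     ((\<lambda>i. Linf_norm (\<lambda>x. f i x - g x)) \<longlongrightarrow> 0) F"

subsection \<open>Differential operators\<close>

definition gradient :: "(real^'n \<Rightarrow> real) \<Rightarrow> real^'n \<Rightarrow> real^'n" where
  "gradient w X = (\<chi> i. frechet_derivative w (at X) (axis i 1))"

definition hessian :: "(real^'n \<Rightarrow> real) \<Rightarrow> real^'n \<Rightarrow> real^'n^'n" where
  "hessian w X = (\<chi> i j. frechet_derivative (\<lambda>Y. gradient w Y $ j) (at X) (axis i 1))"

definition op_A :: "real^'n^'n \<Rightarrow> real^'n^'n \<Rightarrow> (real^'n \<Rightarrow> real) \<Rightarrow> real^'n \<Rightarrow> real" where
  "op_A Q B w X = trace (Q ** hessian w X) + (B *v X) \<bullet> gradient w X"

definition bessel_op :: "real \<Rightarrow> (real \<Rightarrow> real) \<Rightarrow> real \<Rightarrow> real" where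
  "bessel_op a w z = deriv (deriv w) z + a / z * deriv w z"

definition extension_op ::
    "real^'n^'n \<Rightarrow> real^'n^'n \<Rightarrow> real \<Rightarrow> (real^'n \<Rightarrow> real \<Rightarrow> real \<Rightarrow> real) \<Rightarrow>
     real^'n \<Rightarrow> real \<Rightarrow> real \<Rightarrow> real" where
  "extension_op Q B a U X t z = z powr a *
     (op_A Q B (\<lambda>X'. U X' t z) X + bessel_op a (\<lambda>z'. U X t z') z - deriv (\<lambda>t'. U X t' z) t)"

subsection \<open>The kernel, the evolutive semigroup and the fractional power\<close>

definition K_mat :: "real^'n^'n \<Rightarrow> real^'n^'n \<Rightarrow> real \<Rightarrow> real^'n^'n" where
  "K_mat Q B t = (1 / t) *\<^sub>R
     (LINT \<sigma>:{0..t}|lborel. matrix_exp (\<sigma> *\<^sub>R B) ** Q ** matrix_exp (\<sigma> *\<^sub>R transpose B))"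

definition p_kernel ::
    "real^'n^'n \<Rightarrow> real^'n^'n \<Rightarrow> real^'n \<Rightarrow> real^'n \<Rightarrow> real \<Rightarrow> real" where
  "p_kernel Q B X Y t =
     (4 * pi) powr (- real CARD('n) / 2) * det (t *\<^sub>R K_mat Q B t) powr (- 1 / 2) *
     exp (- ((matrix_inv (K_mat Q B t) *v (Y - matrix_exp (t *\<^sub>R B) *v X))
             \<bullet> (Y - matrix_exp (t *\<^sub>R B) *v X)) / (4 * t))"

definition semigroup_P ::
    "real^'n^'n \<Rightarrow> real^'n^'n \<Rightarrow> real \<Rightarrow> ((real^'n) \<times> real \<Rightarrow> real) \<Rightarrow> real^'n \<Rightarrow> real \<Rightarrow> real" where
  "semigroup_P Q B \<tau> u X t = (LINT Y|lborel. p_kernel Q B X Y \<tau> * u (Y, t - \<tau>))"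

definition frac_power ::
    "real^'n^'n \<Rightarrow> real^'n^'n \<Rightarrow> real \<Rightarrow> ((real^'n) \<times> real \<Rightarrow> real) \<Rightarrow> real^'n \<Rightarrow> real \<Rightarrow> real" where
  "frac_power Q B s u X t = - (s / Gamma (1 - s)) *
     (LINT \<tau>:{0<..}|lborel. \<tau> powr (- 1 - s) * (semigroup_P Q B \<tau> u X t - u (X, t)))"

definition poisson_kernel ::
    "real^'n^'n \<Rightarrow> real^'n^'n \<Rightarrow> real \<Rightarrow> real \<Rightarrow> real^'n \<Rightarrow> real^'n \<Rightarrow> real \<Rightarrow> real" where
  "poisson_kernel Q B a z X Y t =
     1 / (2 powr (1 - a) * Gamma ((1 - a) / 2)) * (z powr (1 - a) / t powr ((3 - a) / 2)) *
     exp (- z\<^sup>2 / (4 * t)) * p_kernel Q B X Y t"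

definition poisson_extension ::
    "real^'n^'n \<Rightarrow> real^'n^'n \<Rightarrow> real \<Rightarrow> ((real^'n) \<times> real \<Rightarrow> real) \<Rightarrow>
     real^'n \<Rightarrow> real \<Rightarrow> real \<Rightarrow> real" where
  "poisson_extension Q B a u X t z =
     (LINT \<tau>:{..<t}|lborel. LINT Y|lborel. poisson_kernel Q B a z X Y (t - \<tau>) * u (Y, \<tau>))"

end

theory Submission
  imports Defs "HOL-Real_Asymp.Real_Asymp"
begin

text \<open>
  The semigroup is the average of \<open>u (e\<^sup>\<tau>\<^sup>B X + R(\<tau>) w, t - \<tau>)\<close> over a standard Gaussian \<open>w\<close>, where
  \<open>R(\<tau>) R(\<tau>)\<^sup>* = 2 \<tau> K(\<tau>)\<close> and \<open>R\<close> is differentiable in \<open>\<tau>\<close>. Differentiating this average in \<open>\<tau>\<close>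
  and integrating by parts in \<open>w\<close> shows that it solves the heat equation \<open>\<partial>\<^sub>\<tau> w = \<K> w\<close>. The extension is
  \<open>U = \<integral> k(z,\<tau>) w(\<tau>) d\<tau>\<close> with a weight of mass one satisfying \<open>\<partial>\<^sub>\<tau> k = \<B>\<^sub>z k\<close>, so the extension operator
  applied to \<open>U\<close> is the integral of \<open>\<partial>\<^sub>\<tau> (k w)\<close> and vanishes. Both boundary limits follow from the uniform
  estimate \<open>\<bar>w(\<tau>) - u\<bar> \<le> C min(1,\<tau>)\<close>, after subtracting \<open>u\<close> under the integral.
\<close>

section \<open>Smooth functions and differentiation under the integral\<close>

text \<open>Differentiating \<open>p_kernel\<close> in time would mean differentiating an inverse
  matrix and a determinant that degenerate as \<tau> tends to 0. In the averaged form the density is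
  fixed and the time derivative falls on \<open>u\<close>; the price is a differentiable root R of
  the covariance. The term with R' w is integrated by parts into second derivatives weighted by R
  R'^T, whose symmetric part is half the derivative of R R^T, so the choice of the root leaves no
  trace. The drift BX is unbounded, so bounds on the derivatives of \<open>u\<close> alone do not
  give a uniform estimate of w(\<tau>) - u; the decay of \<open>u\<close> does, through boundedness
  of |x| |Du|. For the limit of z^a \<partial>_z U, the factor z^a times the z-derivative of the
  weight tends to a multiple of \<tau>^(-1-s), which is not integrable at 0. Since the mass of the
  weight is constant in z, the integral of its z-derivative is 0 and \<open>u\<close> can be
  subtracted there as well; then \<tau>^(-1-s) min(1,\<tau>) dominates, and its integrability uses
  both ends of 0 < s < 1.\<close>

lemma higher_differentiable_on_cong:
  assumes "open S" "\<And>x. x \<in> S \<Longrightarrow> f x = g x"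
  shows "higher_differentiable_on S f n \<longleftrightarrow> higher_differentiable_on S g n"
  using assms(2)
proof (induction n arbitrary: f g)
  case 0
  then show ?case by (simp cong: continuous_on_cong)
next
  case (Suc n)
  have d: "(f has_derivative D) (at x) \<longleftrightarrow> (g has_derivative D) (at x)" if "x \<in> S" for x D
  proof
    show "(g has_derivative D) (at x)" if "(f has_derivative D) (at x)"
      by (rule has_derivative_transform_within_open[OF that assms(1) \<open>x \<in> S\<close>]) (rule Suc.prems)
    show "(f has_derivative D) (at x)" if "(g has_derivative D) (at x)"
      by (rule has_derivative_transform_within_open[OF that assms(1) \<open>x \<in> S\<close>]) (rule Suc.prems[symmetric])
  qed
  then have "f differentiable (at x) \<longleftrightarrow> g differentiable (at x)" if "x \<in> S" for x
    using that unfolding differentiable_def by blast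
  \<comment> \<open>\<open>frechet_derivative\<close> chooses from the set of derivatives; equal
    sets give equal choices, so the values agree whether or not a derivative exists.\<close>
  moreover have "frechet_derivative f (at x) v = frechet_derivative g (at x) v" if "x \<in> S" for x v
    using d[OF that] unfolding frechet_derivative_def by simp
  then have "higher_differentiable_on S (\<lambda>x. frechet_derivative f (at x) v) n
      \<longleftrightarrow> higher_differentiable_on S (\<lambda>x. frechet_derivative g (at x) v) n" for v
    by (intro Suc.IH)
  ultimately show ?case by simp
qed

lemma higher_differentiable_on_add:
  assumes "open S" "higher_differentiable_on S f n" "higher_differentiable_on S g n"
  shows "higher_differentiable_on S (\<lambda>x. f x + g x) n"
  using assms(2,3)
proof (induction n arbitrary: f g)
  case 0
  then show ?case by (simp add: continuous_on_add)
next
  case (Suc n)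
  have "frechet_derivative (\<lambda>x. f x + g x) (at x) v
      = frechet_derivative f (at x) v + frechet_derivative g (at x) v" if "x \<in> S" for x v
    using frechet_derivative_at[OF has_derivative_add[OF
      frechet_derivative_works[THEN iffD1] frechet_derivative_works[THEN iffD1]], of f x g] Suc.prems that
    by (simp add: fun_eq_iff)
  then have "higher_differentiable_on S (\<lambda>x. frechet_derivative (\<lambda>x. f x + g x) (at x) v) n" for v
    using Suc higher_differentiable_on_cong[OF assms(1),
      of "\<lambda>x. frechet_derivative (\<lambda>x. f x + g x) (at x) v"] by simp
  then show ?case using Suc.prems by simp
qed

lemma higher_differentiable_on_cmult:
  assumes "open S" "higher_differentiable_on S f n"
  shows "higher_differentiable_on S (\<lambda>x. c * f x) n"
  using assms(2)
proof (induction n arbitrary: f)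
  case 0
  then show ?case by (simp add: continuous_on_mult_left)
next
  case (Suc n)
  have "frechet_derivative (\<lambda>x. c * f x) (at x) v = c * frechet_derivative f (at x) v" if "x \<in> S" for x v
    using frechet_derivative_at[OF has_derivative_mult_right[OF
      frechet_derivative_works[THEN iffD1]], of f x c] Suc.prems that
    by (simp add: fun_eq_iff)
  then have "higher_differentiable_on S (\<lambda>x. frechet_derivative (\<lambda>x. c * f x) (at x) v) n" for v
    using Suc higher_differentiable_on_cong[OF assms(1),
      of "\<lambda>x. frechet_derivative (\<lambda>x. c * f x) (at x) v"] by simp
  then show ?case using Suc.prems by simp
qed

text \<open>The majorant \<open>g\<close> bounds the operator norm of the derivative on a whole
  ball, so the mean value inequality dominates the difference quotients, and dominated convergence
  gives the Frechet derivative. The measure is general because the lemma serves both the Gaussian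
  integrals over space and the time integral over the positive half line.\<close>

lemma has_derivative_integral:
  fixes f :: "'a::euclidean_space \<Rightarrow> 'b \<Rightarrow> real"
  assumes e: "e > 0"
    and der: "\<And>y \<omega>. y \<in> ball x e \<Longrightarrow> \<omega> \<in> space M \<Longrightarrow> ((\<lambda>y. f y \<omega>) has_derivative f' y \<omega>) (at y)"
    and int: "\<And>y. y \<in> ball x e \<Longrightarrow> integrable M (f y)"
    and meas: "\<And>v. (\<lambda>\<omega>. f' x \<omega> v) \<in> borel_measurable M"
    and g: "integrable M g"
    and bound: "\<And>y \<omega> v. y \<in> ball x e \<Longrightarrow> \<omega> \<in> space M \<Longrightarrow> \<bar>f' y \<omega> v\<bar> \<le> g \<omega> * norm v"
  shows "((\<lambda>y. \<integral>\<omega>. f y \<omega> \<partial>M) has_derivative (\<lambda>v. \<integral>\<omega>. f' x \<omega> v \<partial>M)) (at x)"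
    and "integrable M (\<lambda>\<omega>. f' x \<omega> v)"
proof -
  have x: "x \<in> ball x e" using e by simp
  have int': "integrable M (\<lambda>\<omega>. f' x \<omega> v)" for v
  proof (rule Bochner_Integration.integrable_bound[where f="\<lambda>\<omega>. g \<omega> * norm v"])
    show "AE \<omega> in M. norm (f' x \<omega> v) \<le> norm (g \<omega> * norm v)"
    proof (rule AE_I2)
      fix \<omega> assume "\<omega> \<in> space M"
      from bound[OF x this, of v] show "norm (f' x \<omega> v) \<le> norm (g \<omega> * norm v)" by simp
    qed
  qed (use g meas in auto)
  then show "integrable M (\<lambda>\<omega>. f' x \<omega> v)" .
  have lin: "linear (f' x \<omega>)" if "\<omega> \<in> space M" for \<omega>
    using der[OF x that] has_derivative_linear by blast
  have bl: "bounded_linear (\<lambda>v. \<integral>\<omega>. f' x \<omega> v \<partial>M)"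
  proof (rule bounded_linear_intro)
    show "(\<integral>\<omega>. f' x \<omega> (v + w) \<partial>M) = (\<integral>\<omega>. f' x \<omega> v \<partial>M) + (\<integral>\<omega>. f' x \<omega> w \<partial>M)" for v w
      by (subst Bochner_Integration.integral_add[symmetric])
         (auto intro!: int' Bochner_Integration.integral_cong simp: lin linear_add)
    show "(\<integral>\<omega>. f' x \<omega> (r *\<^sub>R v) \<partial>M) = r *\<^sub>R (\<integral>\<omega>. f' x \<omega> v \<partial>M)" for r v
      unfolding real_scaleR_def integral_mult_right_zero[symmetric]
      by (intro Bochner_Integration.integral_cong refl) (simp add: lin linear_cmul)
    show "norm (\<integral>\<omega>. f' x \<omega> v \<partial>M) \<le> norm v * (\<integral>\<omega>. g \<omega> \<partial>M)" for v
    proof -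
      have "norm (\<integral>\<omega>. f' x \<omega> v \<partial>M) \<le> (\<integral>\<omega>. norm (f' x \<omega> v) \<partial>M)"
        by (rule integral_norm_bound)
      also have "\<dots> \<le> (\<integral>\<omega>. norm v * g \<omega> \<partial>M)"
        by (rule integral_mono) (use int' g bound[OF x] in \<open>auto simp: mult.commute\<close>)
      finally have "norm (\<integral>\<omega>. f' x \<omega> v \<partial>M) \<le> (\<integral>\<omega>. norm v * g \<omega> \<partial>M)" .
      then show ?thesis by simp
    qed
  qed
  \<comment> \<open>One \<open>g\<close> comes from the mean value inequality on the convex ball,
    the other from the linear part at \<open>x\<close>.\<close>
  have lip: "\<bar>f y \<omega> - f x \<omega> - f' x \<omega> (y - x)\<bar> \<le> 2 * g \<omega> * norm (y - x)"
    if y: "y \<in> ball x e" and w: "\<omega> \<in> space M" for y \<omega>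
  proof -
    have "norm (f y \<omega> - f x \<omega>) \<le> g \<omega> * norm (y - x)"
    proof (rule differentiable_bound[where S="ball x e" and f="\<lambda>y. f y \<omega>" and f'="\<lambda>y. f' y \<omega>"])
      show "onorm (f' z \<omega>) \<le> g \<omega>" if "z \<in> ball x e" for z
      proof (rule onorm_le)
        show "norm (f' z \<omega> v) \<le> g \<omega> * norm v" for v
          using bound[OF that w] by simp
      qed
    qed (use der w y x in \<open>auto intro: has_derivative_at_withinI\<close>)
    with bound[OF x w, of "y - x"] show ?thesis by (auto simp: abs_le_iff)
  qed
  show "((\<lambda>y. \<integral>\<omega>. f y \<omega> \<partial>M) has_derivative (\<lambda>v. \<integral>\<omega>. f' x \<omega> v \<partial>M)) (at x)"
    unfolding has_derivative_at_within
  proof (intro conjI bl)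
    let ?q = "\<lambda>y \<omega>. (f y \<omega> - f x \<omega> - f' x \<omega> (y - x)) / norm (y - x)"
    have "((\<lambda>y. \<integral>\<omega>. ?q y \<omega> \<partial>M) \<longlongrightarrow> 0) (at x)"
      unfolding tendsto_at_iff_sequentially
    proof (intro allI impI)
      fix X :: "nat \<Rightarrow> 'a" assume X: "\<forall>i. X i \<in> UNIV - {x}" "X \<longlonglongrightarrow> x"
      then obtain N where N: "\<And>n. n \<ge> N \<Longrightarrow> X n \<in> ball x e"
        using e by (metis dist_commute lim_sequentially mem_ball)
      \<comment> \<open>Dropping the first \<open>N\<close> terms keeps the sequence inside the
        ball, where the majorant is valid.\<close>
      have "(\<lambda>n. \<integral>\<omega>. ?q (X (n + N)) \<omega> \<partial>M) \<longlonglongrightarrow> (\<integral>\<omega>. 0 \<partial>M)"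
      proof (rule integral_dominated_convergence[where w="\<lambda>\<omega>. 2 * g \<omega>"])
        show "(\<lambda>\<omega>. ?q (X (n + N)) \<omega>) \<in> borel_measurable M" for n
          using int[OF N, of "n + N"] int[OF x] int' by measurable
        show "AE \<omega> in M. (\<lambda>n. ?q (X (n + N)) \<omega>) \<longlonglongrightarrow> 0"
        proof (rule AE_I2)
          fix \<omega> assume "\<omega> \<in> space M"
          from der[OF x this] have "((\<lambda>y. ?q y \<omega>) \<longlongrightarrow> 0) (at x)"
            unfolding has_derivative_at_within by (simp add: divide_inverse mult.commute)
          then have "(\<lambda>n. ?q (X n) \<omega>) \<longlonglongrightarrow> 0"
            using X unfolding tendsto_at_iff_sequentially comp_def by blast
          then show "(\<lambda>n. ?q (X (n + N)) \<omega>) \<longlonglongrightarrow> 0" by (rule LIMSEQ_ignore_initial_segment)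
        qed
        show "AE \<omega> in M. norm (?q (X (n + N)) \<omega>) \<le> 2 * g \<omega>" for n
        proof (rule AE_I2)
          fix \<omega> assume w: "\<omega> \<in> space M"
          have "norm (X (n + N) - x) > 0" using X by auto
          with lip[OF N w, of "n + N"] show "norm (?q (X (n + N)) \<omega>) \<le> 2 * g \<omega>"
            by (simp add: divide_le_eq)
        qed
      qed (use g in auto)
      then have "(\<lambda>n. \<integral>\<omega>. ?q (X (n + N)) \<omega> \<partial>M) \<longlonglongrightarrow> 0" by simp
      then show "((\<lambda>y. \<integral>\<omega>. ?q y \<omega> \<partial>M) \<circ> X) \<longlonglongrightarrow> 0"
        unfolding comp_def by (rule LIMSEQ_offset)
    qed
    moreover have "\<forall>\<^sub>F y in at x. (\<integral>\<omega>. ?q y \<omega> \<partial>M)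
        = ((\<integral>\<omega>. f y \<omega> \<partial>M) - (\<integral>\<omega>. f x \<omega> \<partial>M) - (\<integral>\<omega>. f' x \<omega> (y - x) \<partial>M)) /\<^sub>R norm (y - x)"
      using eventually_at_ball[OF e, of x UNIV]
    proof eventually_elim
      case (elim y)
      then show ?case using int[of y] int[OF x] int' by (simp add: divide_inverse mult.commute)
    qed
    ultimately show "((\<lambda>y. ((\<integral>\<omega>. f y \<omega> \<partial>M) - (\<integral>\<omega>. f x \<omega> \<partial>M)
        - (\<integral>\<omega>. f' x \<omega> (y - x) \<partial>M)) /\<^sub>R norm (y - x)) \<longlongrightarrow> 0) (at x)"
      by (rule Lim_transform_eventually)
  qed
qed

text \<open>In the applications the index is the time \<tau>, and the bounds must not depend on it.
  Each direction \<open>v\<close> is fixed before the bound \<open>M\<close> is chosen, so the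
  constants may depend on the order and on the directions; this keeps inductions over the order free
  of operator norms.\<close>

primrec uniform_smooth_upto :: "nat \<Rightarrow> 'i set \<Rightarrow> ('i \<Rightarrow> 'a::euclidean_space \<Rightarrow> real) \<Rightarrow> bool" where
  "uniform_smooth_upto 0 I F \<longleftrightarrow> (\<exists>M. \<forall>i\<in>I. \<forall>x. \<bar>F i x\<bar> \<le> M)"
| "uniform_smooth_upto (Suc n) I F \<longleftrightarrow> (\<exists>M. \<forall>i\<in>I. \<forall>x. \<bar>F i x\<bar> \<le> M) \<and> (\<forall>i\<in>I. \<forall>x. F i differentiable at x) \<and>
     (\<forall>v. uniform_smooth_upto n I (\<lambda>i x. frechet_derivative (F i) (at x) v))"

definition uniform_smooth :: "'i set \<Rightarrow> ('i \<Rightarrow> 'a::euclidean_space \<Rightarrow> real) \<Rightarrow> bool" where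
  "uniform_smooth I F \<longleftrightarrow> (\<forall>n. uniform_smooth_upto n I F)"

lemma uniform_smoothD:
  assumes "uniform_smooth I F"
  shows uniform_smooth_bounded: "\<exists>M\<ge>0. \<forall>i\<in>I. \<forall>x. \<bar>F i x\<bar> \<le> M"
    and uniform_smooth_differentiable: "\<And>i x. i \<in> I \<Longrightarrow> F i differentiable at x"
    and uniform_smooth_deriv: "\<And>v. uniform_smooth I (\<lambda>i x. frechet_derivative (F i) (at x) v)"
proof -
  from assms have "uniform_smooth_upto 0 I F" unfolding uniform_smooth_def by blast
  then obtain M where "\<forall>i\<in>I. \<forall>x. \<bar>F i x\<bar> \<le> M" by auto
  then have "\<forall>i\<in>I. \<forall>x. \<bar>F i x\<bar> \<le> max M 0" using max.coboundedI1 by blast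
  then show "\<exists>M\<ge>0. \<forall>i\<in>I. \<forall>x. \<bar>F i x\<bar> \<le> M" using max.cobounded2 by blast
  have S: "uniform_smooth_upto (Suc n) I F" for n using assms unfolding uniform_smooth_def by blast
  from S[of 0] show "\<And>i x. i \<in> I \<Longrightarrow> F i differentiable at x" by simp
  show "\<And>v. uniform_smooth I (\<lambda>i x. frechet_derivative (F i) (at x) v)"
    using S unfolding uniform_smooth_def by simp
qed

lemma uniform_smooth_upto_cong:
  assumes "\<And>i x. i \<in> I \<Longrightarrow> F i x = G i x"
  shows "uniform_smooth_upto n I F \<longleftrightarrow> uniform_smooth_upto n I G"
  using assms
proof (induction n arbitrary: F G)
  case (Suc n)
  have "F i = G i" if "i \<in> I" for i using Suc.prems that by blast
  moreover from this have "uniform_smooth_upto n I (\<lambda>i x. frechet_derivative (F i) (at x) v)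
      = uniform_smooth_upto n I (\<lambda>i x. frechet_derivative (G i) (at x) v)" for v
    by (intro Suc.IH) simp
  ultimately show ?case by simp
qed auto

lemma uniform_smooth_upto_add:
  assumes "uniform_smooth_upto n I F" "uniform_smooth_upto n I G"
  shows "uniform_smooth_upto n I (\<lambda>i x. F i x + G i x)"
  using assms
proof (induction n arbitrary: F G)
  case 0
  then obtain M N where "\<forall>i\<in>I. \<forall>x. \<bar>F i x\<bar> \<le> M" "\<forall>i\<in>I. \<forall>x. \<bar>G i x\<bar> \<le> N" by auto
  then show ?case unfolding uniform_smooth_upto.simps by (intro exI[of _ "M + N"] ballI allI order_trans[OF abs_triangle_ineq] add_mono) auto
next
  case (Suc n)
  have *: "uniform_smooth_upto 0 I (\<lambda>i x. F i x + G i x)"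
  proof -
    from Suc.prems obtain M N where "\<forall>i\<in>I. \<forall>x. \<bar>F i x\<bar> \<le> M" "\<forall>i\<in>I. \<forall>x. \<bar>G i x\<bar> \<le> N" by auto
    then show ?thesis unfolding uniform_smooth_upto.simps by (intro exI[of _ "M + N"] ballI allI order_trans[OF abs_triangle_ineq] add_mono) auto
  qed
  have "frechet_derivative (\<lambda>x. F i x + G i x) (at x) v
      = frechet_derivative (F i) (at x) v + frechet_derivative (G i) (at x) v" if "i \<in> I" for i x v
    using frechet_derivative_at[OF has_derivative_add[OF
      frechet_derivative_works[THEN iffD1] frechet_derivative_works[THEN iffD1]], of "F i" x "G i"]
      Suc.prems that by (simp add: fun_eq_iff)
  then have "uniform_smooth_upto n I (\<lambda>i x. frechet_derivative (\<lambda>x. F i x + G i x) (at x) v)" for v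
    using Suc uniform_smooth_upto_cong[of I
      "\<lambda>i x. frechet_derivative (\<lambda>x. F i x + G i x) (at x) v"] by simp
  then show ?case using Suc.prems * by simp
qed

lemma uniform_smooth_upto_cmult:
  assumes "uniform_smooth_upto n I F" "\<And>i. i \<in> I \<Longrightarrow> \<bar>c i\<bar> \<le> K"
  shows "uniform_smooth_upto n I (\<lambda>i x. c i * F i x)"
  using assms(1)
proof (induction n arbitrary: F)
  case 0
  then obtain M where "\<forall>i\<in>I. \<forall>x. \<bar>F i x\<bar> \<le> M" by auto
  then have "\<bar>c i * F i x\<bar> \<le> K * M" if "i \<in> I" for i x
    using assms(2)[OF that] that unfolding abs_mult by (intro mult_mono) auto
  then show ?case by auto
next
  case (Suc n)
  have *: "uniform_smooth_upto 0 I (\<lambda>i x. c i * F i x)"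
  proof -
    from Suc.prems obtain M where "\<forall>i\<in>I. \<forall>x. \<bar>F i x\<bar> \<le> M" by auto
    then have "\<bar>c i * F i x\<bar> \<le> K * M" if "i \<in> I" for i x
      using assms(2)[OF that] that unfolding abs_mult by (intro mult_mono) auto
    then show ?thesis by auto
  qed
  have "frechet_derivative (\<lambda>x. c i * F i x) (at x) v
      = c i * frechet_derivative (F i) (at x) v" if "i \<in> I" for i x v
    using frechet_derivative_at[OF has_derivative_mult_right[OF
      frechet_derivative_works[THEN iffD1]], of "F i" x "c i"]
      Suc.prems that by (simp add: fun_eq_iff)
  then have "uniform_smooth_upto n I (\<lambda>i x. frechet_derivative (\<lambda>x. c i * F i x) (at x) v)" for v
    using Suc uniform_smooth_upto_cong[of I
      "\<lambda>i x. frechet_derivative (\<lambda>x. c i * F i x) (at x) v"] by simp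
  then show ?case using Suc.prems * by simp
qed

lemma uniform_smooth_upto_zero: "uniform_smooth_upto n I (\<lambda>i x. 0)"
  by (induction n) (simp_all add: exI[of _ "0::real"])

lemma uniform_smooth_upto_sum:
  assumes "finite J" "\<And>j. j \<in> J \<Longrightarrow> uniform_smooth_upto n I (F j)"
  shows "uniform_smooth_upto n I (\<lambda>i x. \<Sum>j\<in>J. F j i x)"
  using assms
  by (induction J rule: finite_induct) (auto simp: uniform_smooth_upto_zero intro!: uniform_smooth_upto_add)

lemma frechet_derivative_basis:
  fixes f :: "'a::euclidean_space \<Rightarrow> real"
  assumes "f differentiable at x"
  shows "frechet_derivative f (at x) v = (\<Sum>b\<in>Basis. (v \<bullet> b) * frechet_derivative f (at x) b)"
proof -
  interpret linear "frechet_derivative f (at x)" by (rule linear_frechet_derivative[OF assms])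
  have "frechet_derivative f (at x) (\<Sum>b\<in>Basis. (v \<bullet> b) *\<^sub>R b) = (\<Sum>b\<in>Basis. (v \<bullet> b) * frechet_derivative f (at x) b)"
    by (simp only: sum scale real_scaleR_def)
  then show ?thesis by (simp add: euclidean_representation)
qed

text \<open>The definition bounds each directional derivative separately. Expanding \<open>v\<close>
  in the finite basis turns finitely many of these bounds into one operator norm bound, the form
  that \<open>has_derivative_integral\<close> asks for.\<close>

lemma uniform_smooth_deriv_bound:
  assumes "uniform_smooth I F"
  shows "\<exists>M\<ge>0. \<forall>i\<in>I. \<forall>x v. \<bar>frechet_derivative (F i) (at x) v\<bar> \<le> M * norm v"
proof -
  have "\<forall>b. \<exists>M. M \<ge> 0 \<and> (\<forall>i\<in>I. \<forall>x. \<bar>frechet_derivative (F i) (at x) b\<bar> \<le> M)"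
    using uniform_smooth_bounded[OF uniform_smooth_deriv[OF assms]] by blast
  from choice[OF this] obtain M where
    "\<forall>b. M b \<ge> 0 \<and> (\<forall>i\<in>I. \<forall>x. \<bar>frechet_derivative (F i) (at x) b\<bar> \<le> M b)" by blast
  then have M: "\<And>b. M b \<ge> 0" "\<And>b i x. i \<in> I \<Longrightarrow> \<bar>frechet_derivative (F i) (at x) b\<bar> \<le> M b"
    by blast+
  have "\<bar>frechet_derivative (F i) (at x) v\<bar> \<le> (\<Sum>b\<in>Basis. M b) * norm v" if "i \<in> I" for i x v
  proof -
    have "\<bar>frechet_derivative (F i) (at x) v\<bar> = \<bar>\<Sum>b\<in>Basis. (v \<bullet> b) * frechet_derivative (F i) (at x) b\<bar>"
      by (rule arg_cong[OF frechet_derivative_basis[OF uniform_smooth_differentiable[OF assms that]]])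
    also have "\<dots> \<le> (\<Sum>b\<in>Basis. \<bar>(v \<bullet> b) * frechet_derivative (F i) (at x) b\<bar>)"
      by (rule sum_abs)
    also have "\<dots> \<le> (\<Sum>b\<in>Basis. norm v * M b)"
      unfolding abs_mult by (intro sum_mono mult_mono M that Basis_le_norm) auto
    finally show ?thesis by (simp add: sum_distrib_left mult.commute)
  qed
  moreover have "(\<Sum>b\<in>Basis. M b) \<ge> 0" by (rule sum_nonneg) (rule M(1))
  ultimately show ?thesis by blast
qed

text \<open>A single function is treated as a family over a one-point index set, so the calculus for
  families serves both cases.\<close>

abbreviation bounded_smooth :: "('a::euclidean_space \<Rightarrow> real) \<Rightarrow> bool" where
  "bounded_smooth f \<equiv> uniform_smooth (UNIV :: unit set) (\<lambda>_. f)"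

lemma bounded_smooth_continuous: "bounded_smooth f \<Longrightarrow> continuous_on S f"
  by (meson UNIV_I continuous_at_imp_continuous_on differentiable_imp_continuous_within
      uniform_smooth_differentiable)

lemma bounded_smooth_measurable: "bounded_smooth f \<Longrightarrow> f \<in> borel_measurable borel"
  by (rule borel_measurable_continuous_onI[OF bounded_smooth_continuous])

lemma bounded_smooth_has_derivative:
  "bounded_smooth f \<Longrightarrow> (f has_derivative frechet_derivative f (at x)) (at x)"
  by (meson UNIV_I frechet_derivative_works uniform_smooth_differentiable)

lemma iter_deriv_append: "iter_deriv (xs @ ys) f = iter_deriv xs (iter_deriv ys f)"
  by (induction xs) auto

text \<open>The seminorms with k = 0 bound the iterated derivatives along basis vectors; linearity
  in the direction extends this to arbitrary directions, one order at a time.\<close>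

lemma schwartz_bounded_smooth:
  assumes "u \<in> schwartz"
  shows "bounded_smooth u"
proof -
  have "uniform_smooth_upto n (UNIV::unit set) (\<lambda>_. f)"
    if "smooth_on UNIV f" "\<And>vs. vs \<in> lists Basis \<Longrightarrow> bounded (range (iter_deriv vs f))" for f :: "'a \<Rightarrow> real" and n
    using that
  proof (induction n arbitrary: f)
    case 0
    from 0(2)[of "[]"] show ?case by (auto simp: bounded_iff)
  next
    case (Suc n)
    have d: "f differentiable at x" for x
      using Suc.prems(1) unfolding smooth_on_def by (metis higher_differentiable_on.simps(2) UNIV_I)
    have b: "uniform_smooth_upto n (UNIV::unit set) (\<lambda>_ x. frechet_derivative f (at x) b)" if "b \<in> Basis" for b
    proof (rule Suc.IH)
      show "smooth_on UNIV (\<lambda>x. frechet_derivative f (at x) b)"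
        using Suc.prems(1) unfolding smooth_on_def by (metis higher_differentiable_on.simps(2))
      \<comment> \<open>\<open>iter_deriv\<close> applies the last vector of the list first, so an
        inner derivative along \<open>b\<close> is appended at the end.\<close>
      show "bounded (range (iter_deriv vs (\<lambda>x. frechet_derivative f (at x) b)))" if "vs \<in> lists Basis" for vs
        using Suc.prems(2)[of "vs @ [b]"] \<open>b \<in> Basis\<close> that by (simp add: iter_deriv_append)
    qed
    have "uniform_smooth_upto n (UNIV::unit set) (\<lambda>_ x. frechet_derivative f (at x) v)" for v
      unfolding frechet_derivative_basis[OF d, of _ v]
      by (intro uniform_smooth_upto_sum uniform_smooth_upto_cmult[where K="norm v"] b) (auto simp: Basis_le_norm)
    moreover from Suc.prems(2)[of "[]"] have "uniform_smooth_upto 0 (UNIV::unit set) (\<lambda>_. f)" by (auto simp: bounded_iff)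
    ultimately show ?case using d by simp
  qed
  moreover have "smooth_on UNIV u" "\<And>vs. vs \<in> lists Basis \<Longrightarrow> bounded (range (iter_deriv vs u))"
    using assms unfolding schwartz_def by (auto dest!: spec[of _ "0::nat"])
  ultimately show ?thesis unfolding uniform_smooth_def by blast
qed

text \<open>Schwarz's theorem. The second difference over the parallelogram spanned by h v and h w
  is symmetric in \<open>v\<close> and \<open>w\<close>; divided by h^2 it tends to either mixed
  derivative.\<close>

lemma frechet_derivative_commute:
  fixes f :: "'a::euclidean_space \<Rightarrow> real"
  assumes f: "bounded_smooth f"
  shows "frechet_derivative (\<lambda>y. frechet_derivative f (at y) v) (at x) w
       = frechet_derivative (\<lambda>y. frechet_derivative f (at y) w) (at x) v"
proof -
  define D where "D v = (\<lambda>y. frechet_derivative f (at y) v)" for v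
  define DD where "DD v w = (\<lambda>y. frechet_derivative (D v) (at y) w)" for v w
  have bD: "bounded_smooth (D v)" for v unfolding D_def by (rule uniform_smooth_deriv[OF f])
  have bDD: "bounded_smooth (DD v w)" for v w unfolding DD_def by (rule uniform_smooth_deriv[OF bD])
  have line: "((\<lambda>s. g (y + s *\<^sub>R a)) has_real_derivative frechet_derivative g (at (y + s *\<^sub>R a)) a) (at s)"
    if "bounded_smooth g" for g :: "'a \<Rightarrow> real" and y a s
  proof -
    have "((\<lambda>s. g (y + s *\<^sub>R a)) has_derivative (\<lambda>h. frechet_derivative g (at (y + s *\<^sub>R a)) (h *\<^sub>R a))) (at s)"
      by (rule has_derivative_compose[OF _ bounded_smooth_has_derivative[OF that]])
         (auto intro!: derivative_eq_intros)
    moreover have "(\<lambda>h. frechet_derivative g (at (y + s *\<^sub>R a)) (h *\<^sub>R a))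
        = (*) (frechet_derivative g (at (y + s *\<^sub>R a)) a)"
      by (simp add: fun_eq_iff linear_cmul[OF linear_frechet_derivative[OF
            uniform_smooth_differentiable[OF that]]] mult.commute)
    ultimately show ?thesis by (simp add: has_field_derivative_def)
  qed
  \<comment> \<open>The mean value theorem is applied along \<open>v\<close> to the increment in the
    direction \<open>w\<close>, then along \<open>w\<close> to the first derivative. Both
    \<open>p\<close> and \<open>q\<close> stay below \<open>h\<close>, so the intermediate point
    tends to \<open>x\<close>.\<close>
  have key: "\<exists>p q. 0 < p \<and> p < h \<and> 0 < q \<and> q < h \<and>
      f (x + h *\<^sub>R v + h *\<^sub>R w) - f (x + h *\<^sub>R v) - f (x + h *\<^sub>R w) + f x = h * h * DD v w (x + p *\<^sub>R v + q *\<^sub>R w)"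
    if h: "h > 0" for h :: real and v w
  proof -
    let ?g = "\<lambda>s. f ((x + h *\<^sub>R w) + s *\<^sub>R v) - f (x + s *\<^sub>R v)"
    have "\<exists>p>0. p < h \<and> ?g h - ?g 0 = (h - 0) * (D v ((x + h *\<^sub>R w) + p *\<^sub>R v) - D v (x + p *\<^sub>R v))"
      unfolding D_def
      by (rule MVT2[OF h]) (intro DERIV_diff line f)
    then obtain p where p: "0 < p" "p < h"
      "?g h - ?g 0 = h * (D v ((x + h *\<^sub>R w) + p *\<^sub>R v) - D v (x + p *\<^sub>R v))" by auto
    have "\<exists>q>0. q < h \<and> D v ((x + p *\<^sub>R v) + h *\<^sub>R w) - D v ((x + p *\<^sub>R v) + 0 *\<^sub>R w) = (h - 0) * DD v w ((x + p *\<^sub>R v) + q *\<^sub>R w)"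
      unfolding DD_def
      by (rule MVT2[OF h]) (intro line bD)
    then obtain q where q: "0 < q" "q < h" "D v ((x + p *\<^sub>R v) + h *\<^sub>R w) - D v (x + p *\<^sub>R v) = h * DD v w (x + p *\<^sub>R v + q *\<^sub>R w)"
      by auto
    have "?g h - ?g 0 = h * h * DD v w (x + p *\<^sub>R v + q *\<^sub>R w)"
      using p(3) q(3) by (simp add: algebra_simps)
    moreover have "?g h - ?g 0 = f (x + h *\<^sub>R v + h *\<^sub>R w) - f (x + h *\<^sub>R v) - f (x + h *\<^sub>R w) + f x"
      by (simp add: algebra_simps)
    ultimately show ?thesis using p q by metis
  qed
  have lim: "((\<lambda>h. (f (x + h *\<^sub>R v + h *\<^sub>R w) - f (x + h *\<^sub>R v) - f (x + h *\<^sub>R w) + f x) / (h * h)) \<longlongrightarrow> DD v w x) (at_right 0)" for v w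
  proof -
    let ?R = "\<lambda>(h::real) p q. 0 < p \<and> p < h \<and> 0 < q \<and> q < h \<and>
      f (x + h *\<^sub>R v + h *\<^sub>R w) - f (x + h *\<^sub>R v) - f (x + h *\<^sub>R w) + f x = h * h * DD v w (x + p *\<^sub>R v + q *\<^sub>R w)"
    have "\<forall>h. \<exists>pq. h > 0 \<longrightarrow> ?R h (fst pq) (snd pq)" using key[of _ v w] by simp
    from choice[OF this] obtain pq' where "\<forall>h. h > 0 \<longrightarrow> ?R h (fst (pq' h)) (snd (pq' h))" by blast
    then obtain p q where pq: "\<And>h::real. h > 0 \<Longrightarrow> ?R h (p h) (q h)" using that[of "\<lambda>h. fst (pq' h)" "\<lambda>h. snd (pq' h)"] by blast
    have ev: "\<forall>\<^sub>F h::real in at_right 0. h > 0" by (rule eventually_at_right_less)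
    have "(p \<longlongrightarrow> 0) (at_right 0)" "(q \<longlongrightarrow> 0) (at_right 0)"
      by (rule tendsto_sandwich[where f="\<lambda>_. 0" and h="\<lambda>x. x", OF _ _ tendsto_const tendsto_ident_at];
          (rule eventually_mono[OF ev], drule pq, linarith))+
    then have "((\<lambda>h. x + p h *\<^sub>R v + q h *\<^sub>R w) \<longlongrightarrow> x + 0 *\<^sub>R v + 0 *\<^sub>R w) (at_right 0)"
      by (intro tendsto_intros)
    moreover have "isCont (DD v w) x"
      using bounded_smooth_continuous[OF bDD, of UNIV] by (simp add: continuous_on_eq_continuous_at)
    ultimately have "((\<lambda>h. DD v w (x + p h *\<^sub>R v + q h *\<^sub>R w)) \<longlongrightarrow> DD v w x) (at_right 0)"
      using isCont_tendsto_compose by fastforce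
    moreover have "\<forall>\<^sub>F h in at_right 0. DD v w (x + p h *\<^sub>R v + q h *\<^sub>R w) = 
       (f (x + h *\<^sub>R v + h *\<^sub>R w) - f (x + h *\<^sub>R v) - f (x + h *\<^sub>R w) + f x) / (h * h)"
      by (rule eventually_mono[OF ev], drule pq) simp
    ultimately show ?thesis by (rule Lim_transform_eventually)
  qed
  have "x + h *\<^sub>R w + h *\<^sub>R v = x + h *\<^sub>R v + h *\<^sub>R w" for h
    by (simp only: add.assoc add.commute[of "h *\<^sub>R w"])
  moreover have "a - b - c + d = a - c - b + d" for a b c d :: real by simp
  ultimately have "(\<lambda>h. (f (x + h *\<^sub>R w + h *\<^sub>R v) - f (x + h *\<^sub>R w) - f (x + h *\<^sub>R v) + f x) / (h * h))
      = (\<lambda>h. (f (x + h *\<^sub>R v + h *\<^sub>R w) - f (x + h *\<^sub>R v) - f (x + h *\<^sub>R w) + f x) / (h * h))"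
    by (simp only:)
  then have "DD v w x = DD w v x"
    using tendsto_unique[OF _ lim[of v w], of "DD w v x"] lim[of w v] by simp
  then show ?thesis unfolding DD_def D_def .
qed

section \<open>Gaussian integrals\<close>

lemma lborel_translate:
  fixes f :: "'a::euclidean_space \<Rightarrow> real" and c :: 'a
  assumes "f \<in> borel_measurable borel"
  shows "(\<integral>w. f (w + c) \<partial>lborel) = (\<integral>w. f w \<partial>lborel)"
    and "integrable lborel (\<lambda>w. f (w + c)) \<longleftrightarrow> integrable lborel f"
proof -
  have *: "lborel = distr lborel borel ((+) c)" by (rule lborel_distr_plus[symmetric])
  have "(\<integral>w. f w \<partial>lborel) = (\<integral>w. f (c + w) \<partial>lborel)"
    by (subst *, subst integral_distr) (use assms in auto)
  then show "(\<integral>w. f (w + c) \<partial>lborel) = (\<integral>w. f w \<partial>lborel)" by (simp add: add.commute)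
  have "integrable lborel f \<longleftrightarrow> integrable lborel (\<lambda>w. f (c + w))"
    by (subst *, subst integrable_distr_eq) (use assms in auto)
  then show "integrable lborel (\<lambda>w. f (w + c)) \<longleftrightarrow> integrable lborel f" by (simp add: add.commute)
qed

text \<open>The integrand factors over the coordinates, so its integral is a product of
  one-dimensional normal integrals of variance 1/(2c).\<close>

lemma has_bochner_integral_exp_norm:
  assumes "c > 0"
  shows "has_bochner_integral lborel (\<lambda>w::'a::euclidean_space. exp (- c * (norm w)\<^sup>2)) (sqrt (pi / c) ^ DIM('a))"
proof (rule has_bochner_integral_nn_integral)
  define \<sigma> where "\<sigma> = 1 / sqrt (2 * c)"
  have \<sigma>: "\<sigma> > 0" "\<sigma>\<^sup>2 = 1 / (2 * c)" using assms by (auto simp: \<sigma>_def power_divide)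
  have e: "exp (- c * x\<^sup>2) = sqrt (pi / c) * normal_density 0 \<sigma> x" for x
    using assms unfolding normal_density_def \<sigma>(2) by (simp add: real_sqrt_divide)
  have 1: "(\<integral>\<^sup>+x. ennreal (exp (- c * x\<^sup>2)) \<partial>lborel) = ennreal (sqrt (pi / c))"
    unfolding e using assms
    by (subst nn_integral_eq_integral) (auto intro!: integrable_mult_right simp: \<sigma>)
  have "(norm w)\<^sup>2 = (\<Sum>b\<in>Basis. (w \<bullet> b)\<^sup>2)" for w :: 'a
    unfolding power2_norm_eq_inner euclidean_inner[of w w] by (simp add: power2_eq_square)
  then have "ennreal (exp (- c * (norm w)\<^sup>2)) = (\<Prod>b\<in>Basis. ennreal (exp (- c * (w \<bullet> b)\<^sup>2)))" for w :: 'a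
    by (simp add: prod_ennreal sum_distrib_left exp_sum sum_negf[symmetric])
  then have "(\<integral>\<^sup>+w. ennreal (exp (- c * (norm (w::'a))\<^sup>2)) \<partial>lborel)
      = (\<integral>\<^sup>+w. (\<Prod>b\<in>(Basis::'a set). ennreal (exp (- c * (w \<bullet> b)\<^sup>2))) \<partial>lborel)"
    by (simp only:)
  also have "\<dots> = (\<Prod>b\<in>(Basis::'a set). \<integral>\<^sup>+x. ennreal (exp (- c * x\<^sup>2)) \<partial>lborel)"
    by (rule nn_integral_lborel_prod[where f="\<lambda>_ x. ennreal (exp (- c * x\<^sup>2))"]) auto
  also have "\<dots> = (\<Prod>b\<in>(Basis::'a set). ennreal (sqrt (pi / c)))" unfolding 1 ..
  finally have "(\<integral>\<^sup>+w. ennreal (exp (- c * (norm (w::'a))\<^sup>2)) \<partial>lborel) = (\<Prod>b\<in>(Basis::'a set). ennreal (sqrt (pi / c)))" .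
  then show "(\<integral>\<^sup>+w. ennreal (exp (- c * (norm (w::'a))\<^sup>2)) \<partial>lborel) = ennreal (sqrt (pi / c) ^ DIM('a))"
    using assms by (simp add: ennreal_power)
qed (use assms in auto)

lemma integrable_exp_norm: "c > 0 \<Longrightarrow> integrable lborel (\<lambda>w::'a::euclidean_space. exp (- c * (norm w)\<^sup>2))"
  using has_bochner_integral_exp_norm by (auto simp: has_bochner_integral_iff)

definition gauss :: "'a::euclidean_space \<Rightarrow> real" where
  "gauss w = (2 * pi) powr (- real DIM('a) / 2) * exp (- (norm w)\<^sup>2 / 2)"

lemma integral_gauss: "(\<integral>w. gauss w \<partial>lborel) = 1"
proof -
  have *: "(\<integral>w. exp (- (1/2) * (norm (w::'a))\<^sup>2) \<partial>lborel) = sqrt (pi / (1/2)) ^ DIM('a)"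
    using has_bochner_integral_exp_norm[of "1/2", where 'a='a] by (auto simp: has_bochner_integral_iff)
  have "sqrt (2 * pi) ^ DIM('a) = (2 * pi) powr (real DIM('a) / 2)"
    by (simp add: powr_half_sqrt[symmetric] powr_powr powr_realpow[symmetric])
  then have "(2 * pi) powr (- real DIM('a) / 2) * sqrt (2 * pi) ^ DIM('a) = 1"
    by (simp add: powr_add[symmetric])
  with * show ?thesis unfolding gauss_def by (simp add: mult.commute)
qed

text \<open>This class of weights is stable under differentiation and under multiplication by linear
  forms. Spatial derivatives that fall on the Gaussian never leave it, and one family of
  integrability bounds covers all orders.\<close>

definition poly_gauss :: "('a::euclidean_space \<Rightarrow> real) \<Rightarrow> bool" where
  "poly_gauss h \<longleftrightarrow> (\<exists>p. real_polynomial_function p \<and> h = (\<lambda>w. p w * exp (- (norm w)\<^sup>2 / 2)))"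

lemma poly_gauss_gauss: "poly_gauss gauss"
  unfolding poly_gauss_def gauss_def[abs_def] by blast

lemma poly_gauss_mult: "real_polynomial_function p \<Longrightarrow> poly_gauss h \<Longrightarrow> poly_gauss (\<lambda>w. p w * h w)"
  unfolding poly_gauss_def
proof (elim exE conjE)
  fix q assume "real_polynomial_function p" "real_polynomial_function q" "h = (\<lambda>w. q w * exp (- (norm w)\<^sup>2 / 2))"
  then show "\<exists>pa. real_polynomial_function pa \<and> (\<lambda>w. p w * h w) = (\<lambda>w. pa w * exp (- (norm w)\<^sup>2 / 2))"
    by (intro exI[of _ "\<lambda>w. p w * q w"]) (auto simp: mult.assoc)
qed

lemma poly_gauss_inner: "poly_gauss h \<Longrightarrow> poly_gauss (\<lambda>w. (w \<bullet> m) * h w)"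
  by (rule poly_gauss_mult) (auto intro: bounded_linear_inner_left)

lemma real_polynomial_function_has_derivative:
  assumes "real_polynomial_function (p :: 'a::real_normed_vector \<Rightarrow> real)"
  shows "\<exists>p'. (\<forall>x. (p has_derivative p' x) (at x)) \<and> (\<forall>v. real_polynomial_function (\<lambda>x. p' x v))"
  using assms
proof induction
  case (linear f)
  then show ?case
    by (intro exI[of _ "\<lambda>_. f"]) (auto simp: bounded_linear_imp_has_derivative)
next
  case (const c)
  show ?case by (intro exI[of _ "\<lambda>_ _. 0"]) auto
next
  case (add f g)
  then obtain f' g' where "(\<forall>x. (f has_derivative f' x) (at x)) \<and> (\<forall>v. real_polynomial_function (\<lambda>x. f' x v))"
    "(\<forall>x. (g has_derivative g' x) (at x)) \<and> (\<forall>v. real_polynomial_function (\<lambda>x. g' x v))" by blast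
  then show ?case
    by (intro exI[of _ "\<lambda>x v. f' x v + g' x v"]) (auto intro!: derivative_intros)
next
  case (mult f g)
  then obtain f' g' where "(\<forall>x. (f has_derivative f' x) (at x)) \<and> (\<forall>v. real_polynomial_function (\<lambda>x. f' x v))"
    "(\<forall>x. (g has_derivative g' x) (at x)) \<and> (\<forall>v. real_polynomial_function (\<lambda>x. g' x v))" by blast
  with mult.hyps show ?case
    by (intro exI[of _ "\<lambda>x v. f x * g' x v + f' x v * g x"])
       (auto intro!: has_derivative_mult real_polynomial_function.intros(3) real_polynomial_function.intros(4))
qed

lemma has_derivative_exp_norm:
  fixes w :: "'a::real_inner"
  shows "((\<lambda>w. exp (- (norm w)\<^sup>2 / 2)) has_derivative (\<lambda>v. - (w \<bullet> v) * exp (- (norm w)\<^sup>2 / 2))) (at w)"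
  unfolding power2_norm_eq_inner
  by (auto intro!: derivative_eq_intros simp: inner_commute)

lemma poly_gauss_has_derivative:
  assumes "poly_gauss h"
  shows "(h has_derivative frechet_derivative h (at w)) (at w)"
    and "poly_gauss (\<lambda>w. frechet_derivative h (at w) v)"
proof -
  obtain p where p: "real_polynomial_function p" "h = (\<lambda>w. p w * exp (- (norm w)\<^sup>2 / 2))"
    using assms unfolding poly_gauss_def by blast
  obtain p' where p': "\<And>x. (p has_derivative p' x) (at x)" "\<And>v. real_polynomial_function (\<lambda>x. p' x v)"
    using real_polynomial_function_has_derivative[OF p(1)] by blast
  have d: "(h has_derivative (\<lambda>v. p w * (- (w \<bullet> v) * exp (- (norm w)\<^sup>2 / 2)) + p' w v * exp (- (norm w)\<^sup>2 / 2))) (at w)" for w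
    unfolding p(2) by (intro has_derivative_mult p' has_derivative_exp_norm)
  then show "(h has_derivative frechet_derivative h (at w)) (at w)"
    using differentiableI frechet_derivative_works by blast
  have "frechet_derivative h (at w) = (\<lambda>v. p w * (- (w \<bullet> v) * exp (- (norm w)\<^sup>2 / 2)) + p' w v * exp (- (norm w)\<^sup>2 / 2))" for w
    by (rule frechet_derivative_at[OF d, symmetric])
  then have "(\<lambda>w. frechet_derivative h (at w) v)
      = (\<lambda>w. (p' w v + (- 1) * (p w * (w \<bullet> v))) * exp (- (norm w)\<^sup>2 / 2))"
    by (simp add: fun_eq_iff algebra_simps)
  moreover have "real_polynomial_function (\<lambda>w. p' w v + (- 1) * (p w * (w \<bullet> v)))"
    by (intro real_polynomial_function.intros(3) real_polynomial_function.intros(4) p' p(1)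
        real_polynomial_function.intros(2) real_polynomial_function.intros(1) bounded_linear_inner_left)
  ultimately show "poly_gauss (\<lambda>w. frechet_derivative h (at w) v)" unfolding poly_gauss_def by blast
qed

lemma poly_gauss_measurable: "poly_gauss h \<Longrightarrow> h \<in> borel_measurable borel"
  by (intro borel_measurable_continuous_onI continuous_at_imp_continuous_on ballI
      has_derivative_continuous[OF poly_gauss_has_derivative(1)])

text \<open>The arbitrary \<epsilon> is what carries the induction: a product of two polynomials
  spends one half of it on each factor.\<close>

lemma real_polynomial_function_growth:
  assumes "real_polynomial_function (p :: 'a::real_normed_vector \<Rightarrow> real)" "\<epsilon> > 0"
  shows "\<exists>C\<ge>0. \<forall>w. \<bar>p w\<bar> \<le> C * exp (\<epsilon> * (norm w)\<^sup>2)"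
  using assms
proof (induction arbitrary: \<epsilon>)
  case (linear f)
  obtain K where K: "K \<ge> 0" "\<And>x. norm (f x) \<le> norm x * K"
    using bounded_linear.nonneg_bounded[OF linear(1)] by blast
  have "\<bar>f w\<bar> \<le> K * (1 + 1 / \<epsilon>) * exp (\<epsilon> * (norm w)\<^sup>2)" for w
  proof -
    have "0 \<le> (norm w - 1)\<^sup>2" by simp
    then have "norm w \<le> 1 + (norm w)\<^sup>2" by (simp add: power2_diff) (smt (verit) norm_ge_zero)
    also have "\<dots> \<le> (1 + 1 / \<epsilon>) * (1 + \<epsilon> * (norm w)\<^sup>2)"
      using linear(2) by (simp add: field_simps)
    also have "\<dots> \<le> (1 + 1 / \<epsilon>) * exp (\<epsilon> * (norm w)\<^sup>2)"
      using linear(2) by (intro mult_left_mono exp_ge_add_one_self) auto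
    finally have "norm w * K \<le> (1 + 1 / \<epsilon>) * exp (\<epsilon> * (norm w)\<^sup>2) * K"
      by (rule mult_right_mono) (rule K)
    with K(2)[of w] show ?thesis by (simp add: mult_ac)
  qed
  moreover have "K * (1 + 1 / \<epsilon>) \<ge> 0" using K linear(2) by simp
  ultimately show ?case by blast
next
  case (const c)
  have "\<bar>c\<bar> * 1 \<le> \<bar>c\<bar> * exp (\<epsilon> * (norm w)\<^sup>2)" for w :: 'a
    using const by (intro mult_left_mono) auto
  then show ?case by (intro exI[of _ "\<bar>c\<bar>"]) auto
next
  case (add f g)
  obtain C D where "C \<ge> 0" "D \<ge> 0" and
    CD: "\<And>w. \<bar>f w\<bar> \<le> C * exp (\<epsilon> * (norm w)\<^sup>2)" "\<And>w. \<bar>g w\<bar> \<le> D * exp (\<epsilon> * (norm w)\<^sup>2)"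
    using add.IH[OF add.prems] by blast
  have "\<bar>f w + g w\<bar> \<le> (C + D) * exp (\<epsilon> * (norm w)\<^sup>2)" for w
    using CD[of w] abs_triangle_ineq[of "f w" "g w"] by (simp add: distrib_right)
  then show ?case using \<open>C \<ge> 0\<close> \<open>D \<ge> 0\<close> by (intro exI[of _ "C + D"]) auto
next
  case (mult f g)
  have "\<epsilon> / 2 > 0" using mult.prems by simp
  then obtain C D where "C \<ge> 0" "D \<ge> 0" and
    CD: "\<And>w. \<bar>f w\<bar> \<le> C * exp (\<epsilon> / 2 * (norm w)\<^sup>2)" "\<And>w. \<bar>g w\<bar> \<le> D * exp (\<epsilon> / 2 * (norm w)\<^sup>2)"
    using mult.IH by metis
  have "\<bar>f w * g w\<bar> \<le> (C * D) * exp (\<epsilon> * (norm w)\<^sup>2)" for w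
  proof -
    have "\<bar>f w * g w\<bar> \<le> (C * exp (\<epsilon> / 2 * (norm w)\<^sup>2)) * (D * exp (\<epsilon> / 2 * (norm w)\<^sup>2))"
      unfolding abs_mult using CD[of w] \<open>C \<ge> 0\<close> by (intro mult_mono) auto
    also have "\<dots> = (C * D) * exp (\<epsilon> * (norm w)\<^sup>2)" by (simp add: mult_ac exp_add[symmetric])
    finally show ?thesis .
  qed
  then show ?case using \<open>C \<ge> 0\<close> \<open>D \<ge> 0\<close> by (intro exI[of _ "C * D"]) auto
qed

text \<open>The polynomial costs a factor exp(|w - y|^2 / 4), which leaves exp(-|w - y|^2 / 4); then
  |w|^2 \<le> 2 |w - y|^2 + 2 |y|^2 moves the decay from w - y to \<open>w\<close>. The translates
  thus have an integrable majorant that is uniform for \<open>y\<close> in bounded sets.\<close>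

lemma poly_gauss_bound:
  assumes "poly_gauss (h :: 'a::euclidean_space \<Rightarrow> real)"
  shows "\<exists>C\<ge>0. \<forall>w y. \<bar>h (w - y)\<bar> \<le> C * exp ((norm y)\<^sup>2 / 4) * exp (- (1/8) * (norm w)\<^sup>2)"
proof -
  obtain p where p: "real_polynomial_function p" "h = (\<lambda>w. p w * exp (- (norm w)\<^sup>2 / 2))"
    using assms unfolding poly_gauss_def by blast
  obtain C where C: "C \<ge> 0" "\<And>w. \<bar>p w\<bar> \<le> C * exp (1/4 * (norm w)\<^sup>2)"
    using real_polynomial_function_growth[OF p(1), of "1/4"] by auto
  have "\<bar>h (w - y)\<bar> \<le> C * exp ((norm y)\<^sup>2 / 4) * exp (- (1/8) * (norm w)\<^sup>2)" for w y
  proof -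
    have "\<bar>h (w - y)\<bar> \<le> C * exp (1/4 * (norm (w - y))\<^sup>2) * exp (- (norm (w - y))\<^sup>2 / 2)"
      unfolding p(2) abs_mult using C(2) by (simp add: mult_right_mono)
    also have "\<dots> = C * exp (- (norm (w - y))\<^sup>2 / 4)" by (simp add: mult.assoc exp_add[symmetric])
    also have "\<dots> \<le> C * exp ((norm y)\<^sup>2 / 4 + - (1/8) * (norm w)\<^sup>2)"
    proof -
      have "norm w \<le> norm (w - y) + norm y" by (rule norm_triangle_sub[of w y, unfolded add.commute[of "norm y"]])
      then have "(norm w)\<^sup>2 \<le> (norm (w - y) + norm y)\<^sup>2" by (rule power_mono) simp
      also have "\<dots> \<le> 2 * (norm (w - y))\<^sup>2 + 2 * (norm y)\<^sup>2"
        using sum_squares_bound[of "norm (w - y)" "norm y"] by (simp add: power2_sum)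
      finally show ?thesis using C(1) by (intro mult_left_mono) auto
    qed
    finally show ?thesis by (simp only: exp_add mult.assoc)
  qed
  with C(1) show ?thesis by blast
qed

lemma poly_gauss_integrable: 
  assumes "poly_gauss h" shows "integrable lborel (\<lambda>w. h (w - y))"
proof -
  obtain C where C: "C \<ge> 0" "\<And>w y. \<bar>h (w - y)\<bar> \<le> C * exp ((norm y)\<^sup>2 / 4) * exp (- (1/8) * (norm w)\<^sup>2)"
    using poly_gauss_bound[OF assms] by blast
  show ?thesis
  proof (rule Bochner_Integration.integrable_bound)
    show "integrable lborel (\<lambda>w. (C * exp ((norm y)\<^sup>2 / 4)) * exp (- (1/8) * (norm w)\<^sup>2))"
      by (intro integrable_mult_right integrable_exp_norm) simp
    show "(\<lambda>w. h (w - y)) \<in> borel_measurable lborel"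
      using poly_gauss_measurable[OF assms] by measurable
  qed (use C in \<open>auto intro!: AE_I2\<close>)
qed

lemma poly_gauss_deriv_bound:
  assumes h: "poly_gauss (h :: 'a::euclidean_space \<Rightarrow> real)"
  shows "\<exists>C\<ge>0. \<forall>w y v. \<bar>frechet_derivative h (at (w - y)) v\<bar>
            \<le> C * exp ((norm y)\<^sup>2 / 4) * exp (- (1/8) * (norm w)\<^sup>2) * norm v"
proof -
  have "\<forall>b. \<exists>C. C \<ge> 0 \<and> (\<forall>w y. \<bar>frechet_derivative h (at (w - y)) b\<bar>
      \<le> C * exp ((norm y)\<^sup>2 / 4) * exp (- (1/8) * (norm w)\<^sup>2))"
    using poly_gauss_bound[OF poly_gauss_has_derivative(2)[OF h]] by blast
  from choice[OF this] obtain C where C: "\<And>b. C b \<ge> 0"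
    "\<And>b w y. \<bar>frechet_derivative h (at (w - y)) b\<bar>
      \<le> C b * exp ((norm y)\<^sup>2 / 4) * exp (- (1/8) * (norm w)\<^sup>2)" by blast
  have diff: "h differentiable at x" for x
    using poly_gauss_has_derivative(1)[OF h] differentiableI by blast
  have "\<bar>frechet_derivative h (at (w - y)) v\<bar>
      \<le> (\<Sum>b\<in>Basis. C b) * exp ((norm y)\<^sup>2 / 4) * exp (- (1/8) * (norm w)\<^sup>2) * norm v" for w y v
  proof -
    have "\<bar>frechet_derivative h (at (w - y)) v\<bar>
        = \<bar>\<Sum>b\<in>Basis. (v \<bullet> b) * frechet_derivative h (at (w - y)) b\<bar>"
      by (rule arg_cong[OF frechet_derivative_basis[OF diff]])
    also have "\<dots> \<le> (\<Sum>b\<in>Basis. \<bar>(v \<bullet> b) * frechet_derivative h (at (w - y)) b\<bar>)"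
      by (rule sum_abs)
    also have "\<dots> \<le> (\<Sum>b\<in>Basis. norm v * (C b * exp ((norm y)\<^sup>2 / 4) * exp (- (1/8) * (norm w)\<^sup>2)))"
      unfolding abs_mult by (intro sum_mono mult_mono C Basis_le_norm) auto
    finally show ?thesis by (simp add: sum_distrib_left sum_distrib_right mult_ac)
  qed
  moreover have "(\<Sum>b\<in>Basis. C b) \<ge> 0" by (rule sum_nonneg) (rule C(1))
  ultimately show ?thesis by blast
qed

text \<open>A derivative in \<open>x\<close> acts in two ways: through \<open>A\<close> it falls on
  \<open>f\<close>, through \<open>L\<close> on the Gaussian weight \<open>h\<close>. Every term is
  again an integral of the same kind with \<open>f\<close> or \<open>h\<close> differentiated, which
  permits iteration, and the choice of \<open>A\<close> and \<open>L\<close> decides where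
  derivatives land.\<close>

lemma gaussian_shift_integral_has_derivative:
  fixes f :: "'e::euclidean_space \<Rightarrow> real" and h :: "'m::euclidean_space \<Rightarrow> real"
    and A :: "'x::euclidean_space \<Rightarrow> 'e"
  assumes f: "bounded_smooth f" and h: "poly_gauss h"
    and A: "bounded_linear A" and R: "bounded_linear R" and L: "bounded_linear L"
  shows "integrable lborel (\<lambda>w. f (c + A x + R w) * h (w - L x))"
    and "((\<lambda>x. \<integral>w. f (c + A x + R w) * h (w - L x) \<partial>lborel) has_derivative
      (\<lambda>v. (\<Sum>b\<in>Basis. (A v \<bullet> b) * (\<integral>w. frechet_derivative f (at (c + A x + R w)) b * h (w - L x) \<partial>lborel))
         + (\<Sum>m\<in>Basis. (- (L v \<bullet> m)) * (\<integral>w. f (c + A x + R w) * frechet_derivative h (at (w - L x)) m \<partial>lborel))))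
      (at x)"
proof -
  have [measurable]: "R \<in> borel_measurable borel"
    using R by (intro borel_measurable_continuous_onI linear_continuous_on)
  have int: "integrable lborel (\<lambda>w. f (c + A x + R w) * h (w - L x))" 
    if f: "bounded_smooth f" and h: "poly_gauss h" for f :: "'e \<Rightarrow> real" and h :: "'m \<Rightarrow> real" and x
  proof -
    obtain M where M: "\<And>x. \<bar>f x\<bar> \<le> M" using uniform_smooth_bounded[OF f] by auto
    have [measurable]: "f \<in> borel_measurable borel" "h \<in> borel_measurable borel"
      using bounded_smooth_measurable[OF f] poly_gauss_measurable[OF h] .
    show ?thesis
    proof (rule Bochner_Integration.integrable_bound)
      show "integrable lborel (\<lambda>w. M * \<bar>h (w - L x)\<bar>)"
        by (intro integrable_mult_right integrable_abs poly_gauss_integrable h)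
      show "AE w in lborel. norm (f (c + A x + R w) * h (w - L x)) \<le> norm (M * \<bar>h (w - L x)\<bar>)"
        using M by (intro AE_I2) (auto simp: abs_mult intro!: mult_right_mono intro: order_trans[OF M abs_ge_self])
    qed measurable
  qed
  show "integrable lborel (\<lambda>w. f (c + A x + R w) * h (w - L x))" by (rule int[OF f h])
  obtain M where M: "M \<ge> 0" "\<And>x. \<bar>f x\<bar> \<le> M" using uniform_smooth_bounded[OF f] by auto
  obtain M' where M': "M' \<ge> 0" "\<And>x v. \<bar>frechet_derivative f (at x) v\<bar> \<le> M' * norm v"
    using uniform_smooth_deriv_bound[OF f] by auto
  obtain C where C: "C \<ge> 0" "\<And>w y. \<bar>h (w - y)\<bar> \<le> C * exp ((norm y)\<^sup>2 / 4) * exp (- (1/8) * (norm w)\<^sup>2)"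
    using poly_gauss_bound[OF h] by auto
  obtain D where D: "D \<ge> 0" "\<And>w y v. \<bar>frechet_derivative h (at (w - y)) v\<bar>
      \<le> D * exp ((norm y)\<^sup>2 / 4) * exp (- (1/8) * (norm w)\<^sup>2) * norm v"
    using poly_gauss_deriv_bound[OF h] by auto
  obtain KA where KA: "KA \<ge> 0" "\<And>v. norm (A v) \<le> norm v * KA" using bounded_linear.nonneg_bounded[OF A] by blast
  obtain KL where KL: "KL \<ge> 0" "\<And>v. norm (L v) \<le> norm v * KL" using bounded_linear.nonneg_bounded[OF L] by blast
  \<comment> \<open>Majorant for the factor exp(|L y|^2 / 4) of the shifted weight, valid for
    \<open>y\<close> in the unit ball about \<open>x\<close>.\<close>
  define E where "E = exp (((norm x + 1) * KL)\<^sup>2 / 4)"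
  define G where "G w = (M' * KA * C + M * D * KL) * E * exp (- (1/8) * (norm w)\<^sup>2)" for w :: 'm
  let ?f' = "\<lambda>y w v. f (c + A y + R w) * frechet_derivative h (at (w - L y)) (- L v)
      + frechet_derivative f (at (c + A y + R w)) (A v) * h (w - L y)"
  have E: "exp ((norm (L y))\<^sup>2 / 4) \<le> E" if "y \<in> ball x 1" for y
  proof -
    have "norm y \<le> norm x + 1" using that norm_triangle_sub[of y x] by (auto simp: dist_norm norm_minus_commute)
    then have "norm (L y) \<le> (norm x + 1) * KL"
      using KL by (meson mult_right_mono order_trans)
    then show ?thesis unfolding E_def by (auto intro: power_mono)
  qed
  have E0: "E \<ge> 0" unfolding E_def by simp
  have lf: "frechet_derivative f (at z) v = (\<Sum>b\<in>Basis. (v \<bullet> b) * frechet_derivative f (at z) b)" for z v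
    by (rule frechet_derivative_basis[OF uniform_smooth_differentiable[OF f]]) simp
  have lh: "frechet_derivative h (at z) v = (\<Sum>b\<in>Basis. (v \<bullet> b) * frechet_derivative h (at z) b)" for z v
    by (rule frechet_derivative_basis[OF differentiableI[OF poly_gauss_has_derivative(1)[OF h]]])
  have main: "((\<lambda>x. \<integral>w. f (c + A x + R w) * h (w - L x) \<partial>lborel) has_derivative (\<lambda>v. \<integral>w. ?f' x w v \<partial>lborel)) (at x)"
  proof (rule has_derivative_integral(1)[where e=1 and g=G])
    show "((\<lambda>y. f (c + A y + R w) * h (w - L y)) has_derivative ?f' y w) (at y)" for y w
    proof (rule has_derivative_mult)
      show "((\<lambda>y. f (c + A y + R w)) has_derivative (\<lambda>v. frechet_derivative f (at (c + A y + R w)) (A v))) (at y)"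
        by (rule has_derivative_compose[OF _ bounded_smooth_has_derivative[OF f]])
           (auto intro!: derivative_eq_intros bounded_linear_imp_has_derivative A)
      show "((\<lambda>y. h (w - L y)) has_derivative (\<lambda>v. frechet_derivative h (at (w - L y)) (- L v))) (at y)"
        by (rule has_derivative_compose[OF _ poly_gauss_has_derivative(1)[OF h]])
           (auto intro!: derivative_eq_intros bounded_linear_imp_has_derivative L)
    qed
    show "integrable lborel (\<lambda>w. f (c + A y + R w) * h (w - L y))" for y by (rule int[OF f h])
    show "(\<lambda>w. ?f' x w v) \<in> borel_measurable lborel" for v
      using bounded_smooth_measurable[OF f] poly_gauss_measurable[OF h]
        bounded_smooth_measurable[OF uniform_smooth_deriv[OF f, of "A v"]]
        poly_gauss_measurable[OF poly_gauss_has_derivative(2)[OF h, of "- L v"]]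
      by measurable
    show "integrable lborel G" unfolding G_def
      by (intro integrable_mult_right integrable_exp_norm) simp
    show "\<bar>?f' y w v\<bar> \<le> G w * norm v" if "y \<in> ball x 1" for y w v
    proof -
      let ?e = "exp (- (1/8) * (norm w)\<^sup>2)"
      have "\<bar>?f' y w v\<bar> \<le> \<bar>f (c + A y + R w)\<bar> * \<bar>frechet_derivative h (at (w - L y)) (- L v)\<bar>
         + \<bar>frechet_derivative f (at (c + A y + R w)) (A v)\<bar> * \<bar>h (w - L y)\<bar>"
        by (rule order_trans[OF abs_triangle_ineq]) (simp add: abs_mult)
      also have "\<dots> \<le> M * (D * E * ?e * (norm v * KL)) + M' * (norm v * KA) * (C * E * ?e)"
      proof (intro add_mono mult_mono M M')
        show "\<bar>frechet_derivative h (at (w - L y)) (- L v)\<bar> \<le> D * E * ?e * (norm v * KL)"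
          by (rule order_trans[OF D(2)]) (use D(1) KL E[OF that] E0 in \<open>auto intro!: mult_mono\<close>)
        show "\<bar>frechet_derivative f (at (c + A y + R w)) (A v)\<bar> \<le> M' * (norm v * KA)"
          by (rule order_trans[OF M'(2)]) (use M' KA in \<open>auto intro!: mult_mono\<close>)
        show "\<bar>h (w - L y)\<bar> \<le> C * E * ?e"
          by (rule order_trans[OF C(2)]) (use C(1) E[OF that] E0 in \<open>auto intro!: mult_mono\<close>)
      qed (use M M' KA in auto)
      also have "\<dots> = G w * norm v" unfolding G_def by (simp add: algebra_simps)
      finally show ?thesis .
    qed
  qed simp
  moreover have "(\<integral>w. ?f' x w v \<partial>lborel)
      = (\<Sum>b\<in>Basis. (A v \<bullet> b) * (\<integral>w. frechet_derivative f (at (c + A x + R w)) b * h (w - L x) \<partial>lborel))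
         + (\<Sum>m\<in>Basis. (- (L v \<bullet> m)) * (\<integral>w. f (c + A x + R w) * frechet_derivative h (at (w - L x)) m \<partial>lborel))" for v
  proof -
    have "?f' x w v = (\<Sum>b\<in>Basis. (A v \<bullet> b) * (frechet_derivative f (at (c + A x + R w)) b * h (w - L x)))
       + (\<Sum>m\<in>Basis. (- (L v \<bullet> m)) * (f (c + A x + R w) * frechet_derivative h (at (w - L x)) m))" for w
      by (subst lf[of _ "A v"], subst lh[of _ "- L v"])
         (simp add: sum_distrib_left sum_distrib_right mult_ac inner_minus_left sum_negf)
    moreover have "integrable lborel (\<lambda>w. frechet_derivative f (at (c + A x + R w)) b * h (w - L x))" for b
      by (rule int[OF uniform_smooth_deriv[OF f] h])
    moreover have "integrable lborel (\<lambda>w. f (c + A x + R w) * frechet_derivative h (at (w - L x)) m)" for m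
      by (rule int[OF f poly_gauss_has_derivative(2)[OF h]])
    ultimately show ?thesis by simp
  qed
  ultimately show "((\<lambda>x. \<integral>w. f (c + A x + R w) * h (w - L x) \<partial>lborel) has_derivative
      (\<lambda>v. (\<Sum>b\<in>Basis. (A v \<bullet> b) * (\<integral>w. frechet_derivative f (at (c + A x + R w)) b * h (w - L x) \<partial>lborel))
         + (\<Sum>m\<in>Basis. (- (L v \<bullet> m)) * (\<integral>w. f (c + A x + R w) * frechet_derivative h (at (w - L x)) m \<partial>lborel))))
      (at x)" by simp
qed

text \<open>Each derivative contributes only coordinates of \<open>A i v\<close> or
  \<open>L i v\<close>, controlled by \<open>K\<close>, while the remaining integral is at most the
  supremum of |f| times the L^1 norm of the weight. The maps \<open>R i\<close> may therefore grow
  without bound in \<open>i\<close>.\<close>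

lemma gaussian_shift_integral_uniform_smooth:
  fixes f :: "'e::euclidean_space \<Rightarrow> real" and h :: "'m::euclidean_space \<Rightarrow> real"
    and A :: "'i \<Rightarrow> 'x::euclidean_space \<Rightarrow> 'e"
  assumes "bounded_smooth f" "poly_gauss h"
    and lin: "\<And>i. i \<in> I \<Longrightarrow> bounded_linear (A i)" "\<And>i. i \<in> I \<Longrightarrow> bounded_linear (R i)"
      "\<And>i. i \<in> I \<Longrightarrow> bounded_linear (L i)"
    and K: "\<And>i v. i \<in> I \<Longrightarrow> norm (A i v) \<le> K * norm v" "\<And>i v. i \<in> I \<Longrightarrow> norm (L i v) \<le> K * norm v"
  shows "uniform_smooth I (\<lambda>i x. \<integral>w. f (c i + A i x + R i w) * h (w - L i x) \<partial>lborel)"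
  unfolding uniform_smooth_def
proof
  have bnd0: "\<exists>M. \<forall>i\<in>I. \<forall>x. \<bar>\<integral>w. f (c i + A i x + R i w) * h (w - L i x) \<partial>lborel\<bar> \<le> M"
    if f: "bounded_smooth f" and h: "poly_gauss h" for f :: "'e \<Rightarrow> real" and h :: "'m \<Rightarrow> real"
  proof -
    obtain M where M: "M \<ge> 0" "\<And>x. \<bar>f x\<bar> \<le> M" using uniform_smooth_bounded[OF f] by auto
    have "\<bar>\<integral>w. f (c i + A i x + R i w) * h (w - L i x) \<partial>lborel\<bar> \<le> M * (\<integral>w. \<bar>h w\<bar> \<partial>lborel)" if "i \<in> I" for i x
    proof -
      note int = gaussian_shift_integral_has_derivative(1)[OF f h lin[OF that], of "c i" x]
      note int' = poly_gauss_integrable[OF h, of "L i x"]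
      have "\<bar>\<integral>w. f (c i + A i x + R i w) * h (w - L i x) \<partial>lborel\<bar> \<le> (\<integral>w. \<bar>f (c i + A i x + R i w) * h (w - L i x)\<bar> \<partial>lborel)"
        by (rule integral_abs_bound)
      also have "\<dots> \<le> (\<integral>w. M * \<bar>h (w - L i x)\<bar> \<partial>lborel)"
      proof (rule integral_mono)
        show "\<bar>f (c i + A i x + R i w) * h (w - L i x)\<bar> \<le> M * \<bar>h (w - L i x)\<bar>" for w
          unfolding abs_mult by (intro mult_right_mono M) auto
      qed (intro integrable_abs integrable_mult_right int int')+
      \<comment> \<open>Translation invariance removes the shift, so the bound does not see
        \<open>i\<close> or \<open>x\<close>.\<close>
      also have "\<dots> = M * (\<integral>w. \<bar>h w\<bar> \<partial>lborel)"
        using lborel_translate(1)[of "\<lambda>w. \<bar>h w\<bar>" "- L i x"] poly_gauss_measurable[OF h] by simp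
      finally show ?thesis .
    qed
    then show ?thesis by auto
  qed
  fix n
  show "uniform_smooth_upto n I (\<lambda>i x. \<integral>w. f (c i + A i x + R i w) * h (w - L i x) \<partial>lborel)"
    using assms(1,2)
  proof (induction n arbitrary: f h)
    case 0
    then show ?case using bnd0 by simp
  next
    case (Suc n)
    note f = Suc.prems(1) and h = Suc.prems(2)
    let ?F = "\<lambda>i x. \<integral>w. f (c i + A i x + R i w) * h (w - L i x) \<partial>lborel"
    have d: "(?F i has_derivative
      (\<lambda>v. (\<Sum>b\<in>Basis. (A i v \<bullet> b) * (\<integral>w. frechet_derivative f (at (c i + A i x + R i w)) b * h (w - L i x) \<partial>lborel))
         + (\<Sum>m\<in>Basis. (- (L i v \<bullet> m)) * (\<integral>w. f (c i + A i x + R i w) * frechet_derivative h (at (w - L i x)) m \<partial>lborel))))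
      (at x)" if "i \<in> I" for i x
      by (rule gaussian_shift_integral_has_derivative(2)[OF f h lin[OF that]])
    have bnd: "\<bar>A i v \<bullet> b\<bar> \<le> K * norm v" if "i \<in> I" "b \<in> Basis" for i v b
      using Basis_le_norm[OF that(2), of "A i v"] K(1)[OF that(1), of v] by linarith
    have bnd': "\<bar>- (L i v \<bullet> b)\<bar> \<le> K * norm v" if "i \<in> I" "b \<in> Basis" for i v b
      using Basis_le_norm[OF that(2), of "L i v"] K(2)[OF that(1), of v] by linarith
    have "uniform_smooth_upto n I (\<lambda>i x. 
         (\<Sum>b\<in>Basis. (A i v \<bullet> b) * (\<integral>w. frechet_derivative f (at (c i + A i x + R i w)) b * h (w - L i x) \<partial>lborel))
         + (\<Sum>m\<in>Basis. (- (L i v \<bullet> m)) * (\<integral>w. f (c i + A i x + R i w) * frechet_derivative h (at (w - L i x)) m \<partial>lborel)))" for v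
      by (intro uniform_smooth_upto_add uniform_smooth_upto_sum
          uniform_smooth_upto_cmult[where K="K * norm v"] Suc.IH f h uniform_smooth_deriv
          poly_gauss_has_derivative(2) bnd bnd') auto
    then have "uniform_smooth_upto n I (\<lambda>i x. frechet_derivative (?F i) (at x) v)" for v
      by (subst uniform_smooth_upto_cong) (simp_all only: frechet_derivative_at[OF d, symmetric])
    moreover have "\<forall>i\<in>I. \<forall>x. ?F i differentiable at x" using d differentiableI by blast
    ultimately show ?case using bnd0[OF f h] by simp
  qed
qed

text \<open>The integral of \<open>g gauss\<close> is invariant under translation in the direction \<open>m\<close>; the identity is the
  vanishing of its derivative.\<close>
lemma gaussian_integration_by_parts:
  fixes g :: "'m::euclidean_space \<Rightarrow> real"
  assumes g: "\<And>w. (g has_derivative g' w) (at w)" and meas: "\<And>v. (\<lambda>w. g' w v) \<in> borel_measurable borel"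
    and M: "\<And>w. \<bar>g w\<bar> \<le> M" "\<And>w v. \<bar>g' w v\<bar> \<le> M * norm v"
  shows "(\<integral>w. (w \<bullet> m) * g w * gauss w \<partial>lborel) = (\<integral>w. g' w m * gauss w \<partial>lborel)"
    and "integrable lborel (\<lambda>w. (w \<bullet> m) * g w * gauss w)"
proof -
  note pg = poly_gauss_gauss[where 'a='m]
  have [measurable]: "g \<in> borel_measurable borel"
    by (intro borel_measurable_continuous_onI continuous_at_imp_continuous_on ballI
        has_derivative_continuous[OF g])
  have [measurable]: "gauss \<in> borel_measurable (borel::'m measure)"
    by (rule poly_gauss_measurable[OF pg])
  have M0: "M \<ge> 0" using M(1)[of 0] by linarith
  let ?f = "\<lambda>h w. g (w + h *\<^sub>R m) * gauss (w + h *\<^sub>R m)"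
  let ?f' = "\<lambda>h w k. k * (g' (w + h *\<^sub>R m) m * gauss (w + h *\<^sub>R m)
      - g (w + h *\<^sub>R m) * ((w + h *\<^sub>R m) \<bullet> m) * gauss (w + h *\<^sub>R m))"
  have dg: "((gauss :: 'm \<Rightarrow> real) has_derivative (\<lambda>v. - (w \<bullet> v) * gauss w)) (at w)" for w
    using has_derivative_mult_right[OF has_derivative_exp_norm, of "(2 * pi) powr (- real DIM('m) / 2)" w]
    unfolding gauss_def[abs_def] by (simp add: mult_ac)
  obtain C where C: "C \<ge> 0" "\<And>w y::'m. \<bar>gauss (w - y)\<bar> \<le> C * exp ((norm y)\<^sup>2 / 4) * exp (- (1/8) * (norm w)\<^sup>2)"
    using poly_gauss_bound[OF pg] by auto
  obtain D where D: "D \<ge> 0" "\<And>w y::'m. \<bar>((w - y) \<bullet> m) * gauss (w - y)\<bar> \<le> D * exp ((norm y)\<^sup>2 / 4) * exp (- (1/8) * (norm w)\<^sup>2)"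
    using poly_gauss_bound[OF poly_gauss_inner[OF pg, of m]] by auto
  define E where "E = exp ((norm m)\<^sup>2 / 4)"
  have E: "exp ((norm (- h *\<^sub>R m))\<^sup>2 / 4) \<le> E" if "h \<in> ball 0 1" for h
  proof -
    have "norm (- h *\<^sub>R m) \<le> norm m"
      using that mult_right_mono[of "\<bar>h\<bar>" 1 "norm m"] by (simp add: dist_norm)
    then show ?thesis unfolding E_def by (auto intro: power_mono)
  qed
  have int0: "integrable lborel (\<lambda>w. g w * gauss w)" and int1: "integrable lborel (\<lambda>w. (w \<bullet> m) * g w * gauss w)"
  proof -
    have int: "integrable lborel (\<lambda>w. g w * h w)" if "poly_gauss h" for h
    proof (rule Bochner_Integration.integrable_bound)
      show "integrable lborel (\<lambda>w. M * \<bar>h w\<bar>)"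
        using poly_gauss_integrable[OF that, of 0] by simp
      show "(\<lambda>w. g w * h w) \<in> borel_measurable lborel" using poly_gauss_measurable[OF that] by measurable
      show "AE w in lborel. norm (g w * h w) \<le> norm (M * \<bar>h w\<bar>)"
        using M(1) M0 by (intro AE_I2) (auto simp: abs_mult intro!: mult_right_mono)
    qed
    from int[OF pg] show "integrable lborel (\<lambda>w. g w * gauss w)" .
    from int[OF poly_gauss_inner[OF pg, of m]] show "integrable lborel (\<lambda>w. (w \<bullet> m) * g w * gauss w)"
      by (simp add: mult_ac)
  qed
  have lin: "g' w (k *\<^sub>R m) = k * g' w m" for w k
    using linear_cmul[OF has_derivative_linear[OF g]] by simp
  have fd: "((\<lambda>h. ?f h w) has_derivative ?f' h w) (at h)" for h w
  proof -
    have "((\<lambda>h. ?f h w) has_derivative (\<lambda>k. g (w + h *\<^sub>R m) * (- ((w + h *\<^sub>R m) \<bullet> (k *\<^sub>R m)) * gauss (w + h *\<^sub>R m))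
        + g' (w + h *\<^sub>R m) (k *\<^sub>R m) * gauss (w + h *\<^sub>R m))) (at h)"
    proof (rule has_derivative_mult)
      show "((\<lambda>h. g (w + h *\<^sub>R m)) has_derivative (\<lambda>k. g' (w + h *\<^sub>R m) (k *\<^sub>R m))) (at h)"
        by (rule has_derivative_compose[OF _ g]) (auto intro!: derivative_eq_intros)
      show "((\<lambda>h. gauss (w + h *\<^sub>R m)) has_derivative (\<lambda>k. - ((w + h *\<^sub>R m) \<bullet> (k *\<^sub>R m)) * gauss (w + h *\<^sub>R m))) (at h)"
        by (rule has_derivative_compose[OF _ dg]) (auto intro!: derivative_eq_intros)
    qed
    then show ?thesis by (rule has_derivative_eq_rhs) (simp add: lin fun_eq_iff algebra_simps)
  qed
  let ?G = "\<lambda>w::'m. (M * norm m * C + M * D) * E * exp (- (1/8) * (norm w)\<^sup>2)"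
  have bd: "\<bar>?f' h w k\<bar> \<le> ?G w * norm k" if "h \<in> ball 0 1" for h w k
  proof -
    let ?e = "exp (- (1/8) * (norm w)\<^sup>2)"
    have 1: "\<bar>gauss (w + h *\<^sub>R m)\<bar> \<le> C * E * ?e"
    proof -
      have "C * exp ((norm (- h *\<^sub>R m))\<^sup>2 / 4) * ?e \<le> C * E * ?e"
        by (intro mult_right_mono mult_left_mono E[OF that] C(1)) simp
      with C(2)[of w "- h *\<^sub>R m"] show ?thesis by simp
    qed
    have 2: "\<bar>((w + h *\<^sub>R m) \<bullet> m) * gauss (w + h *\<^sub>R m)\<bar> \<le> D * E * ?e"
    proof -
      have "D * exp ((norm (- h *\<^sub>R m))\<^sup>2 / 4) * ?e \<le> D * E * ?e"
        by (intro mult_right_mono mult_left_mono E[OF that] D(1)) simp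
      with D(2)[of w "- h *\<^sub>R m"] show ?thesis by simp
    qed
    have "\<bar>g' (w + h *\<^sub>R m) m * gauss (w + h *\<^sub>R m) - g (w + h *\<^sub>R m) * ((w + h *\<^sub>R m) \<bullet> m) * gauss (w + h *\<^sub>R m)\<bar>
      \<le> \<bar>g' (w + h *\<^sub>R m) m\<bar> * \<bar>gauss (w + h *\<^sub>R m)\<bar> + \<bar>g (w + h *\<^sub>R m)\<bar> * \<bar>((w + h *\<^sub>R m) \<bullet> m) * gauss (w + h *\<^sub>R m)\<bar>"
      by (rule order_trans[OF abs_triangle_ineq4]) (simp add: abs_mult)
    also have "\<dots> \<le> (M * norm m) * (C * E * ?e) + M * (D * E * ?e)"
      by (intro add_mono mult_mono M 1 2) (use M0 in auto)
    also have "\<dots> = ?G w" by (simp add: algebra_simps)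
    finally show ?thesis unfolding abs_mult by (simp add: mult_left_mono mult.commute)
  qed
  have meas': "(\<lambda>w. ?f' 0 w k) \<in> borel_measurable lborel" for k using meas[of m] by simp
  have intf: "integrable lborel (?f h)" for h
    using lborel_translate(2)[of "\<lambda>w. g w * gauss w" "h *\<^sub>R m"] int0 by simp
  have intG: "integrable lborel ?G" by (intro integrable_mult_right integrable_exp_norm) simp
  have der: "((\<lambda>h. \<integral>w. ?f h w \<partial>lborel) has_derivative (\<lambda>k. \<integral>w. ?f' 0 w k \<partial>lborel)) (at 0)"
    by (rule has_derivative_integral(1)[where e=1 and g="?G"];
        (rule zero_less_one fd intf meas' intG | erule bd))
  have int: "integrable lborel (\<lambda>w. ?f' 0 w 1)"
    by (rule has_derivative_integral(2)[where e=1 and g="?G" and f="?f" and x=0];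
        (rule zero_less_one fd intf meas' intG | erule bd))
  have "(\<integral>w. ?f h w \<partial>lborel) = (\<integral>w. g w * gauss w \<partial>lborel)" for h
    using lborel_translate(1)[of "\<lambda>w. g w * gauss w" "h *\<^sub>R m"] by simp
  with der have "((\<lambda>h. \<integral>w. g w * gauss w \<partial>lborel) has_derivative (\<lambda>k. \<integral>w. ?f' 0 w k \<partial>lborel)) (at (0::real))"
    by simp
  from has_derivative_unique[OF this has_derivative_const] have "(\<integral>w. ?f' 0 w 1 \<partial>lborel) = 0" by meson
  then have 0: "(\<integral>w. g' w m * gauss w - (w \<bullet> m) * g w * gauss w \<partial>lborel) = 0" by (simp add: mult_ac)
  have i: "integrable lborel (\<lambda>w. g' w m * gauss w)"
    using Bochner_Integration.integrable_add[OF int int1] by (simp add: mult_ac)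
  show "integrable lborel (\<lambda>w. (w \<bullet> m) * g w * gauss w)" by (rule int1)
  show "(\<integral>w. (w \<bullet> m) * g w * gauss w \<partial>lborel) = (\<integral>w. g' w m * gauss w \<partial>lborel)"
    using 0 Bochner_Integration.integral_diff[OF i int1] by simp
qed

section \<open>Linear changes of variables\<close>

text \<open>By Fubini the coordinate along \<open>e\<close> is integrated first; with the other
  coordinates frozen the shear is a translation of the real line.\<close>

lemma nn_integral_lborel_shear:
  fixes g :: "'a::euclidean_space \<Rightarrow> ennreal"
  assumes [measurable]: "g \<in> borel_measurable borel" and e: "e \<in> Basis" "d \<in> Basis" "e \<noteq> d"
  shows "(\<integral>\<^sup>+x. g (x + (c * (x \<bullet> d)) *\<^sub>R e) \<partial>lborel) = (\<integral>\<^sup>+x. g x \<partial>lborel)"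
proof -
  interpret product_sigma_finite "\<lambda>_::'a. lborel :: real measure" by standard
  let ?S = "\<lambda>f::'a \<Rightarrow> real. \<Sum>b\<in>Basis. f b *\<^sub>R b"
  let ?I = "Basis - {e}"
  have ins: "Basis = insert e ?I" using e by auto
  have fold: "(\<integral>\<^sup>+x. h x \<partial>lborel) = (\<integral>\<^sup>+f. (\<integral>\<^sup>+y. h (?S (f(e := y))) \<partial>lborel) \<partial>(Pi\<^sub>M ?I (\<lambda>_. lborel)))"
    if [measurable]: "h \<in> borel_measurable borel" for h :: "'a \<Rightarrow> ennreal"
  proof -
    have "(\<integral>\<^sup>+x. h x \<partial>lborel) = (\<integral>\<^sup>+f. h (?S f) \<partial>(Pi\<^sub>M Basis (\<lambda>_. lborel)))"
      by (subst lborel_eq, subst nn_integral_distr) auto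
    also have "\<dots> = (\<integral>\<^sup>+f. h (?S f) \<partial>(Pi\<^sub>M (insert e ?I) (\<lambda>_. lborel)))"
      by (simp only: ins[symmetric])
    also have "\<dots> = (\<integral>\<^sup>+f. (\<integral>\<^sup>+y. h (?S (f(e := y))) \<partial>lborel) \<partial>(Pi\<^sub>M ?I (\<lambda>_. lborel)))"
    proof (rule product_nn_integral_insert)
      show "(\<lambda>f. h (?S f)) \<in> borel_measurable (Pi\<^sub>M (insert e ?I) (\<lambda>_. lborel))"
        unfolding ins[symmetric] by measurable
    qed auto
    finally show ?thesis .
  qed
  \<comment> \<open>The product \<open>1 * y\<close> gives the inner integral the affine shape of
    \<open>nn_integral_real_affine\<close>.\<close>
  have S: "?S (f(e := y)) + (c * (?S (f(e := y)) \<bullet> d)) *\<^sub>R e = ?S (f(e := c * f d + 1 * y))" for f y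
  proof -
    have 1: "?S (f(e := y)) \<bullet> d = f d" using e by (subst inner_sum_left_Basis) auto
    have 2: "?S (f(e := z)) = z *\<^sub>R e + (\<Sum>b\<in>?I. f b *\<^sub>R b)" for z
      by (subst ins, subst sum.insert) (auto intro!: sum.cong)
    show ?thesis unfolding 1 unfolding 2 by (simp add: algebra_simps)
  qed
  have "(\<integral>\<^sup>+x. g (x + (c * (x \<bullet> d)) *\<^sub>R e) \<partial>lborel)
      = (\<integral>\<^sup>+f. (\<integral>\<^sup>+y. g (?S (f(e := c * f d + 1 * y))) \<partial>lborel) \<partial>(Pi\<^sub>M ?I (\<lambda>_. lborel)))"
    unfolding S[symmetric] by (rule fold) measurable
  also have "\<dots> = (\<integral>\<^sup>+f. (\<integral>\<^sup>+y. g (?S (f(e := y))) \<partial>lborel) \<partial>(Pi\<^sub>M ?I (\<lambda>_. lborel)))"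
  proof (rule nn_integral_cong)
    fix f
    have m: "(\<lambda>y. g (?S (f(e := y)))) \<in> borel_measurable borel"
    proof -
      have 2: "?S (f(e := z)) = z *\<^sub>R e + (\<Sum>b\<in>?I. f b *\<^sub>R b)" for z
        by (subst ins, subst sum.insert) (auto intro!: sum.cong)
      show ?thesis unfolding 2 by measurable
    qed
    show "(\<integral>\<^sup>+y. g (?S (f(e := c * f d + 1 * y))) \<partial>lborel) = (\<integral>\<^sup>+y. g (?S (f(e := y))) \<partial>lborel)"
      using nn_integral_real_affine[OF m, of 1 "c * f d"] by simp
  qed
  also have "\<dots> = (\<integral>\<^sup>+x. g x \<partial>lborel)" by (rule fold[symmetric]) measurable
  finally show ?thesis .
qed

lemma prod_Basis_vec: "(\<Prod>b\<in>(Basis :: (real^'n) set). f b) = (\<Prod>i\<in>UNIV. f (axis i 1))"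
proof -
  have "(Basis :: (real^'n) set) = (\<lambda>i. axis i 1) ` UNIV" by (auto dest: axis_inverse)
  then have "bij_betw (\<lambda>i. axis i 1) UNIV (Basis :: (real^'n) set)"
    by (auto simp: bij_betw_def inj_on_def axis_eq_axis)
  then show ?thesis by (rule prod.reindex_bij_betw[symmetric])
qed

lemma sum_Basis_vec: "(\<Sum>b\<in>(Basis :: (real^'n) set). f b) = (\<Sum>i\<in>UNIV. f (axis i 1))"
proof -
  have "(Basis :: (real^'n) set) = (\<lambda>i. axis i 1) ` UNIV" by (auto dest: axis_inverse)
  then have "bij_betw (\<lambda>i. axis i 1) UNIV (Basis :: (real^'n) set)"
    by (auto simp: bij_betw_def inj_on_def axis_eq_axis)
  then show ?thesis by (rule sum.reindex_bij_betw[symmetric])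
qed

text \<open>Lebesgue measure is determined by its values on boxes, and the preimage of a box is the
  box with permuted sides.\<close>

lemma lborel_permute_coordinates:
  assumes p: "p permutes (UNIV :: 'n::finite set)"
  shows "lborel = distr lborel borel (\<lambda>x :: real^'n. \<chi> i. x $ p i)"
proof (rule lborel_eqI)
  let ?T = "\<lambda>x :: real^'n. \<chi> i. x $ p i"
  have bij: "bij p" using p permutes_bij by blast
  fix l u :: "real^'n" assume "\<And>b. b \<in> Basis \<Longrightarrow> l \<bullet> b \<le> u \<bullet> b"
  then have le: "l $ i \<le> u $ i" for i by (metis axis_in_Basis_iff cart_eq_inner_axis Basis_real_def insertI1)
  let ?l = "\<chi> i. l $ inv p i" and ?u = "\<chi> i. u $ inv p i"
  have m: "?T \<in> borel_measurable borel"
    by (intro borel_measurable_continuous_onI continuous_intros)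
  have vim: "?T -` box l u = box ?l ?u"
  proof (rule set_eqI)
    fix x
    have "(\<forall>i. l $ i < x $ p i \<and> x $ p i < u $ i) \<longleftrightarrow> (\<forall>j. l $ inv p j < x $ j \<and> x $ j < u $ inv p j)"
      using bij by (metis bij_inv_eq_iff)
    then show "x \<in> ?T -` box l u \<longleftrightarrow> x \<in> box ?l ?u" by (simp add: mem_box_cart)
  qed
  have le': "\<forall>b\<in>Basis. ?l \<bullet> b \<le> ?u \<bullet> b" using le by (auto dest!: axis_inverse simp: inner_axis)
  have "emeasure (distr lborel borel ?T) (box l u) = emeasure lborel (box ?l ?u)"
    using m by (subst emeasure_distr) (auto simp: vim)
  also have "\<dots> = (\<Prod>b\<in>Basis. (?u - ?l) \<bullet> b)" by (rule emeasure_lborel_box) (use le' in auto)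
  also have "\<dots> = (\<Prod>b\<in>Basis. (u - l) \<bullet> b)"
    unfolding prod_Basis_vec using prod.reindex_bij_betw[OF bij_imp_bij_inv[OF bij], of "\<lambda>i. u $ i - l $ i"]
    by (simp add: inner_axis)
  finally show "emeasure (distr lborel borel ?T) (box l u) = (\<Prod>b\<in>Basis. (u - l) \<bullet> b)" .
qed simp

text \<open>The library's change of variables requires a well-ordered index type, hence the direct proof by
  elementary matrices.\<close>
lemma nn_integral_matrix_mult:
  fixes A :: "real^'n^'n" and f :: "real^'n \<Rightarrow> ennreal"
  assumes "det A \<noteq> 0" "f \<in> borel_measurable borel"
  shows "(\<integral>\<^sup>+x. f x \<partial>lborel) = \<bar>det A\<bar> * (\<integral>\<^sup>+x. f (A *v x) \<partial>lborel)"
proof -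
  have [measurable]: "(\<lambda>x. A *v x) \<in> borel_measurable borel" for A :: "real^'n^'n"
    by (intro borel_measurable_continuous_onI linear_continuous_on) simp
  have "det A \<noteq> 0 \<longrightarrow> (\<forall>f. f \<in> borel_measurable borel \<longrightarrow>
      (\<integral>\<^sup>+x. f x \<partial>lborel) = ennreal \<bar>det A\<bar> * (\<integral>\<^sup>+x. f (A *v x) \<partial>lborel))"
  proof (induction A rule: induct_matrix_elementary)
    case (1 A B)
    show ?case
    proof (intro impI allI)
      fix f :: "real^'n \<Rightarrow> ennreal" assume "det (A ** B) \<noteq> 0" and [measurable]: "f \<in> borel_measurable borel"
      then have nz: "det A \<noteq> 0" "det B \<noteq> 0" by (auto simp: det_mul)
      have "(\<integral>\<^sup>+x. f x \<partial>lborel) = \<bar>det A\<bar> * (\<integral>\<^sup>+x. f (A *v x) \<partial>lborel)"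
        by (rule 1(1)[rule_format, OF nz(1)]) measurable
      also have "(\<integral>\<^sup>+x. f (A *v x) \<partial>lborel) = \<bar>det B\<bar> * (\<integral>\<^sup>+x. f (A *v (B *v x)) \<partial>lborel)"
        by (rule 1(2)[rule_format, OF nz(2)]) measurable
      finally show "(\<integral>\<^sup>+x. f x \<partial>lborel) = \<bar>det (A ** B)\<bar> * (\<integral>\<^sup>+x. f ((A ** B) *v x) \<partial>lborel)"
        by (simp add: det_mul abs_mult ennreal_mult' mult.assoc matrix_vector_mul_assoc)
    qed
  next
    \<comment> \<open>A zero row makes the determinant vanish, so the claim is vacuous.\<close>
    case (2 A i)
    then show ?case by (simp add: det_zero_row(2))
  next
    case (3 A)
    show ?case
    proof (intro impI allI)
      fix f :: "real^'n \<Rightarrow> ennreal" assume "det A \<noteq> 0" and [measurable]: "f \<in> borel_measurable borel"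
      have det: "det A = (\<Prod>i\<in>UNIV. A$i$i)" using 3 by (rule det_diagonal)
      define c where "c b = (A *v b) \<bullet> b" for b
      have c: "c (axis i 1) = A$i$i" for i
        by (simp add: c_def inner_axis matrix_vector_mult_basis column_def)
      have nz: "c j \<noteq> 0" if "j \<in> Basis" for j
        using \<open>det A \<noteq> 0\<close> axis_inverse[OF that] by (auto simp: c det)
      have T: "0 + (\<Sum>j\<in>Basis. (c j * (x \<bullet> j)) *\<^sub>R j) = A *v x" for x
      proof -
        have "(\<Sum>j\<in>UNIV. A$i$j * x$j) = A$i$i * x$i" for i
          using 3 by (subst sum.remove[of _ i]) (auto intro!: sum.neutral)
        then show ?thesis unfolding sum_Basis_vec c cart_eq_inner_axis[symmetric]
          by (simp add: vec_eq_iff matrix_vector_mult_def axis_def if_distrib cong: if_cong)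
      qed
      have "lborel = density (distr lborel borel ((*v) A)) (\<lambda>_. (\<Prod>j\<in>Basis. \<bar>c j\<bar>))"
        using lborel_affine_euclidean[of c 0, unfolded T] nz by simp
      moreover have "(\<Prod>j\<in>Basis. \<bar>c j\<bar>) = \<bar>det A\<bar>" by (simp add: prod_Basis_vec c det abs_prod)
      ultimately have "lborel = density (distr lborel borel ((*v) A)) (\<lambda>_. \<bar>det A\<bar>)" by simp
      then show "(\<integral>\<^sup>+x. f x \<partial>lborel) = ennreal \<bar>det A\<bar> * (\<integral>\<^sup>+x. f (A *v x) \<partial>lborel)"
        by (rule arg_cong[of _ _ "\<lambda>M. \<integral>\<^sup>+x. f x \<partial>M", THEN trans])
          (simp add: nn_integral_density nn_integral_distr nn_integral_cmult)
    qed
  next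
    case (4 m n)
    let ?p = "Transposition.transpose m n"
    have p: "?p permutes UNIV" by (rule permutes_swap_id) auto
    let ?A = "(\<chi> i j. mat 1 $ i $ ?p j) :: real^'n^'n"
    have det: "\<bar>det ?A\<bar> = 1" unfolding det_permute_columns[OF p] by (simp add: sign_def)
    have A: "?A *v x = (\<chi> i. x $ ?p i)" for x
    proof -
      have "(\<Sum>j\<in>UNIV. (if i = ?p j then 1 else 0) * x$j) = x $ ?p i" for i
      proof -
        have "(if i = ?p j then 1 else 0) * x$j = (if j = ?p i then x $ ?p i else 0)" for j
        proof (cases "j = ?p i")
          case False
          then have "i \<noteq> ?p j" by (metis transpose_involutory)
          with False show ?thesis by simp
        qed simp
        then have "(\<Sum>j\<in>UNIV. (if i = ?p j then 1 else 0) * x$j) = (\<Sum>j\<in>UNIV. if j = ?p i then x $ ?p i else 0)"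
          by (intro sum.cong refl)
        then show ?thesis by simp
      qed
      then show ?thesis by (simp add: vec_eq_iff matrix_vector_mult_def mat_def)
    qed
    have "(\<integral>\<^sup>+x. f x \<partial>lborel) = (\<integral>\<^sup>+x. f (?A *v x) \<partial>lborel)" if "f \<in> borel_measurable borel" for f
      unfolding A by (subst lborel_permute_coordinates[OF p], subst nn_integral_distr)
        (auto simp: that intro!: borel_measurable_continuous_onI continuous_intros)
    then show ?case unfolding det abs_one ennreal_1 mult_1 by blast
  next
    \<comment> \<open>The matrix adds \<open>c\<close> times row \<open>n\<close> to row
      \<open>m\<close> of the identity: determinant one, and the action on vectors is a
      shear.\<close>
    case (5 m n c)
    let ?A = "(\<chi> i j. if i = m \<and> j = n then c else of_bool (i = j)) :: real^'n^'n"
    have "?A = (\<chi> k. if k = m then row m (mat 1) + c *s row n (mat 1) else row k (mat 1))"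
      using 5 by (auto simp: vec_eq_iff row_def mat_def)
    then have det: "det ?A = 1" by (simp only: det_row_operation[OF 5] det_I)
    have A: "?A *v x = x + (c * (x \<bullet> axis n 1)) *\<^sub>R axis m 1" for x
    proof -
      have "(\<Sum>j\<in>UNIV. (if i = m \<and> j = n then c else of_bool (i = j)) * x$j) = x$i + (if i = m then c * x$n else 0)" for i
      proof -
        have "(if i = m \<and> j = n then c else of_bool (i = j)) * x$j
          = (if j = i then x$i else 0) + (if j = n then (if i = m then c * x$n else 0) else 0)" for j
          using 5 by auto
        then show ?thesis by (simp add: sum.distrib)
      qed
      then have "?A *v x = x + (c * x $ n) *\<^sub>R axis m 1" by (auto simp: vec_eq_iff matrix_vector_mult_def axis_def)
      then show ?thesis by (simp add: inner_axis)
    qed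
    have "(\<integral>\<^sup>+x. f x \<partial>lborel) = (\<integral>\<^sup>+x. f (?A *v x) \<partial>lborel)" if "f \<in> borel_measurable borel" for f
      unfolding A by (rule nn_integral_lborel_shear[symmetric]) (use that 5 in \<open>auto simp: axis_eq_axis\<close>)
    then show ?case unfolding det abs_one ennreal_1 mult_1 by blast
  qed
  with assms show ?thesis by blast
qed

text \<open>Applied to indicators, the nonnegative formula becomes an identity of measures, and this
  transfers directly to signed integrands.\<close>

lemma integral_matrix_mult:
  fixes A :: "real^'n^'n" and f :: "real^'n \<Rightarrow> real"
  assumes d: "det A \<noteq> 0" and f: "f \<in> borel_measurable borel"
  shows "(\<integral>x. f x \<partial>lborel) = \<bar>det A\<bar> * (\<integral>x. f (A *v x) \<partial>lborel)"
proof -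
  have A[measurable]: "(\<lambda>x. A *v x) \<in> borel_measurable borel"
    by (intro borel_measurable_continuous_onI linear_continuous_on) simp
  note [measurable] = f
  have "lborel = density (distr lborel borel ((*v) A)) (\<lambda>_. \<bar>det A\<bar>)"
  proof (rule measure_eqI)
    fix S :: "(real^'n) set" assume "S \<in> sets lborel"
    then have [measurable]: "S \<in> sets borel" by simp
    show "emeasure lborel S = emeasure (density (distr lborel borel ((*v) A)) (\<lambda>_. \<bar>det A\<bar>)) S"
      using nn_integral_matrix_mult[OF d, of "indicator S"]
      by (simp add: emeasure_density nn_integral_distr nn_integral_cmult[symmetric])
  qed simp
  then have "(\<integral>x. f x \<partial>lborel) = (\<integral>x. f x \<partial>density (distr lborel borel ((*v) A)) (\<lambda>_. \<bar>det A\<bar>))" by simp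
  also have "\<dots> = (\<integral>x. \<bar>det A\<bar> * f x \<partial>distr lborel borel ((*v) A))"
    by (subst integral_density) auto
  also have "\<dots> = (\<integral>x. \<bar>det A\<bar> * f (A *v x) \<partial>lborel)"
    by (subst integral_distr) auto
  finally show ?thesis by simp
qed

section \<open>The covariance matrix and the kernel\<close>

lemma bounded_bilinear_matrix_mult:
  "bounded_bilinear ((**) :: real^'n^'m \<Rightarrow> real^'p^'n \<Rightarrow> real^'p^'m)"
  unfolding bilinear_conv_bounded_bilinear[symmetric] bilinear_def
  by (auto intro!: linearI simp: matrix_matrix_mult_def vec_eq_iff algebra_simps sum.distrib sum_distrib_left)

lemma bounded_bilinear_matrix_vector_mult:
  "bounded_bilinear ((*v) :: real^'n^'m \<Rightarrow> real^'n \<Rightarrow> real^'m)"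
  unfolding bilinear_conv_bounded_bilinear[symmetric] bilinear_def
  by (auto intro!: linearI simp: matrix_vector_mult_def vec_eq_iff algebra_simps sum.distrib sum_distrib_left)

lemma bounded_linear_transpose: "bounded_linear (transpose :: real^'n^'m \<Rightarrow> real^'m^'n)"
  unfolding linear_conv_bounded_linear[symmetric]
  by (auto intro!: linearI simp: transpose_def vec_eq_iff)

section \<open>The matrix exponential\<close>

lemma matrix_power_commute: "A ** matrix_power A k = matrix_power A k ** A"
  by (induction k) (simp_all add: matrix_mul_assoc)

lemma matrix_power_scaleR: "matrix_power (t *\<^sub>R A) k = t ^ k *\<^sub>R matrix_power (A :: real^'n^'n) k"
  by (induction k) (simp_all add: bounded_bilinear.scaleR_left[OF bounded_bilinear_matrix_mult]
      bounded_bilinear.scaleR_right[OF bounded_bilinear_matrix_mult])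

lemma matrix_power_transpose: "matrix_power (transpose A) k = transpose (matrix_power (A :: real^'n^'n) k)"
  by (induction k) (simp_all add: matrix_transpose_mul[symmetric] matrix_power_commute transpose_mat)

text \<open>Each product with \<open>A\<close> is a sum of N terms, so the entries grow at most by
  the ratio N times the largest entry. This dominates every entry of the exponential series by a
  scalar exponential series.\<close>

lemma matrix_power_bound: "\<exists>K\<ge>0. \<forall>k i j. \<bar>matrix_power (A :: real^'n^'n) k $ i $ j\<bar> \<le> K ^ k"
proof -
  define m where "m = Max (range (\<lambda>(i,j). \<bar>A$i$j\<bar>))"
  have m: "\<bar>A$i$j\<bar> \<le> m" for i j unfolding m_def by (rule Max_ge) (auto intro!: rev_image_eqI[of "(i,j)"])
  define K where "K = real CARD('n) * m"
  have m0: "m \<ge> 0" using m[of undefined undefined] by linarith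
  then have K0: "K \<ge> 0" unfolding K_def by simp
  have "\<bar>matrix_power A k $ i $ j\<bar> \<le> K ^ k" for k i j
  proof (induction k arbitrary: i j)
    case 0
    show ?case by (simp add: mat_def)
  next
    case (Suc k)
    have "\<bar>matrix_power A (Suc k) $ i $ j\<bar> \<le> (\<Sum>l\<in>UNIV. \<bar>A$i$l * matrix_power A k $ l $ j\<bar>)"
      by (simp add: matrix_matrix_mult_def sum_abs)
    also have "\<dots> \<le> (\<Sum>l\<in>(UNIV::'n set). m * K ^ k)"
      unfolding abs_mult by (intro sum_mono mult_mono m Suc m0) auto
    also have "\<dots> = K ^ Suc k" by (simp add: K_def)
    finally show ?case .
  qed
  with K0 show ?thesis by blast
qed

lemma matrix_exp_entry_summable:
  "summable (\<lambda>k. (matrix_power (A :: real^'n^'n) k $ i $ j / fact k) * t ^ k)"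
proof -
  obtain K where K: "K \<ge> 0" "\<And>k i j. \<bar>matrix_power A k $ i $ j\<bar> \<le> K ^ k"
    using matrix_power_bound by blast
  show ?thesis
  proof (rule summable_comparison_test'[where N=0])
    show "summable (\<lambda>k. inverse (fact k) * (K * \<bar>t\<bar>) ^ k)" by (rule summable_exp)
    show "norm ((matrix_power A k $ i $ j / fact k) * t ^ k) \<le> inverse (fact k) * (K * \<bar>t\<bar>) ^ k" for k
      using mult_right_mono[OF K(2)[of k i j], of "\<bar>t\<bar> ^ k / fact k"]
      by (simp add: abs_mult power_abs power_mult_distrib field_simps)
  qed
qed

text \<open>Reduces convergence, differentiation and commutation to real power series in
  \<open>t\<close>.\<close>

lemma matrix_exp_nth:
  "matrix_exp (t *\<^sub>R A) $ i $ j = (\<Sum>k. (matrix_power (A :: real^'n^'n) k $ i $ j / fact k) * t ^ k)"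
proof -
  have "(\<lambda>k. (1 / fact k) *\<^sub>R matrix_power (t *\<^sub>R A) k) sums
      (\<chi> i j. \<Sum>k. (matrix_power A k $ i $ j / fact k) * t ^ k)"
    unfolding sums_def
  proof (intro vec_tendstoI)
    fix i j
    have "(\<lambda>n. \<Sum>k<n. (matrix_power A k $ i $ j / fact k) * t ^ k) \<longlonglongrightarrow>
        (\<Sum>k. (matrix_power A k $ i $ j / fact k) * t ^ k)"
      using summable_LIMSEQ[OF matrix_exp_entry_summable] .
    then show "(\<lambda>n. (\<Sum>k<n. (1 / fact k) *\<^sub>R matrix_power (t *\<^sub>R A) k) $ i $ j) \<longlonglongrightarrow>
        (\<chi> i j. \<Sum>k. (matrix_power A k $ i $ j / fact k) * t ^ k) $ i $ j"
      by (simp add: matrix_power_scaleR mult_ac)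
  qed
  then have "matrix_exp (t *\<^sub>R A) = (\<chi> i j. \<Sum>k. (matrix_power A k $ i $ j / fact k) * t ^ k)"
    unfolding matrix_exp_def by (rule sums_unique[symmetric])
  then show ?thesis by simp
qed

lemma matrix_exp_0: "matrix_exp (0 *\<^sub>R (A :: real^'n^'n)) = mat 1"
  unfolding vec_eq_iff matrix_exp_nth powser_zero by simp

lemma matrix_exp_transpose:
  "matrix_exp (t *\<^sub>R transpose (A :: real^'n^'n)) = transpose (matrix_exp (t *\<^sub>R A))"
  unfolding vec_eq_iff matrix_exp_nth matrix_power_transpose by (simp add: transpose_def matrix_exp_nth)

lemma suminf_linear_combination:
  fixes f :: "'l::finite \<Rightarrow> nat \<Rightarrow> real"
  assumes "\<And>l. summable (f l)"
  shows "(\<Sum>k. \<Sum>l\<in>UNIV. a l * f l k) = (\<Sum>l\<in>UNIV. a l * (\<Sum>k. f l k))"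
proof -
  have "(\<Sum>k. \<Sum>l\<in>UNIV. a l * f l k) = (\<Sum>l\<in>UNIV. \<Sum>k. a l * f l k)"
    by (rule suminf_sum) (rule summable_mult[OF assms])
  also have "\<dots> = (\<Sum>l\<in>UNIV. a l * (\<Sum>k. f l k))" by (intro sum.cong refl suminf_mult assms)
  finally show ?thesis .
qed

lemma matrix_exp_commute:
  "(A :: real^'n^'n) ** matrix_exp (t *\<^sub>R A) = matrix_exp (t *\<^sub>R A) ** A"
proof -
  have "(\<Sum>l\<in>UNIV. A$i$l * (\<Sum>k. (matrix_power A k $ l $ j / fact k) * t ^ k))
      = (\<Sum>l\<in>UNIV. (\<Sum>k. (matrix_power A k $ i $ l / fact k) * t ^ k) * A$l$j)" for i j
  proof -
    have "(\<Sum>l\<in>UNIV. A$i$l * (\<Sum>k. (matrix_power A k $ l $ j / fact k) * t ^ k))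
        = (\<Sum>k. \<Sum>l\<in>UNIV. A$i$l * ((matrix_power A k $ l $ j / fact k) * t ^ k))"
      by (rule suminf_linear_combination[OF matrix_exp_entry_summable, symmetric])
    also have "\<dots> = (\<Sum>k. \<Sum>l\<in>UNIV. ((matrix_power A k $ i $ l / fact k) * t ^ k) * A$l$j)"
    proof (rule suminf_cong)
      fix k
      have "(A ** matrix_power A k) $ i $ j = (matrix_power A k ** A) $ i $ j"
        by (simp only: matrix_power_commute)
      then have "(\<Sum>l\<in>UNIV. A$i$l * matrix_power A k $ l $ j) * (t ^ k / fact k)
         = (\<Sum>l\<in>UNIV. matrix_power A k $ i $ l * A$l$j) * (t ^ k / fact k)"
        by (simp add: matrix_matrix_mult_def)
      then show "(\<Sum>l\<in>UNIV. A$i$l * ((matrix_power A k $ l $ j / fact k) * t ^ k))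
         = (\<Sum>l\<in>UNIV. ((matrix_power A k $ i $ l / fact k) * t ^ k) * A$l$j)"
        unfolding sum_distrib_right by (simp only: mult_ac times_divide_eq_right times_divide_eq_left)
    qed
    also have "\<dots> = (\<Sum>l\<in>UNIV. (\<Sum>k. (matrix_power A k $ i $ l / fact k) * t ^ k) * A$l$j)"
      unfolding mult.commute[of _ "A $ _ $ j"] by (rule suminf_linear_combination[OF matrix_exp_entry_summable])
    finally show ?thesis .
  qed
  then show ?thesis by (simp add: vec_eq_iff matrix_matrix_mult_def matrix_exp_nth)
qed

lemma has_vector_derivative_matrix:
  fixes f :: "real \<Rightarrow> real^'n^'m"
  assumes "\<And>i j. ((\<lambda>t. f t $ i $ j) has_real_derivative D $ i $ j) (at t)"
  shows "(f has_vector_derivative D) (at t)"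
  unfolding has_vector_derivative_def has_derivative_componentwise_within[of f]
proof
  fix b :: "real^'n^'m" assume "b \<in> Basis"
  then obtain i j where b: "b = axis i (axis j 1)" by (auto simp: Basis_vec_def)
  have "x \<bullet> b = x $ i $ j" for x :: "real^'n^'m" by (simp add: b inner_axis)
  then show "((\<lambda>x. f x \<bullet> b) has_derivative (\<lambda>x. (x *\<^sub>R D) \<bullet> b)) (at t)"
    using assms[of i j] by (simp add: has_field_derivative_def mult.commute[of _ "D $ i $ j"])
qed

lemma matrix_exp_has_vector_derivative:
  "((\<lambda>t. matrix_exp (t *\<^sub>R A)) has_vector_derivative (A :: real^'n^'n) ** matrix_exp (t *\<^sub>R A)) (at t)"
proof (rule has_vector_derivative_matrix)
  fix i j
  let ?c = "\<lambda>k. matrix_power A k $ i $ j / fact k"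
  have "((\<lambda>t. \<Sum>k. ?c k * t ^ k) has_real_derivative (\<Sum>k. diffs ?c k * t ^ k)) (at t)"
    by (rule termdiffs_strong_converges_everywhere) (rule matrix_exp_entry_summable)
  moreover have "(\<Sum>k. diffs ?c k * t ^ k) = (A ** matrix_exp (t *\<^sub>R A)) $ i $ j"
  proof -
    \<comment> \<open>The factor k + 1 from \<open>diffs\<close> cancels in (k + 1)!, and the extra
      power of \<open>A\<close> becomes a product with row \<open>i\<close> of
      \<open>A\<close>.\<close>
    have "diffs ?c k * t ^ k = (\<Sum>l\<in>UNIV. A$i$l * ((matrix_power A k $ l $ j / fact k) * t ^ k))" for k
      by (simp add: diffs_def matrix_matrix_mult_def sum_divide_distrib sum_distrib_right sum_distrib_left
          field_simps del: of_nat_Suc)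
    then have "(\<Sum>k. diffs ?c k * t ^ k) = (\<Sum>k. \<Sum>l\<in>UNIV. A$i$l * ((matrix_power A k $ l $ j / fact k) * t ^ k))"
      by simp
    also have "\<dots> = (\<Sum>l\<in>UNIV. A$i$l * (\<Sum>k. (matrix_power A k $ l $ j / fact k) * t ^ k))"
      by (rule suminf_linear_combination[OF matrix_exp_entry_summable])
    finally show ?thesis by (simp add: matrix_matrix_mult_def matrix_exp_nth)
  qed
  ultimately show "((\<lambda>t. matrix_exp (t *\<^sub>R A) $ i $ j) has_real_derivative (A ** matrix_exp (t *\<^sub>R A)) $ i $ j) (at t)"
    by (simp add: matrix_exp_nth)
qed

lemma continuous_on_matrix_exp: "continuous_on S (\<lambda>t. matrix_exp (t *\<^sub>R (A :: real^'n^'n)))"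
  by (intro continuous_at_imp_continuous_on ballI has_vector_derivative_continuous[OF matrix_exp_has_vector_derivative])

text \<open>The product exp((s + t - r) A) exp(r A) has derivative zero in \<open>r\<close>; its
  values at r = 0 and r = t are the two sides.\<close>

lemma matrix_exp_add:
  "matrix_exp ((s + t) *\<^sub>R (A :: real^'n^'n)) = matrix_exp (s *\<^sub>R A) ** matrix_exp (t *\<^sub>R A)"
proof -
  let ?E = "\<lambda>t. matrix_exp (t *\<^sub>R A)"
  let ?\<phi> = "\<lambda>r. ?E (s + t - r) ** ?E r"
  have 1: "((\<lambda>r. ?E (s + t - r)) has_vector_derivative - (A ** ?E (s + t - r))) (at r)" for r
  proof -
    have "((\<lambda>r. s + t - r) has_vector_derivative - 1) (at r)" by (auto intro!: derivative_eq_intros)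
    from vector_diff_chain_at[OF this matrix_exp_has_vector_derivative] show ?thesis by (simp add: comp_def)
  qed
  have "(?\<phi> has_vector_derivative 0) (at r)" for r
  proof -
    have "(?\<phi> has_vector_derivative (?E (s + t - r) ** (A ** ?E r) + - (A ** ?E (s + t - r)) ** ?E r)) (at r)"
      by (rule bounded_bilinear.has_vector_derivative[OF bounded_bilinear_matrix_mult 1 matrix_exp_has_vector_derivative])
    moreover have "?E (s + t - r) ** (A ** ?E r) + - (A ** ?E (s + t - r)) ** ?E r = 0"
      by (simp add: matrix_exp_commute[of A "s + t - r"] bounded_bilinear.minus_left[OF bounded_bilinear_matrix_mult] matrix_mul_assoc)
    ultimately show ?thesis by simp
  qed
  then obtain c where "\<And>r. ?\<phi> r = c"
    using has_vector_derivative_zero_constant[of UNIV ?\<phi>] by auto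
  then have "?\<phi> 0 = ?\<phi> t" by (simp only:)
  then show ?thesis unfolding matrix_exp_0 by simp
qed

text \<open>For t > 0 this is t K(t). The Gaussian p(X, . , t) has twice this matrix as its
  covariance, since its exponent carries 1/(4t) and not 1/(2t); hence the factor 2 in the equation
  for the root R.\<close>

definition covariance :: "real^'n^'n \<Rightarrow> real^'n^'n \<Rightarrow> real \<Rightarrow> real^'n^'n" where
  "covariance Q B t = (LINT \<sigma>:{0..t}|lborel. matrix_exp (\<sigma> *\<^sub>R B) ** Q ** matrix_exp (\<sigma> *\<^sub>R transpose B))"

lemma scaleR_K_mat: "t > 0 \<Longrightarrow> t *\<^sub>R K_mat Q B t = covariance Q B t"
  unfolding K_mat_def covariance_def by simp

abbreviation cov_rate :: "real^'n^'n \<Rightarrow> real^'n^'n \<Rightarrow> real \<Rightarrow> real^'n^'n" where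
  "cov_rate Q B \<sigma> \<equiv> matrix_exp (\<sigma> *\<^sub>R B) ** Q ** transpose (matrix_exp (\<sigma> *\<^sub>R B))"

lemma continuous_on_cov_rate: "continuous_on S (cov_rate Q B)"
  by (intro bounded_bilinear.continuous_on[OF bounded_bilinear_matrix_mult] continuous_on_const
      continuous_on_matrix_exp bounded_linear.continuous_on[OF bounded_linear_transpose])

lemma set_integrable_cov_rate: "set_integrable lborel {a..b} (cov_rate Q B)"
  by (rule borel_integrable_atLeastAtMost') (rule continuous_on_cov_rate)

lemma covariance_eq: "covariance Q B t = (LINT \<sigma>:{0..t}|lborel. cov_rate Q B \<sigma>)"
  unfolding covariance_def matrix_exp_transpose ..

lemma covariance_has_vector_derivative:
  assumes "t > 0"
  shows "(covariance Q B has_vector_derivative cov_rate Q B t) (at t)"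
proof -
  have eq: "covariance Q B s = integral {0..s} (cov_rate Q B)" for s
    unfolding covariance_eq by (rule set_borel_integral_eq_integral(2)[OF set_integrable_cov_rate])
  have "((\<lambda>s. integral {0..s} (cov_rate Q B)) has_vector_derivative cov_rate Q B t) (at t within {0..t+1})"
    by (rule integral_has_vector_derivative[OF continuous_on_cov_rate]) (use assms in auto)
  moreover have "at t within {0..t+1} = at t" by (rule at_within_interior) (use assms in auto)
  ultimately show ?thesis by (simp add: eq[abs_def])
qed

text \<open>Applied to transposition and to the quadratic forms that send A to <A x, x>.\<close>

lemma covariance_linear_image:
  assumes "bounded_linear T"
  shows "T (covariance Q B t) = (LINT \<sigma>:{0..t}|lborel. T (cov_rate Q B \<sigma>))"
  unfolding covariance_eq set_lebesgue_integral_def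
  by (subst integral_bounded_linear[OF assms, symmetric])
     (use set_integrable_cov_rate[where a=0 and b=t and Q=Q and B=B] in
       \<open>auto simp: set_integrable_def linear_cmul[OF bounded_linear.linear[OF assms]]\<close>)

lemma transpose_covariance: "Q = transpose Q \<Longrightarrow> transpose (covariance Q B t) = covariance Q B t"
  unfolding covariance_linear_image[OF bounded_linear_transpose] 
  by (simp add: covariance_eq matrix_transpose_mul matrix_mul_assoc)

text \<open>The integrand is bounded on [0,1]. The linear rate in \<open>t\<close> is the source of
  the factor \<tau> for the Gaussian part of \<open>W_near\<close>.\<close>

lemma norm_covariance_le: "\<exists>K\<ge>0. \<forall>t\<in>{0..1}. norm (covariance Q B t) \<le> K * t"
proof -
  have "bounded (cov_rate Q B ` {0..1})"
    by (intro compact_imp_bounded compact_continuous_image continuous_on_cov_rate compact_Icc)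
  then obtain K where "\<forall>x\<in>cov_rate Q B ` {0..1}. norm x \<le> K" unfolding bounded_iff by blast
  then have K: "\<And>\<sigma>. \<sigma> \<in> {0..1} \<Longrightarrow> norm (cov_rate Q B \<sigma>) \<le> K" by blast
  have "norm (covariance Q B t) \<le> K * t" if "t \<in> {0..1}" for t
  proof -
    have "covariance Q B t = integral {0..t} (cov_rate Q B)"
      unfolding covariance_eq by (rule set_borel_integral_eq_integral(2)[OF set_integrable_cov_rate])
    moreover have "norm (integral {0..t} (cov_rate Q B)) \<le> K * (t - 0)"
      by (rule integral_bound) (use that K in \<open>auto intro: continuous_on_cov_rate\<close>)
    ultimately show ?thesis by simp
  qed
  moreover have "K \<ge> 0" by (rule order_trans[OF norm_ge_zero K[of 0]]) simp
  ultimately show ?thesis by blast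
qed

section \<open>Lower bound for the covariance at large times\<close>

lemma inner_matrix_vector_mult: "(A *v x) \<bullet> y = x \<bullet> (transpose A *v y)" for A :: "real^'n^'m"
  using dot_lmul_matrix[of y A x] by (simp add: inner_commute)

lemma cov_rate_quadratic:
  "(cov_rate Q B \<sigma> *v y) \<bullet> y = (Q *v (transpose (matrix_exp (\<sigma> *\<^sub>R B)) *v y)) \<bullet> (transpose (matrix_exp (\<sigma> *\<^sub>R B)) *v y)"
  by (simp only: matrix_vector_mul_assoc[symmetric] inner_matrix_vector_mult[of "matrix_exp (\<sigma> *\<^sub>R B)"])

text \<open>Positivity of Q allows the integral over [0, t - 1] to be discarded; shifting the rest
  to [0,1] and splitting the exponential leaves the covariance at time 1 seen through the transpose
  of exp((t - 1) B). Nondegeneracy at time 1 thereby controls R(t)^(-1) exp(t B) for all t \<ge>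
  1.\<close>

lemma covariance_lower_bound:
  assumes Q: "pos_semidef Q" and t: "t \<ge> 1"
  shows "(covariance Q B 1 *v (transpose (matrix_exp ((t - 1) *\<^sub>R B)) *v y)) \<bullet> (transpose (matrix_exp ((t - 1) *\<^sub>R B)) *v y)
    \<le> (covariance Q B t *v y) \<bullet> y"
proof -
  let ?z = "transpose (matrix_exp ((t - 1) *\<^sub>R B)) *v y"
  have bl: "bounded_linear (\<lambda>A. (A *v x) \<bullet> x)" for x :: "real^'a"
    by (rule bounded_linear_compose[OF bounded_linear_inner_left
          bounded_bilinear.bounded_linear_left[OF bounded_bilinear_matrix_vector_mult]])
  have nn: "(cov_rate Q B \<sigma> *v x) \<bullet> x \<ge> 0" for \<sigma> x
    unfolding cov_rate_quadratic using Q by (simp add: pos_semidef_def)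
  have cont: "continuous_on S (\<lambda>\<sigma>. (cov_rate Q B \<sigma> *v x) \<bullet> x)" for S x
    by (rule bounded_linear.continuous_on[OF bl continuous_on_cov_rate])
  have int: "set_integrable lborel {a..b} (\<lambda>\<sigma>. (cov_rate Q B \<sigma> *v x) \<bullet> x)" for a b x
    by (rule borel_integrable_atLeastAtMost') (rule cont)
  have shift: "(cov_rate Q B \<sigma> *v ?z) \<bullet> ?z = (cov_rate Q B (\<sigma> + (t - 1)) *v y) \<bullet> y" for \<sigma>
  proof -
    have "transpose (matrix_exp (\<sigma> *\<^sub>R B)) *v ?z = transpose (matrix_exp ((\<sigma> + (t - 1)) *\<^sub>R B)) *v y"
      by (subst add.commute) (simp only: matrix_exp_add matrix_transpose_mul matrix_vector_mul_assoc)
    then show ?thesis unfolding cov_rate_quadratic by simp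
  qed
  have "(covariance Q B 1 *v ?z) \<bullet> ?z = (LINT \<sigma>:{0..1}|lborel. (cov_rate Q B \<sigma> *v ?z) \<bullet> ?z)"
    by (rule covariance_linear_image[OF bl])
  also have "\<dots> = (LINT \<sigma>:{t-1..t}|lborel. (cov_rate Q B \<sigma> *v y) \<bullet> y)"
  proof -
    have "(\<integral>\<sigma>. indicator {t-1..t} \<sigma> *\<^sub>R ((cov_rate Q B \<sigma> *v y) \<bullet> y) \<partial>lborel)
      = (\<integral>\<sigma>. indicator {t-1..t} ((t - 1) + 1 * \<sigma>) *\<^sub>R ((cov_rate Q B ((t - 1) + 1 * \<sigma>) *v y) \<bullet> y) \<partial>lborel)"
      by (subst lborel_integral_real_affine[of 1 _ "t - 1"]) auto
    moreover have "indicator {t-1..t} ((t - 1) + 1 * \<sigma>) = (indicator {0..1} \<sigma> :: real)" for \<sigma>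
      by (auto simp: indicator_def)
    ultimately show ?thesis unfolding set_lebesgue_integral_def shift by (simp add: add.commute)
  qed
  also have "\<dots> \<le> (LINT \<sigma>:{0..t}|lborel. (cov_rate Q B \<sigma> *v y) \<bullet> y)"
  proof -
    have "indicator {t-1..t} \<sigma> *\<^sub>R ((cov_rate Q B \<sigma> *v y) \<bullet> y) \<le> indicator {0..t} \<sigma> *\<^sub>R ((cov_rate Q B \<sigma> *v y) \<bullet> y)" for \<sigma>
      using t nn by (auto simp: indicator_def)
    then show ?thesis unfolding set_lebesgue_integral_def
      using int[unfolded set_integrable_def] by (intro integral_mono) auto
  qed
  also have "\<dots> = (covariance Q B t *v y) \<bullet> y" by (rule covariance_linear_image[OF bl, symmetric])
  finally show ?thesis .
qed

text \<open>Orthonormalisation with respect to the form \<open>M\<close>. The explicit recursion is used instead of an abstract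
  square root because it is differentiable in \<open>M\<close>.\<close>
function gram_schmidt :: "real^'n^'n \<Rightarrow> (nat \<Rightarrow> real^'n) \<Rightarrow> nat \<Rightarrow> real^'n" where
  "gram_schmidt M e n = (let x = e n - (\<Sum>k<n. ((M *v e n) \<bullet> gram_schmidt M e k) *\<^sub>R gram_schmidt M e k)
     in inverse (sqrt ((M *v x) \<bullet> x)) *\<^sub>R x)"
  by pat_completeness auto
termination by (relation "Wellfounded.measure (\<lambda>(M, e, n). n)") auto

declare gram_schmidt.simps [simp del]

lemma inner_matrix_symmetric:
  "transpose M = M \<Longrightarrow> (M *v x) \<bullet> y = (M *v y) \<bullet> x" for M :: "real^'n^'n"
  using inner_matrix_vector_mult[of M x y] by (simp add: inner_commute)

text \<open>Ensures that the normalisation divides by a positive number: the corrected vector could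
  vanish only if \<open>e n\<close> were in the span of its predecessors. The span property of the
  earlier vectors is a hypothesis, so that the lemma can be used inside the induction that proves
  it.\<close>

lemma gram_schmidt_nonzero:
  fixes M :: "real^'n^'n"
  assumes g: "\<And>k. k < n \<Longrightarrow> gram_schmidt M e k \<in> span (e ` {..k})" and indep: "e n \<notin> span (e ` {..<n})"
  shows "e n - (\<Sum>k<n. ((M *v e n) \<bullet> gram_schmidt M e k) *\<^sub>R gram_schmidt M e k) \<noteq> 0"
proof
  assume "e n - (\<Sum>k<n. ((M *v e n) \<bullet> gram_schmidt M e k) *\<^sub>R gram_schmidt M e k) = 0"
  then have "e n = (\<Sum>k<n. ((M *v e n) \<bullet> gram_schmidt M e k) *\<^sub>R gram_schmidt M e k)" by simp
  also have "\<dots> \<in> span (e ` {..<n})"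
  proof (intro span_sum span_scale)
    fix k assume "k \<in> {..<n}"
    then have "span (e ` {..k}) \<subseteq> span (e ` {..<n})" by (intro span_mono image_mono) auto
    with g \<open>k \<in> {..<n}\<close> show "gram_schmidt M e k \<in> span (e ` {..<n})" by auto
  qed
  finally show False using indep by simp
qed

text \<open>The three claims support each other in one induction: membership in the span gives a
  nonzero vector, and the relations among the earlier vectors make the subtracted projection cancel
  exactly.\<close>

lemma gram_schmidt_orthonormal:
  fixes M :: "real^'n^'n"
  assumes sym: "transpose M = M" and pd: "pos_def M"
    and indep: "\<And>n. n < N \<Longrightarrow> e n \<notin> span (e ` {..<n})" and "n < N"
  shows "gram_schmidt M e n \<in> span (e ` {..n}) \<and> (M *v gram_schmidt M e n) \<bullet> gram_schmidt M e n = 1 \<and>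
    (\<forall>k<n. (M *v gram_schmidt M e n) \<bullet> gram_schmidt M e k = 0)"
  using \<open>n < N\<close>
proof (induction n rule: less_induct)
  case (less n)
  let ?g = "gram_schmidt M e"
  define x where "x = e n - (\<Sum>k<n. ((M *v e n) \<bullet> ?g k) *\<^sub>R ?g k)"
  have gn: "?g n = inverse (sqrt ((M *v x) \<bullet> x)) *\<^sub>R x"
    by (subst gram_schmidt.simps) (simp add: x_def Let_def)
  have IH: "?g k \<in> span (e ` {..k})" "(M *v ?g k) \<bullet> ?g k = 1" "\<And>j. j < k \<Longrightarrow> (M *v ?g k) \<bullet> ?g j = 0" if "k < n" for k
    using less that by auto
  have "x \<noteq> 0" unfolding x_def by (rule gram_schmidt_nonzero[OF IH(1) indep[OF less.prems]])
  then have pos: "(M *v x) \<bullet> x > 0" using pd by (simp add: pos_def_def)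
  have orth: "(M *v ?g j) \<bullet> ?g k = (if j = k then 1 else 0)" if "j < n" "k < n" for j k
    using IH[OF that(1)] IH[OF that(2)] inner_matrix_symmetric[OF sym, of "?g j" "?g k"] by (cases j k rule: linorder_cases) auto
  have xk: "(M *v x) \<bullet> ?g k = 0" if "k < n" for k
  proof -
    have "(M *v x) \<bullet> ?g k = (M *v e n) \<bullet> ?g k - (\<Sum>j<n. ((M *v e n) \<bullet> ?g j) * ((M *v ?g j) \<bullet> ?g k))"
      unfolding x_def by (simp add: matrix_vector_mult_diff_distrib inner_diff_left matrix_vector_mult_scaleR
          linear_sum[OF matrix_vector_mul_linear] inner_sum_left)
    also have "(\<Sum>j<n. ((M *v e n) \<bullet> ?g j) * ((M *v ?g j) \<bullet> ?g k)) = (\<Sum>j<n. if j = k then (M *v e n) \<bullet> ?g k else 0)"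
      using that by (intro sum.cong) (auto simp: orth)
    also have "\<dots> = (M *v e n) \<bullet> ?g k" using that by simp
    finally show ?thesis by simp
  qed
  have "x \<in> span (e ` {..n})" unfolding x_def
  proof (intro span_diff span_sum span_scale)
    show "e n \<in> span (e ` {..n})" by (rule span_base) auto
    fix k assume "k \<in> {..<n}"
    then have "span (e ` {..k}) \<subseteq> span (e ` {..n})" by (intro span_mono image_mono) auto
    with IH(1) \<open>k \<in> {..<n}\<close> show "?g k \<in> span (e ` {..n})" by auto
  qed
  then have "?g n \<in> span (e ` {..n})" unfolding gn by (rule span_scale)
  moreover have "(M *v ?g n) \<bullet> ?g n = 1"
    unfolding gn using pos by (simp add: matrix_vector_mult_scaleR field_simps)
  moreover have "\<forall>k<n. (M *v ?g n) \<bullet> ?g k = 0"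
    unfolding gn using xk by (simp add: matrix_vector_mult_scaleR)
  ultimately show ?case by blast
qed

lemma gram_schmidt_inner:
  fixes M :: "real^'n^'n"
  assumes sym: "transpose M = M" and pd: "pos_def M"
    and indep: "\<And>n. n < N \<Longrightarrow> e n \<notin> span (e ` {..<n})" and "i < N" "j < N"
  shows "(M *v gram_schmidt M e i) \<bullet> gram_schmidt M e j = (if i = j then 1 else 0)"
proof (cases "i = j")
  case True
  then show ?thesis using gram_schmidt_orthonormal[OF sym pd indep \<open>i < N\<close>] by simp
next
  case False
  then consider "j < i" | "i < j" by linarith
  then have "(M *v gram_schmidt M e i) \<bullet> gram_schmidt M e j = 0"
  proof cases
    case 1
    then show ?thesis using gram_schmidt_orthonormal[OF sym pd indep \<open>i < N\<close>] by blast
  next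
    case 2
    then have "(M *v gram_schmidt M e j) \<bullet> gram_schmidt M e i = 0"
      using gram_schmidt_orthonormal[OF sym pd indep \<open>j < N\<close>] by blast
    then show ?thesis by (rule trans[OF inner_matrix_symmetric[OF sym]])
  qed
  with False show ?thesis by simp
qed

lemma bounded_bilinear_differentiable:
  assumes "bounded_bilinear p" "f differentiable (at x within S)" "g differentiable (at x within S)"
  shows "(\<lambda>x. p (f x) (g x)) differentiable (at x within S)"
  using assms bounded_bilinear.FDERIV[OF assms(1)] unfolding differentiable_def by blast

text \<open>The recursion uses only sums, bilinear operations and an inverse square root at a
  positive number, so differentiability in \<open>s\<close> passes from the earlier vectors to the
  next one.\<close>

lemma gram_schmidt_differentiable:
  fixes M :: "real \<Rightarrow> real^'n^'n"
  assumes M: "M differentiable (at t)" and sym: "transpose (M t) = M t" and pd: "pos_def (M t)"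
    and indep: "\<And>n. n < N \<Longrightarrow> e n \<notin> span (e ` {..<n})" and "n < N"
  shows "(\<lambda>s. gram_schmidt (M s) e n) differentiable (at t)"
  using \<open>n < N\<close>
proof (induction n rule: less_induct)
  case (less n)
  let ?g = "\<lambda>s. gram_schmidt (M s) e"
  define x where "x = (\<lambda>s. e n - (\<Sum>k<n. ((M s *v e n) \<bullet> ?g s k) *\<^sub>R ?g s k))"
  define q where "q = (\<lambda>s. (M s *v x s) \<bullet> x s)"
  have IH: "(\<lambda>s. ?g s k) differentiable (at t)" if "k < n" for k using less that by simp
  have x: "x differentiable (at t)" unfolding x_def
    by (intro differentiable_diff differentiable_sum differentiable_const differentiable_inner ballI
        bounded_bilinear_differentiable[OF bounded_bilinear_scaleR] IH
        bounded_bilinear_differentiable[OF bounded_bilinear_matrix_vector_mult] M) auto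
  then have q: "q differentiable (at t)" unfolding q_def
    by (intro differentiable_inner bounded_bilinear_differentiable[OF bounded_bilinear_matrix_vector_mult] M)
  have "x t \<noteq> 0" unfolding x_def
    by (rule gram_schmidt_nonzero[OF _ indep[OF less.prems]])
       (use gram_schmidt_orthonormal[OF sym pd indep, of N] less.prems in auto)
  then have "q t > 0" using pd by (simp add: q_def pos_def_def)
  moreover obtain q' where "(q has_derivative q') (at t)" using q unfolding differentiable_def by blast
  ultimately have "(\<lambda>s. inverse (sqrt (q s))) differentiable (at t)"
    unfolding differentiable_def by (auto intro!: exI derivative_eq_intros)
  then have "(\<lambda>s. inverse (sqrt (q s)) *\<^sub>R x s) differentiable (at t)"
    by (rule bounded_bilinear_differentiable[OF bounded_bilinear_scaleR _ x])
  then show ?case by (subst gram_schmidt.simps) (simp add: x_def q_def Let_def)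
qed

text \<open>If the columns of \<open>b\<close> are orthonormal for the form M, then b^T M b = 1,
  hence b b^T M = 1, and R = M b satisfies R R^T = M b b^T M = M with inverse b^T. As a product of
  differentiable functions M b is differentiable, and no inverse has to be differentiated.\<close>

lemma differentiable_matrix_root:
  fixes M :: "real \<Rightarrow> real^'n^'n"
  assumes M: "\<And>t. t \<in> T \<Longrightarrow> M differentiable (at t)" and sym: "\<And>t. t \<in> T \<Longrightarrow> transpose (M t) = M t"
    and pd: "\<And>t. t \<in> T \<Longrightarrow> pos_def (M t)"
  shows "\<exists>(R :: real \<Rightarrow> real^'n^'n) S. \<forall>t\<in>T. R differentiable (at t) \<and> R t ** transpose (R t) = M t \<and> S t ** R t = mat 1"
proof -
  let ?N = "CARD('n)"
  obtain \<pi> :: "nat \<Rightarrow> 'n" where \<pi>: "bij_betw \<pi> {0..<?N} UNIV"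
    using ex_bij_betw_nat_finite[of "UNIV :: 'n set"] by auto
  define e :: "nat \<Rightarrow> real^'n" where "e k = axis (\<pi> k) 1" for k
  define idx where "idx = the_inv_into {0..<?N} \<pi>"
  have idx: "idx j < ?N" "\<pi> (idx j) = j" for j
    using \<pi> unfolding idx_def bij_betw_def
    by (auto intro: f_the_inv_into_f simp: the_inv_into_into[of \<pi> "{0..<?N}" j "{0..<?N}", simplified])
  have inj_idx: "idx i = idx j \<longleftrightarrow> i = j" for i j using idx(2) by metis
  have indep: "e n \<notin> span (e ` {..<n})" if "n < ?N" for n
  proof -
    have "e ` {..<n} \<subseteq> Basis - {e n}"
    proof
      fix v assume "v \<in> e ` {..<n}"
      then obtain k where k: "k < n" "v = e k" by auto
      then have "\<pi> k \<noteq> \<pi> n"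
        using inj_on_eq_iff[OF bij_betw_imp_inj_on[OF \<pi>], of k n] that by simp
      then show "v \<in> Basis - {e n}" by (simp add: k e_def axis_eq_axis)
    qed
    moreover have "e n \<notin> span (Basis - {e n})"
      using independent_Basis unfolding dependent_def by (auto simp: e_def)
    ultimately show ?thesis using span_mono by blast
  qed
  define b where "b t = (\<chi> i j. gram_schmidt (M t) e (idx j) $ i)" for t
  have bMb: "transpose (b t) ** (M t ** b t) = mat 1" if "t \<in> T" for t
  proof -
    let ?g = "gram_schmidt (M t) e"
    have "(M t *v ?g (idx j)) \<bullet> ?g (idx i) = (if i = j then 1 else 0)" for i j
      using gram_schmidt_inner[OF sym[OF that] pd[OF that] indep idx(1)[of j] idx(1)[of i]] inj_idx[of i j]
      by (simp add: eq_commute[of "idx j"])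
    moreover have "(transpose (b t) ** (M t ** b t)) $ i $ j = (M t *v ?g (idx j)) \<bullet> ?g (idx i)" for i j
      by (simp add: b_def transpose_def matrix_matrix_mult_def matrix_vector_mult_def inner_vec_def mult.commute)
    ultimately show ?thesis by (simp add: vec_eq_iff mat_def)
  qed
  \<comment> \<open>Puts a vector into column \<open>j\<close>; in terms of \<open>C\<close>, the
    matrix \<open>b\<close> is a sum of linear images of differentiable vectors.\<close>
  define C :: "'n \<Rightarrow> real^'n \<Rightarrow> real^'n^'n" where "C j v = (\<chi> i l. if l = j then v $ i else 0)" for j v
  have C: "bounded_linear (C j)" for j
    unfolding linear_conv_bounded_linear[symmetric] by (rule linearI) (auto simp: C_def vec_eq_iff)
  have bC: "b t = (\<Sum>j\<in>UNIV. C j (gram_schmidt (M t) e (idx j)))" for t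
    by (simp add: vec_eq_iff b_def C_def)
  have bd: "b differentiable (at t)" if "t \<in> T" for t
    unfolding bC[abs_def]
  proof (rule differentiable_sum)
    show "\<forall>j\<in>UNIV. (\<lambda>t. C j (gram_schmidt (M t) e (idx j))) differentiable at t"
      using gram_schmidt_differentiable[OF M[OF that] sym[OF that] pd[OF that] indep idx(1)]
        bounded_linear.has_derivative[OF C] unfolding differentiable_def by blast
  qed simp
  have "(\<lambda>t. M t ** b t) differentiable (at t) \<and> (M t ** b t) ** transpose (M t ** b t) = M t
      \<and> transpose (b t) ** (M t ** b t) = mat 1" if "t \<in> T" for t
  proof (intro conjI)
    show "(\<lambda>t. M t ** b t) differentiable (at t)"
      by (rule bounded_bilinear_differentiable[OF bounded_bilinear_matrix_mult M[OF that] bd[OF that]])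
    \<comment> \<open>A one-sided inverse of a square matrix is two-sided, so the factors in
      \<open>bMb\<close> may be rotated.\<close>
    have "b t ** (transpose (b t) ** M t) = mat 1"
      using bMb[OF that] by (metis matrix_left_right_inverse matrix_mul_assoc)
    then show "(M t ** b t) ** transpose (M t ** b t) = M t"
      by (simp add: matrix_transpose_mul sym[OF that] matrix_mul_assoc[symmetric])
  qed (rule bMb[OF that])
  then have "\<forall>t\<in>T. (\<lambda>t. M t ** b t) differentiable (at t) \<and> (M t ** b t) ** transpose (M t ** b t) = M t
      \<and> transpose (b t) ** (M t ** b t) = mat 1" by blast
  then show ?thesis
    by (intro exI[of _ "\<lambda>t. M t ** b t"] exI[of _ "\<lambda>t. transpose (b t)"])
qed

section \<open>The kernel as an image of the standard Gaussian\<close>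

lemma matrix_inv_unique:
  fixes A :: "real^'n^'n"
  assumes "A ** A' = mat 1"
  shows "matrix_inv A = A'"
proof -
  have A': "A' ** A = mat 1" using assms matrix_left_right_inverse by blast
  have "A ** matrix_inv A = mat 1 \<and> matrix_inv A ** A = mat 1"
    unfolding matrix_inv_def by (rule someI[of _ A']) (use assms A' in auto)
  then show ?thesis by (metis A' matrix_mul_assoc matrix_mul_lid matrix_mul_rid)
qed

text \<open>With Y = e^(tB) X + R w the exponent becomes -|w|^2 / 2 because K(t)^(-1) = 2 t S^T S,
  and the Jacobian |det R| = 2^(N/2) det(t K(t))^(1/2) turns (4 pi)^(-N/2) into (2
  pi)^(-N/2).\<close>

lemma p_kernel_eq_gauss:
  fixes Q B R :: "real^'n^'n"
  assumes t: "t > 0" and R: "R ** transpose R = 2 *\<^sub>R covariance Q B t" and S: "S ** R = mat 1"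
  shows "\<bar>det R\<bar> * p_kernel Q B X (matrix_exp (t *\<^sub>R B) *v X + R *v w) t = gauss w"
proof -
  have K: "K_mat Q B t = (1 / (2 * t)) *\<^sub>R (R ** transpose R)"
    using scaleR_K_mat[OF t, of Q B] R t by (simp add: K_mat_def covariance_def)
  have "transpose (S ** R) = mat 1" unfolding S by (rule transpose_mat)
  then have R': "R ** S = mat 1" "transpose R ** transpose S = mat 1"
    using matrix_left_right_inverse1[OF S] unfolding matrix_transpose_mul by blast+
  have "K_mat Q B t ** ((2 * t) *\<^sub>R (transpose S ** S)) = mat 1"
  proof -
    have "(R ** transpose R) ** (transpose S ** S) = R ** ((transpose R ** transpose S) ** S)"
      by (simp add: matrix_mul_assoc)
    then show ?thesis unfolding K using t R' by (simp add: bounded_bilinear.scaleR_left[OF bounded_bilinear_matrix_mult]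
      bounded_bilinear.scaleR_right[OF bounded_bilinear_matrix_mult])
  qed
  then have inv: "matrix_inv (K_mat Q B t) = (2 * t) *\<^sub>R (transpose S ** S)" by (rule matrix_inv_unique)
  have Sw: "S *v (R *v w) = w" using S by (simp add: matrix_vector_mul_assoc)
  have quad: "(matrix_inv (K_mat Q B t) *v (R *v w)) \<bullet> (R *v w) = 2 * t * (norm w)\<^sup>2"
  proof -
    have "((transpose S ** S) *v y) \<bullet> y = (S *v y) \<bullet> (S *v y)" for y
      by (simp only: matrix_vector_mul_assoc[symmetric] inner_matrix_vector_mult[of "transpose S"] transpose_transpose)
    then show ?thesis unfolding inv scaleR_matrix_vector_assoc[symmetric] inner_scaleR_left Sw power2_norm_eq_inner
      by (simp only: Sw)
  qed
  have dR: "det R \<noteq> 0" using S by (metis det_I det_mul mult_zero_right zero_neq_one)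
  \<comment> \<open>As a product with a scalar matrix, so that \<open>det_mul\<close> yields the
    factor 2^N.\<close>
  have "2 *\<^sub>R covariance Q B t = mat 2 ** covariance Q B t"
    by (simp add: vec_eq_iff matrix_matrix_mult_def mat_def if_distrib[of "\<lambda>r. r * _"] cong: if_cong)
  moreover have "det (mat 2 :: real^'n^'n) = 2 ^ CARD('n)" by (simp add: det_diagonal mat_def)
  ultimately have "det (2 *\<^sub>R covariance Q B t) = 2 ^ CARD('n) * det (covariance Q B t)" by (simp add: det_mul)
  then have det: "(det R)\<^sup>2 = 2 ^ CARD('n) * det (covariance Q B t)"
    using R by (metis det_mul det_transpose power2_eq_square)
  let ?d = "det (covariance Q B t)" and ?N = "real CARD('n)"
  \<comment> \<open>Positivity is read off from (det R)^2 > 0; the real powers below rely on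
    it.\<close>
  have d: "?d > 0" using det dR by (metis zero_less_mult_pos zero_less_power zero_less_power2 zero_less_numeral)
  have "\<bar>det R\<bar> = 2 powr (?N / 2) * ?d powr (1 / 2)"
  proof -
    have "\<bar>det R\<bar> = sqrt (2 ^ CARD('n) * ?d)" using det by (metis real_sqrt_abs)
    also have "\<dots> = (2 powr ?N * ?d) powr (1 / 2)" using d by (simp add: powr_half_sqrt powr_realpow)
    also have "\<dots> = 2 powr (?N / 2) * ?d powr (1 / 2)" using d by (simp add: powr_mult powr_powr)
    finally show ?thesis .
  qed
  then have "\<bar>det R\<bar> * ((4 * pi) powr (- ?N / 2) * ?d powr (- 1 / 2))
     = (2 powr (?N / 2) * (4 * pi) powr (- ?N / 2)) * (?d powr (1 / 2) * ?d powr (- 1 / 2))" by simp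
  also have "?d powr (1 / 2) * ?d powr (- 1 / 2) = 1" using d by (simp add: powr_add[symmetric])
  also have "2 powr (?N / 2) * (4 * pi) powr (- ?N / 2) = (2 * pi) powr (- ?N / 2)"
  proof -
    have "(4 * pi) powr (- ?N / 2) = 2 powr (- ?N / 2) * (2 * pi) powr (- ?N / 2)"
      by (subst powr_mult[symmetric]) auto
    then have "2 powr (?N / 2) * (4 * pi) powr (- ?N / 2) = (2 powr (?N / 2) * 2 powr (- ?N / 2)) * (2 * pi) powr (- ?N / 2)"
      by simp
    also have "2 powr (?N / 2) * 2 powr (- ?N / 2) = 1" by (simp add: powr_add[symmetric])
    finally show ?thesis by simp
  qed
  finally have const: "\<bar>det R\<bar> * ((4 * pi) powr (- ?N / 2) * ?d powr (- 1 / 2)) = (2 * pi) powr (- ?N / 2)"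
    by (simp only: mult_1_right)
  have "2 * t * (norm w)\<^sup>2 / (4 * t) = (norm w)\<^sup>2 / 2" using t by simp
  moreover have DIM: "DIM(real^'n) = CARD('n)" by simp
  ultimately have ex: "exp (- (2 * t * (norm w)\<^sup>2) / (4 * t)) = exp (- (norm w)\<^sup>2 / 2)" by simp
  show ?thesis
    unfolding p_kernel_def gauss_def scaleR_K_mat[OF t] add_diff_cancel_left' quad ex DIM const[symmetric]
    by (simp only: mult.assoc)
qed

lemma integral_p_kernel:
  fixes Q B R :: "real^'n^'n" and f :: "real^'n \<Rightarrow> real"
  assumes t: "t > 0" and R: "R ** transpose R = 2 *\<^sub>R covariance Q B t" and S: "S ** R = mat 1"
    and f: "f \<in> borel_measurable borel"
  shows "(LINT Y|lborel. p_kernel Q B X Y t * f Y) = (LINT w|lborel. f (matrix_exp (t *\<^sub>R B) *v X + R *v w) * gauss w)"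
proof -
  let ?c = "matrix_exp (t *\<^sub>R B) *v X"
  have dR: "det R \<noteq> 0" using S by (metis det_I det_mul mult_zero_right zero_neq_one)
  have cont: "continuous_on UNIV (\<lambda>Y. p_kernel Q B X Y t)" unfolding p_kernel_def
    by (intro continuous_intros bounded_linear.continuous_on[OF matrix_vector_mul_bounded_linear]) (use t in auto)
  have m: "(\<lambda>Y. p_kernel Q B X Y t * f Y) \<in> borel_measurable borel"
    using borel_measurable_continuous_onI[OF cont] f by measurable
  have "(LINT Y|lborel. p_kernel Q B X Y t * f Y) = (LINT Y|lborel. p_kernel Q B X (Y + ?c) t * f (Y + ?c))"
    by (rule lborel_translate(1)[OF m, symmetric])
  also have "\<dots> = \<bar>det R\<bar> * (LINT w|lborel. p_kernel Q B X (R *v w + ?c) t * f (R *v w + ?c))"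
    by (rule integral_matrix_mult[OF dR]) (use m in measurable)
  also have "\<dots> = (LINT w|lborel. \<bar>det R\<bar> * (p_kernel Q B X (R *v w + ?c) t * f (R *v w + ?c)))"
    by simp
  also have "\<dots> = (LINT w|lborel. f (?c + R *v w) * gauss w)"
  proof (intro Bochner_Integration.integral_cong refl)
    show "\<bar>det R\<bar> * (p_kernel Q B X (R *v w + ?c) t * f (R *v w + ?c)) = f (?c + R *v w) * gauss w" for w
      unfolding p_kernel_eq_gauss[OF t R S, of X w, symmetric] by (simp only: add.commute[of ?c] mult_ac)
  qed
  finally show ?thesis .
qed

section \<open>Gaussian averages\<close>

abbreviation DX :: "'n \<Rightarrow> ((real^'n) \<times> real \<Rightarrow> real) \<Rightarrow> (real^'n) \<times> real \<Rightarrow> real" where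
  "DX i f \<equiv> \<lambda>x. frechet_derivative f (at x) (axis i 1, 0)"

abbreviation DT :: "((real^'n) \<times> real \<Rightarrow> real) \<Rightarrow> (real^'n) \<times> real \<Rightarrow> real" where
  "DT f \<equiv> \<lambda>x. frechet_derivative f (at x) (0, 1)"

lemma sum_Basis_prod_real:
  "(\<Sum>b\<in>(Basis :: ((real^'n) \<times> real) set). g b) = (\<Sum>i\<in>UNIV. g (axis i 1, 0)) + g (0, 1)"
proof -
  have "(\<Sum>b\<in>(Basis :: ((real^'n) \<times> real) set). g b)
      = (\<Sum>b\<in>(\<lambda>u. (u, 0)) ` (Basis :: (real^'n) set). g b) + (\<Sum>b\<in>(\<lambda>u. (0, u)) ` (Basis :: real set). g b)"
    unfolding Basis_prod_def by (rule sum.union_disjoint) auto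
  also have "(\<Sum>b\<in>(\<lambda>u. (u, 0)) ` (Basis :: (real^'n) set). g b) = (\<Sum>b\<in>(Basis :: (real^'n) set). g (b, 0))"
    by (subst sum.reindex) (auto simp: inj_on_def)
  finally show ?thesis by (simp add: sum_Basis_vec)
qed

lemma frechet_derivative_prod:
  fixes f :: "(real^'n) \<times> real \<Rightarrow> real"
  assumes "f differentiable (at x)"
  shows "frechet_derivative f (at x) v = (\<Sum>i\<in>UNIV. (fst v $ i) * DX i f x) + snd v * DT f x"
  by (subst frechet_derivative_basis[OF assms]) (simp add: sum_Basis_prod_real inner_prod_def inner_axis)

text \<open>Minimum over the compact unit sphere, extended by homogeneity.\<close>

lemma pos_def_lower_bound:
  fixes M :: "real^'n^'n"
  assumes "pos_def M"
  shows "\<exists>c>0. \<forall>z. c * (norm z)\<^sup>2 \<le> (M *v z) \<bullet> z"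
proof -
  have cont: "continuous_on (sphere 0 1) (\<lambda>z. (M *v z) \<bullet> z)"
    by (intro continuous_on_inner continuous_on_id linear_continuous_on) simp
  have "sphere (0::real^'n) 1 \<noteq> {}" by simp
  then obtain z0 where z0: "z0 \<in> sphere 0 1" "\<And>z. z \<in> sphere 0 1 \<Longrightarrow> (M *v z0) \<bullet> z0 \<le> (M *v z) \<bullet> z"
    using continuous_attains_inf[OF compact_sphere _ cont] by blast
  let ?c = "(M *v z0) \<bullet> z0"
  have "z0 \<noteq> 0" using z0(1) by auto
  then have "?c > 0" using assms by (simp add: pos_def_def)
  moreover have "?c * (norm z)\<^sup>2 \<le> (M *v z) \<bullet> z" for z
  proof (cases "z = 0")
    case False
    have "?c \<le> (M *v (inverse (norm z) *\<^sub>R z)) \<bullet> (inverse (norm z) *\<^sub>R z)"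
      by (rule z0(2)) (use False in simp)
    also have "\<dots> = ((M *v z) \<bullet> z) / (norm z)\<^sup>2"
      by (simp add: matrix_vector_mult_scaleR field_simps power2_eq_square)
    finally show ?thesis using False by (simp add: field_simps)
  qed simp
  ultimately show ?thesis by blast
qed

text \<open>Differentiating an average in its matrix produces the factor |w|, which is not a
  polynomial; it is majorised by 1 + |w|^2.\<close>

lemma integrable_norm_gauss: "integrable lborel (\<lambda>w::'m::euclidean_space. norm w * gauss w)"
proof -
  have p: "poly_gauss (\<lambda>w::'m. (\<Sum>m\<in>Basis. (w \<bullet> m) * (w \<bullet> m)) * gauss w)"
    by (intro poly_gauss_mult poly_gauss_gauss real_polynomial_function_sum real_polynomial_function.intros(4)
        real_polynomial_function.intros(1) bounded_linear_inner_left) simp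
  have 1: "integrable lborel (\<lambda>w::'m. gauss w + (w \<bullet> w) * gauss w)"
    using poly_gauss_integrable[OF poly_gauss_gauss, of "0::'m"] poly_gauss_integrable[OF p, of 0]
    by (simp add: euclidean_inner[of w w for w :: 'm])
  have g: "gauss w \<ge> 0" for w :: 'm unfolding gauss_def by simp
  have [measurable]: "gauss \<in> borel_measurable (borel :: 'm measure)"
    by (rule poly_gauss_measurable[OF poly_gauss_gauss])
  show ?thesis
  proof (rule Bochner_Integration.integrable_bound[OF 1])
    show "AE w in lborel. norm (norm w * gauss w) \<le> norm (gauss w + (w \<bullet> w) * gauss (w :: 'm))"
    proof (rule AE_I2)
      fix w :: 'm
      have "0 \<le> (norm w - 1)\<^sup>2" by simp
      then have "norm w \<le> 1 + w \<bullet> w"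
        by (simp add: power2_diff power2_norm_eq_inner) (smt (verit) norm_ge_zero)
      then have "norm w * gauss w \<le> (1 + w \<bullet> w) * gauss w" using g by (rule mult_right_mono)
      with g[of w] show "norm (norm w * gauss w) \<le> norm (gauss w + (w \<bullet> w) * gauss w)"
        by (simp add: distrib_right)
    qed
  qed measurable
qed

text \<open>Centre and matrix are varied jointly as one point \<open>p\<close>, so the chain rule
  covers both the curve of drift and root in time and the segment \<theta> R. The matrix direction
  brings in the first moment of the Gaussian, hence the term with \<open>norm w * gauss w\<close> in
  the majorant.\<close>

lemma gaussian_matrix_has_derivative:
  fixes f :: "(real^'n) \<times> real \<Rightarrow> real"
  assumes f: "bounded_smooth f"
  shows "((\<lambda>p. \<integral>w. f (fst p + (snd p *v w, 0)) * gauss w \<partial>lborel) has_derivative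
      (\<lambda>q. \<integral>w. frechet_derivative f (at (fst p + (snd p *v w, 0))) (fst q + (snd q *v w, 0)) * gauss w \<partial>lborel))
      (at (p :: ((real^'n) \<times> real) \<times> (real^'n^'n)))"
proof -
  obtain M where M: "M \<ge> 0" "\<And>x v. \<bar>frechet_derivative f (at x) v\<bar> \<le> M * norm v"
    using uniform_smooth_deriv_bound[OF f] by auto
  obtain K where K: "K \<ge> 0" "\<And>A w. norm ((A :: real^'n^'n) *v w) \<le> norm A * norm w * K"
    using bounded_bilinear.nonneg_bounded[OF bounded_bilinear_matrix_vector_mult] by blast
  have g: "gauss w \<ge> 0" for w :: "real^'n" unfolding gauss_def by simp
  have [measurable]: "f \<in> borel_measurable borel" "gauss \<in> borel_measurable (borel :: (real^'n) measure)"
    using bounded_smooth_measurable[OF f] poly_gauss_measurable[OF poly_gauss_gauss] by auto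
  have cm: "(\<lambda>w. (c :: (real^'n) \<times> real) + ((A :: real^'n^'n) *v w, 0)) \<in> borel_measurable borel" for c A
    by (intro borel_measurable_continuous_onI continuous_intros linear_continuous_on) simp
  let ?g = "\<lambda>w::real^'n. M * (gauss w + K * (norm w * gauss w))"
  have ig: "integrable lborel ?g"
    using poly_gauss_integrable[OF poly_gauss_gauss, of "0::real^'n"]
    by (intro integrable_mult_right Bochner_Integration.integrable_add integrable_norm_gauss) simp
  show ?thesis
  proof (rule has_derivative_integral(1)[where e=1 and g="?g"])
    show "((\<lambda>p. f (fst p + (snd p *v w, 0)) * gauss w) has_derivative
        (\<lambda>q. frechet_derivative f (at (fst p + (snd p *v w, 0))) (fst q + (snd q *v w, 0)) * gauss w)) (at p)" for p :: "((real^'n) \<times> real) \<times> (real^'n^'n)" and w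
    proof (rule has_derivative_mult_left)
      have "bounded_linear (\<lambda>p :: ((real^'n) \<times> real) \<times> (real^'n^'n). fst p + (snd p *v w, 0 :: real))"
        by (rule bounded_linear_add[OF bounded_linear_fst bounded_linear_Pair[OF
            bounded_linear_compose[OF bounded_bilinear.bounded_linear_left[OF bounded_bilinear_matrix_vector_mult]
              bounded_linear_snd] bounded_linear_zero]])
      from has_derivative_compose[OF bounded_linear_imp_has_derivative[OF this] bounded_smooth_has_derivative[OF f]]
      show "((\<lambda>p. f (fst p + (snd p *v w, 0))) has_derivative
        (\<lambda>q. frechet_derivative f (at (fst p + (snd p *v w, 0))) (fst q + (snd q *v w, 0)))) (at p)" .
    qed
    show "integrable lborel (\<lambda>w. f (fst p + (snd p *v w, 0)) * gauss w)" for p :: "((real^'n) \<times> real) \<times> (real^'n^'n)"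
    proof -
      obtain M0 where M0: "\<And>x. \<bar>f x\<bar> \<le> M0" using uniform_smooth_bounded[OF f] by auto
      show ?thesis
      proof (rule Bochner_Integration.integrable_bound)
        show "integrable lborel (\<lambda>w::real^'n. M0 * gauss w)"
          using poly_gauss_integrable[OF poly_gauss_gauss, of "0::real^'n"] by simp
        show "(\<lambda>w. f (fst p + (snd p *v w, 0)) * gauss w) \<in> borel_measurable lborel"
          using measurable_compose[OF cm bounded_smooth_measurable[OF f]] by measurable
        have "\<bar>f x * gauss w\<bar> \<le> \<bar>M0 * gauss w\<bar>" for x and w :: "real^'n"
          unfolding abs_mult by (intro mult_right_mono order_trans[OF M0 abs_ge_self]) auto
        then show "AE w in lborel. norm (f (fst p + (snd p *v w, 0)) * gauss w) \<le> norm (M0 * gauss w)"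
          by (intro AE_I2) simp
      qed
    qed
    show "(\<lambda>w. frechet_derivative f (at (fst p + (snd p *v w, 0))) (fst v + (snd v *v w, 0)) * gauss w) \<in> borel_measurable lborel" for v :: "((real^'n) \<times> real) \<times> (real^'n^'n)"
    proof -
      have [measurable]: "(\<lambda>w. DX i f (fst p + (snd p *v w, 0))) \<in> borel_measurable borel"
        "(\<lambda>w. DT f (fst p + (snd p *v w, 0))) \<in> borel_measurable borel" for i
        by (rule measurable_compose[OF cm bounded_smooth_measurable[OF uniform_smooth_deriv[OF f]]])+
      have "(\<lambda>w. snd v *v w) \<in> borel_measurable borel"
        by (intro borel_measurable_continuous_onI linear_continuous_on) simp
      then have [measurable]: "(\<lambda>w. (snd v *v w) $ i) \<in> borel_measurable borel" for i
        by (rule measurable_compose) (intro borel_measurable_continuous_onI continuous_intros)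
      show ?thesis
      proof (subst measurable_cong)
        show "frechet_derivative f (at (fst p + (snd p *v w, 0))) (fst v + (snd v *v w, 0)) * gauss w
          = ((\<Sum>i\<in>UNIV. (fst (fst v) $ i + (snd v *v w) $ i) * DX i f (fst p + (snd p *v w, 0)))
              + snd (fst v) * DT f (fst p + (snd p *v w, 0))) * gauss w" for w
          by (rule arg_cong[of _ _ "\<lambda>r. r * gauss w", OF trans[OF frechet_derivative_prod[OF uniform_smooth_differentiable[OF f]]]])
            simp_all
      qed measurable
    qed
    show "\<bar>frechet_derivative f (at (fst y + (snd y *v w, 0))) (fst v + (snd v *v w, 0)) * gauss w\<bar> \<le> ?g w * norm v"
      for y v :: "((real^'n) \<times> real) \<times> (real^'n^'n)" and w
    proof -
      have "norm (fst v + (snd v *v w, 0 :: real)) \<le> norm (fst v) + norm (snd v *v w, 0 :: real)" by (rule norm_triangle_ineq)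
      also have "norm (snd v *v w, 0 :: real) = norm (snd v *v w)" by (simp add: norm_Pair)
      also have "norm (fst v) + norm (snd v *v w) \<le> norm v + norm v * norm w * K"
        using norm_fst_le[of "fst v" "snd v"] norm_snd_le[of "snd v" "fst v"] K
        by (intro add_mono order_trans[OF K(2)] mult_right_mono) auto
      finally have "norm (fst v + (snd v *v w, 0 :: real)) \<le> norm v + norm v * norm w * K" .
      then have "\<bar>frechet_derivative f (at (fst y + (snd y *v w, 0))) (fst v + (snd v *v w, 0))\<bar> \<le> M * (norm v + norm v * norm w * K)"
        using M(1) by (intro order_trans[OF M(2)] mult_left_mono)
      then have "\<bar>frechet_derivative f (at (fst y + (snd y *v w, 0))) (fst v + (snd v *v w, 0)) * gauss w\<bar>
          \<le> M * (norm v + norm v * norm w * K) * gauss w"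
        unfolding abs_mult abs_of_nonneg[OF g] using g by (rule mult_right_mono)
      also have "\<dots> = ?g w * norm v" by (simp add: algebra_simps)
      finally show ?thesis .
    qed
  qed (use ig in auto)
qed

lemma frechet_derivative_sum_DX:
  fixes f :: "(real^'n) \<times> real \<Rightarrow> real"
  assumes f: "bounded_smooth f"
  shows "frechet_derivative (\<lambda>y. frechet_derivative f (at y) (a, 0)) (at x) (b, 0)
    = (\<Sum>i\<in>UNIV. \<Sum>j\<in>UNIV. (b $ i * a $ j) * DX i (DX j f) x)"
proof -
  have e: "(\<lambda>y. frechet_derivative f (at y) (a, 0)) = (\<lambda>y. \<Sum>j\<in>UNIV. a $ j * DX j f y)"
  proof (rule ext)
    show "frechet_derivative f (at y) (a, 0) = (\<Sum>j\<in>UNIV. a $ j * DX j f y)" for y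
      by (rule trans[OF frechet_derivative_prod[OF uniform_smooth_differentiable[OF f]]]) simp_all
  qed
  have "((\<lambda>y. \<Sum>j\<in>UNIV. a $ j * DX j f y) has_derivative
      (\<lambda>v. \<Sum>j\<in>UNIV. a $ j * frechet_derivative (DX j f) (at x) v)) (at x)"
    by (intro has_derivative_sum has_derivative_mult_right bounded_smooth_has_derivative uniform_smooth_deriv[OF f])
  then have "frechet_derivative (\<lambda>y. \<Sum>j\<in>UNIV. a $ j * DX j f y) (at x)
      = (\<lambda>v. \<Sum>j\<in>UNIV. a $ j * frechet_derivative (DX j f) (at x) v)" by (rule frechet_derivative_at[symmetric])
  moreover have "frechet_derivative (DX j f) (at x) (b, 0) = (\<Sum>i\<in>UNIV. b $ i * DX i (DX j f) x)" for j
    by (rule trans[OF frechet_derivative_prod[OF uniform_smooth_differentiable[OF uniform_smooth_deriv[OF f]]]]) simp_all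
  ultimately have "frechet_derivative (\<lambda>y. frechet_derivative f (at y) (a, 0)) (at x) (b, 0)
      = (\<Sum>j\<in>UNIV. a $ j * (\<Sum>i\<in>UNIV. b $ i * DX i (DX j f) x))" unfolding e by (simp only:)
  also have "\<dots> = (\<Sum>j\<in>UNIV. \<Sum>i\<in>UNIV. (b $ i * a $ j) * DX i (DX j f) x)"
    unfolding sum_distrib_left by (intro sum.cong refl) (simp only: mult_ac)
  also have "\<dots> = (\<Sum>i\<in>UNIV. \<Sum>j\<in>UNIV. (b $ i * a $ j) * DX i (DX j f) x)" by (rule sum.swap)
  finally show ?thesis .
qed

text \<open>Each factor <w, m> coming from R' w is traded by
  \<open>gaussian_integration_by_parts\<close> for a derivative along R m; summing over the basis
  collects the products (R m)_i (R' m)_j into the entries of R R'^T.\<close>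

lemma gaussian_second_order_identity:
  fixes f :: "(real^'n) \<times> real \<Rightarrow> real" and R R' :: "real^'n^'n"
  assumes f: "bounded_smooth f"
  shows "(\<integral>w. frechet_derivative f (at (y + (R *v w, 0))) (R' *v w, 0) * gauss w \<partial>lborel)
    = (\<Sum>i\<in>UNIV. \<Sum>j\<in>UNIV. (R ** transpose R') $ i $ j * (\<integral>w. DX i (DX j f) (y + (R *v w, 0)) * gauss w \<partial>lborel))"
proof -
  let ?Y = "\<lambda>w. y + (R *v w, 0 :: real)"
  let ?D = "\<lambda>m x. frechet_derivative f (at x) (R' *v m, 0)"
  have bD: "bounded_smooth (?D m)" for m by (rule uniform_smooth_deriv[OF f])
  have cm: "?Y \<in> borel_measurable borel"
    by (intro borel_measurable_continuous_onI continuous_intros linear_continuous_on) simp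
  have blR: "bounded_linear (\<lambda>w. (R *v w, 0 :: real))"
    by (rule bounded_linear_Pair[OF matrix_vector_mul_bounded_linear bounded_linear_zero])
  obtain K where K: "K \<ge> 0" "\<And>w. norm (R *v w, 0 :: real) \<le> norm w * K"
    using bounded_linear.nonneg_bounded[OF blR] by blast
  have parts: "(\<integral>w. (w \<bullet> m) * ?D m (?Y w) * gauss w \<partial>lborel)
      = (\<integral>w. frechet_derivative (?D m) (at (?Y w)) (R *v m, 0) * gauss w \<partial>lborel)
      \<and> integrable lborel (\<lambda>w. (w \<bullet> m) * ?D m (?Y w) * gauss w)" for m
  proof -
    obtain M where M: "M \<ge> 0" "\<And>x. \<bar>?D m x\<bar> \<le> M" using uniform_smooth_bounded[OF bD[of m]] by auto
    obtain M' where M': "M' \<ge> 0" "\<And>x v. \<bar>frechet_derivative (?D m) (at x) v\<bar> \<le> M' * norm v"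
      using uniform_smooth_deriv_bound[OF bD[of m]] by auto
    have d: "((\<lambda>w. ?D m (?Y w)) has_derivative (\<lambda>v. frechet_derivative (?D m) (at (?Y w)) (R *v v, 0))) (at w)" for w
      by (rule has_derivative_compose[OF _ bounded_smooth_has_derivative[OF bD]])
         (use has_derivative_add[OF has_derivative_const bounded_linear_imp_has_derivative[OF blR]] in simp)
    have m: "(\<lambda>w. frechet_derivative (?D m) (at (?Y w)) (R *v v, 0)) \<in> borel_measurable borel" for v
      by (rule measurable_compose[OF cm bounded_smooth_measurable[OF uniform_smooth_deriv[OF bD]]])
    \<comment> \<open>\<open>gaussian_integration_by_parts\<close> takes a single constant for
      function and derivative, hence the maximum; \<open>K\<close> bounds the action of
      \<open>R\<close>.\<close>
    have b1: "\<bar>?D m (?Y w)\<bar> \<le> max M (M' * K)" for w using M(2)[of "?Y w"] by linarith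
    have b2: "\<bar>frechet_derivative (?D m) (at (?Y w)) (R *v v, 0)\<bar> \<le> max M (M' * K) * norm v" for w v
    proof -
      have "\<bar>frechet_derivative (?D m) (at (?Y w)) (R *v v, 0)\<bar> \<le> M' * (norm v * K)"
        using M' K by (intro order_trans[OF M'(2)] mult_left_mono)
      also have "\<dots> = (M' * K) * norm v" by simp
      also have "\<dots> \<le> max M (M' * K) * norm v" by (intro mult_right_mono) auto
      finally show ?thesis .
    qed
    show ?thesis
      by (rule conjI[OF gaussian_integration_by_parts[OF d m b1 b2]])
  qed
  have e: "frechet_derivative f (at (?Y w)) (R' *v w, 0) * gauss w
      = (\<Sum>m\<in>Basis. (w \<bullet> m) * ?D m (?Y w) * gauss w)" for w
  proof -
    have lin: "linear (\<lambda>v. frechet_derivative f (at (?Y w)) (R' *v v, 0))"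
    proof -
      have "linear (\<lambda>v. (R' *v v, 0 :: real))"
        by (rule bounded_linear.linear[OF bounded_linear_Pair[OF matrix_vector_mul_bounded_linear bounded_linear_zero]])
      from linear_compose[OF this linear_frechet_derivative[OF uniform_smooth_differentiable[OF f]]]
      show ?thesis by (simp add: comp_def)
    qed
    have "frechet_derivative f (at (?Y w)) (R' *v (\<Sum>m\<in>Basis. (w \<bullet> m) *\<^sub>R m), 0) = (\<Sum>m\<in>Basis. (w \<bullet> m) * ?D m (?Y w))"
      by (subst linear_sum[OF lin]) (simp add: linear_cmul[OF lin])
    then show ?thesis by (simp add: euclidean_representation sum_distrib_right)
  qed
  have intDD: "integrable lborel (\<lambda>w. DX i (DX j f) (?Y w) * gauss w)" for i j
  proof -
    have "bounded_smooth (DX i (DX j f))" by (intro uniform_smooth_deriv f)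
    from gaussian_shift_integral_has_derivative(1)[OF this poly_gauss_gauss, of "\<lambda>_::real. 0" "\<lambda>w. (R *v w, 0)" "\<lambda>_. 0" y 0]
    show ?thesis using blR by simp
  qed
  have "(\<integral>w. frechet_derivative f (at (?Y w)) (R' *v w, 0) * gauss w \<partial>lborel)
      = (\<Sum>m\<in>Basis. \<integral>w. frechet_derivative (?D m) (at (?Y w)) (R *v m, 0) * gauss w \<partial>lborel)"
  proof -
    have "(\<integral>w. frechet_derivative f (at (?Y w)) (R' *v w, 0) * gauss w \<partial>lborel)
        = (\<Sum>m\<in>Basis. \<integral>w. (w \<bullet> m) * ?D m (?Y w) * gauss w \<partial>lborel)"
      unfolding e by (rule Bochner_Integration.integral_sum) (rule conjunct2[OF parts])
    also have "\<dots> = (\<Sum>m\<in>Basis. \<integral>w. frechet_derivative (?D m) (at (?Y w)) (R *v m, 0) * gauss w \<partial>lborel)"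
      by (intro sum.cong refl) (rule conjunct1[OF parts])
    finally show ?thesis .
  qed
  also have "\<dots> = (\<Sum>m\<in>Basis. \<Sum>i\<in>UNIV. \<Sum>j\<in>UNIV. ((R *v m) $ i * (R' *v m) $ j) * (\<integral>w. DX i (DX j f) (?Y w) * gauss w \<partial>lborel))"
  proof (intro sum.cong refl)
    fix m :: "real^'n"
    have "(\<integral>w. frechet_derivative (?D m) (at (?Y w)) (R *v m, 0) * gauss w \<partial>lborel)
      = (\<integral>w. (\<Sum>i\<in>UNIV. \<Sum>j\<in>UNIV. ((R *v m) $ i * (R' *v m) $ j) * (DX i (DX j f) (?Y w) * gauss w)) \<partial>lborel)"
      by (intro Bochner_Integration.integral_cong refl, subst frechet_derivative_sum_DX[OF f])
        (simp only: sum_distrib_right mult.assoc)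
    also have "\<dots> = (\<Sum>i\<in>UNIV. \<Sum>j\<in>UNIV. ((R *v m) $ i * (R' *v m) $ j) * (\<integral>w. DX i (DX j f) (?Y w) * gauss w \<partial>lborel))"
      using intDD by (simp add: Bochner_Integration.integral_sum)
    finally show "(\<integral>w. frechet_derivative (?D m) (at (?Y w)) (R *v m, 0) * gauss w \<partial>lborel)
      = (\<Sum>i\<in>UNIV. \<Sum>j\<in>UNIV. ((R *v m) $ i * (R' *v m) $ j) * (\<integral>w. DX i (DX j f) (?Y w) * gauss w \<partial>lborel))" .
  qed
  also have "\<dots> = (\<Sum>i\<in>UNIV. \<Sum>j\<in>UNIV. \<Sum>k\<in>UNIV. (R $ i $ k * R' $ j $ k) * (\<integral>w. DX i (DX j f) (?Y w) * gauss w \<partial>lborel))"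
  proof -
    have "(R *v axis k 1) $ i = R $ i $ k" "(R' *v axis k 1) $ i = R' $ i $ k" for k i
      by (simp_all add: matrix_vector_mult_basis column_def)
    moreover have "(\<Sum>k\<in>UNIV. \<Sum>i\<in>UNIV. \<Sum>j\<in>UNIV. x k i j) = (\<Sum>i\<in>UNIV. \<Sum>j\<in>UNIV. \<Sum>k\<in>UNIV. x k i j)"
      for x :: "'n \<Rightarrow> 'n \<Rightarrow> 'n \<Rightarrow> real"
      by (rule trans[OF sum.swap]) (intro sum.cong refl sum.swap)
    ultimately show ?thesis unfolding sum_Basis_vec by (simp only:)
  qed
  also have "\<dots> = (\<Sum>i\<in>UNIV. \<Sum>j\<in>UNIV. (R ** transpose R') $ i $ j * (\<integral>w. DX i (DX j f) (?Y w) * gauss w \<partial>lborel))"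
    by (simp add: matrix_matrix_mult_def transpose_def sum_distrib_right)
  finally show ?thesis .
qed

section \<open>The evolutive semigroup\<close>

text \<open>Applied with P = R R'^T, C the rate of the covariance and G the symmetric array of
  averaged second derivatives: whichever root R was chosen, only the derivative of R R^T
  survives.\<close>

lemma sum_symmetric_part:
  fixes P C :: "real^'n^'n"
  assumes G: "\<And>i j. G i j = G j i" and PC: "\<And>i j. P $ i $ j + P $ j $ i = 2 * C $ i $ j"
  shows "(\<Sum>i\<in>UNIV. \<Sum>j\<in>UNIV. P $ i $ j * G i j) = (\<Sum>i\<in>UNIV. \<Sum>j\<in>UNIV. C $ i $ j * G i j)"
proof -
  have "(\<Sum>i\<in>UNIV. \<Sum>j\<in>UNIV. P $ j $ i * G i j) = (\<Sum>i\<in>UNIV. \<Sum>j\<in>UNIV. P $ i $ j * G i j)"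
    by (subst sum.swap) (intro sum.cong refl arg_cong2[where f="(*)"] G)
  then have "2 * (\<Sum>i\<in>UNIV. \<Sum>j\<in>UNIV. P $ i $ j * G i j)
      = (\<Sum>i\<in>UNIV. \<Sum>j\<in>UNIV. P $ i $ j * G i j) + (\<Sum>i\<in>UNIV. \<Sum>j\<in>UNIV. P $ j $ i * G i j)" by simp
  also have "\<dots> = (\<Sum>i\<in>UNIV. \<Sum>j\<in>UNIV. (P $ i $ j + P $ j $ i) * G i j)"
    by (simp only: sum.distrib distrib_right)
  also have "\<dots> = 2 * (\<Sum>i\<in>UNIV. \<Sum>j\<in>UNIV. C $ i $ j * G i j)"
    unfolding PC by (simp add: sum_distrib_left mult.assoc)
  finally show ?thesis by simp
qed

text \<open>\<open>R\<close> is a root of twice the covariance and \<open>S\<close> its inverse. The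
  locale hides their construction behind the listed properties; \<open>hypoelliptic_exists\<close>
  supplies them, and the proof of the theorem interprets the locale.\<close>

locale hypoelliptic =
  fixes Q B :: "real^'n^'n" and R S :: "real \<Rightarrow> real^'n^'n"
  assumes Q_sym: "Q = transpose Q" and Q_nonneg: "pos_semidef Q"
    and cov_pos: "\<And>t. t > 0 \<Longrightarrow> pos_def (covariance Q B t)"
    and R_diff: "\<And>t. t > 0 \<Longrightarrow> R differentiable (at t)"
    and R_root: "\<And>t. t > 0 \<Longrightarrow> R t ** transpose (R t) = 2 *\<^sub>R covariance Q B t"
    and S_inv: "\<And>t. t > 0 \<Longrightarrow> S t ** R t = mat 1"
begin

abbreviation E :: "real \<Rightarrow> real^'n^'n" where "E \<tau> \<equiv> matrix_exp (\<tau> *\<^sub>R B)"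

definition W :: "((real^'n) \<times> real \<Rightarrow> real) \<Rightarrow> real \<Rightarrow> (real^'n) \<times> real \<Rightarrow> real" where
  "W f \<tau> x = (\<integral>w. f ((E \<tau> *v fst x, snd x - \<tau>) + (R \<tau> *v w, 0)) * gauss w \<partial>lborel)"

lemma semigroup_P_eq_W:
  assumes "bounded_smooth u" "\<tau> > 0"
  shows "semigroup_P Q B \<tau> u X t = W u \<tau> (X, t)"
proof -
  have m: "(\<lambda>Y. u (Y, t - \<tau>)) \<in> borel_measurable borel"
    by (intro borel_measurable_continuous_onI continuous_on_compose2[OF bounded_smooth_continuous[OF assms(1), of UNIV]]
        continuous_intros) auto
  show ?thesis unfolding semigroup_P_def W_def
    by (subst integral_p_kernel[OF assms(2) R_root[OF assms(2)] S_inv[OF assms(2)] m]) simp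
qed

text \<open>With v = S E V and y = S^T v, the equation for the root gives |v|^2 = 2 <covariance y,
  y> = <y, E V>. The lower bound through time 1 controls z = E(t - 1)^T y by a multiple of |v|, and
  <y, E V> = <E(1)^T z, V> then yields |v|^2 \<le> K |v| |V|.\<close>

lemma S_E_bound: "\<exists>K\<ge>0. \<forall>t\<ge>1. \<forall>V. norm (S t *v (E t *v V)) \<le> K * norm V"
proof -
  obtain c where c: "c > 0" "\<And>z. c * (norm z)\<^sup>2 \<le> (covariance Q B 1 *v z) \<bullet> z"
    using pos_def_lower_bound[OF cov_pos[of 1]] by auto
  obtain k where k: "k \<ge> 0" "\<And>z. norm (transpose (E 1) *v z) \<le> norm z * k"
    using bounded_linear.nonneg_bounded[OF matrix_vector_mul_bounded_linear[of "transpose (E 1)"]] by blast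
  define K where "K = k / sqrt (2 * c)"
  have "norm (S t *v (E t *v V)) \<le> K * norm V" if "t \<ge> 1" for t V
  proof -
    have t: "t > 0" using that by simp
    define v where "v = S t *v (E t *v V)"
    define y where "y = transpose (S t) *v v"
    define z where "z = transpose (E (t - 1)) *v y"
    have RS: "R t ** S t = mat 1" using matrix_left_right_inverse1[OF S_inv[OF t]] .
    have "transpose (S t ** R t) = mat 1" unfolding S_inv[OF t] by (rule transpose_mat)
    then have RtSt: "transpose (R t) ** transpose (S t) = mat 1" by (simp add: matrix_transpose_mul)
    have "(2 *\<^sub>R covariance Q B t) *v y = E t *v V"
    proof -
      have "(R t ** transpose (R t)) *v y = R t *v ((transpose (R t) ** transpose (S t)) *v v)"
        unfolding y_def by (simp only: matrix_vector_mul_assoc matrix_mul_assoc)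
      also have "\<dots> = (R t ** S t) *v (E t *v V)" unfolding RtSt v_def matrix_vector_mul_lid
        by (simp only: matrix_vector_mul_assoc matrix_mul_assoc)
      finally show ?thesis unfolding R_root[OF t] RS by simp
    qed
    moreover have yE: "y \<bullet> (E t *v V) = (norm v)\<^sup>2"
    proof -
      have "y \<bullet> (E t *v V) = v \<bullet> (S t *v (E t *v V))"
        unfolding y_def by (simp only: inner_matrix_vector_mult[of "transpose (S t)"] transpose_transpose)
      then show ?thesis unfolding v_def[symmetric] by (simp add: power2_norm_eq_inner)
    qed
    ultimately have "2 * ((covariance Q B t *v y) \<bullet> y) = (norm v)\<^sup>2"
      by (metis inner_commute inner_scaleR_left scaleR_matrix_vector_assoc)
    moreover have "c * (norm z)\<^sup>2 \<le> (covariance Q B t *v y) \<bullet> y"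
      using c(2)[of z] covariance_lower_bound[OF Q_nonneg that, of B y] unfolding z_def by linarith
    ultimately have zv: "2 * c * (norm z)\<^sup>2 \<le> (norm v)\<^sup>2" by simp
    have Ey: "transpose (E t) *v y = transpose (E 1) *v z"
    proof -
      have "E t = E (t - 1) ** E 1" using matrix_exp_add[of "t - 1" 1 B] by simp
      then show ?thesis unfolding z_def by (simp only: matrix_transpose_mul matrix_vector_mul_assoc)
    qed
    have "(norm v)\<^sup>2 = (transpose (E t) *v y) \<bullet> V"
      unfolding yE[symmetric] using inner_matrix_vector_mult[of "E t" V y] by (simp add: inner_commute)
    also have "\<dots> \<le> norm (transpose (E t) *v y) * norm V" by (rule norm_cauchy_schwarz)
    also have "\<dots> \<le> (norm z * k) * norm V" unfolding Ey by (rule mult_right_mono[OF k(2)]) simp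
    also have "\<dots> \<le> (norm v / sqrt (2 * c)) * k * norm V"
    proof -
      have "(sqrt (2 * c) * norm z)\<^sup>2 \<le> (norm v)\<^sup>2" using zv c(1) by (simp add: power_mult_distrib)
      then have "sqrt (2 * c) * norm z \<le> norm v" by (rule power2_le_imp_le) simp
      then have "norm z \<le> norm v / sqrt (2 * c)" using c(1) by (simp add: field_simps)
      then show ?thesis using k(1) by (intro mult_right_mono) auto
    qed
    finally have "norm v * norm v \<le> norm v * (K * norm V)" unfolding K_def by (simp add: power2_eq_square field_simps)
    then have "norm v \<le> K * norm V"
    proof (cases "v = 0")
      case False
      then have "norm v > 0" by simp
      with \<open>norm v * norm v \<le> norm v * (K * norm V)\<close> show ?thesis by (rule mult_left_le_imp_le)
    qed (use k(1) c(1) in \<open>simp add: K_def\<close>)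
    then show ?thesis unfolding v_def .
  qed
  moreover have "K \<ge> 0" unfolding K_def using k(1) c(1) by simp
  ultimately show ?thesis by blast
qed

lemma E_bound: "\<exists>K\<ge>0. \<forall>t\<in>{0..1}. \<forall>V. norm (E t *v V) \<le> K * norm V"
proof -
  have "bounded (E ` {0..1})"
    by (intro compact_imp_bounded compact_continuous_image continuous_on_matrix_exp compact_Icc)
  then obtain K where "\<forall>x\<in>E ` {0..1}. norm x \<le> K" unfolding bounded_iff by blast
  then have K: "\<And>t. t \<in> {0..1} \<Longrightarrow> norm (E t) \<le> K" by blast
  obtain k where k: "k \<ge> 0" "\<And>A V. norm ((A :: real^'n^'n) *v V) \<le> norm A * norm V * k"
    using bounded_bilinear.nonneg_bounded[OF bounded_bilinear_matrix_vector_mult] by blast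
  have K0: "K \<ge> 0" by (rule order_trans[OF norm_ge_zero K[of 0]]) simp
  have "norm (E t *v V) \<le> (K * k) * norm V" if "t \<in> {0..1}" for t V
  proof -
    have "norm (E t *v V) \<le> norm (E t) * norm V * k" by (rule k(2))
    also have "\<dots> \<le> K * norm V * k" using k(1) K[OF that] by (intro mult_right_mono) auto
    finally show ?thesis by (simp add: mult_ac)
  qed
  moreover have "K * k \<ge> 0" using K0 k by simp
  ultimately show ?thesis by blast
qed

text \<open>The matrix \<open>e\<^sup>\<tau>\<^sup>B\<close> may grow exponentially. For \<open>\<tau> > 1\<close> the Gaussian is therefore translated, so that the
  spatial derivatives fall on it and produce only the bounded factors \<open>R(\<tau>)\<^sup>-\<^sup>1 e\<^sup>\<tau>\<^sup>B\<close>.\<close>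
lemma W_uniform_smooth:
  assumes f: "bounded_smooth f"
  shows "uniform_smooth {0<..} (W f)"
proof -
  obtain K1 where K1: "K1 \<ge> 0" "\<And>t V. t \<in> {0..1} \<Longrightarrow> norm (E t *v V) \<le> K1 * norm V" using E_bound by blast
  obtain K2 where K2: "K2 \<ge> 0" "\<And>t V. t \<ge> 1 \<Longrightarrow> norm (S t *v (E t *v V)) \<le> K2 * norm V" using S_E_bound by blast
  \<comment> \<open>The split at 1 matches the two available bounds: \<open>E_bound\<close> covers
    times up to 1, \<open>S_E_bound\<close> those from 1 on.\<close>
  define A where "A \<tau> x = (if \<tau> \<le> 1 then E \<tau> *v fst x else 0, snd x)" for \<tau> and x :: "(real^'n) \<times> real"
  define L where "L \<tau> x = (if \<tau> \<le> 1 then 0 else S \<tau> *v (E \<tau> *v fst x))" for \<tau> and x :: "(real^'n) \<times> real"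
  define K where "K = K1 + K2 + 1"
  have blE: "bounded_linear (\<lambda>x :: (real^'n) \<times> real. E \<tau> *v fst x)" for \<tau>
    by (rule bounded_linear_compose[OF matrix_vector_mul_bounded_linear bounded_linear_fst])
  have "uniform_smooth {0<..} (\<lambda>\<tau> x. \<integral>w. f ((0, - \<tau>) + A \<tau> x + (R \<tau> *v w, 0)) * gauss (w - L \<tau> x) \<partial>lborel)"
  proof (rule gaussian_shift_integral_uniform_smooth[OF f poly_gauss_gauss])
    show "bounded_linear (A \<tau>)" for \<tau>
      unfolding A_def[abs_def]
      by (cases "\<tau> \<le> 1") (simp_all add: bounded_linear_Pair[OF blE bounded_linear_snd] bounded_linear_Pair[OF bounded_linear_zero bounded_linear_snd])
    show "bounded_linear (\<lambda>w. (R \<tau> *v w, 0 :: real))" for \<tau>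
      by (rule bounded_linear_Pair[OF matrix_vector_mul_bounded_linear bounded_linear_zero])
    show "bounded_linear (L \<tau>)" for \<tau>
      unfolding L_def[abs_def]
      by (cases "\<tau> \<le> 1") (simp_all add: bounded_linear_zero bounded_linear_compose[OF matrix_vector_mul_bounded_linear blE])
    fix \<tau> :: real and v :: "(real^'n) \<times> real" assume \<tau>: "\<tau> \<in> {0<..}"
    have le: "c * norm v \<le> K * norm v" if "c \<le> K" for c using that by (rule mult_right_mono) simp
    have "norm (A \<tau> v) \<le> norm (fst (A \<tau> v)) + norm (snd (A \<tau> v))" by (metis norm_Pair_le prod.collapse)
    also have "\<dots> \<le> K1 * norm (fst v) + norm (snd v)"
    proof (cases "\<tau> \<le> 1")
      case True
      then show ?thesis using K1(2)[of \<tau> "fst v"] \<tau> by (simp add: A_def)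
    next
      case False
      then show ?thesis using K1(1) by (simp add: A_def)
    qed
    also have "\<dots> \<le> K1 * norm v + norm v"
      using norm_fst_le[of "fst v" "snd v"] norm_snd_le[of "snd v" "fst v"] K1(1) by (intro add_mono mult_left_mono) auto
    also have "\<dots> \<le> K * norm v" using le[of "K1 + 1"] K2(1) by (simp add: K_def algebra_simps)
    finally show "norm (A \<tau> v) \<le> K * norm v" .
    have "norm (L \<tau> v) \<le> K2 * norm (fst v)"
    proof (cases "\<tau> \<le> 1")
      case True
      then show ?thesis using K2(1) by (simp add: L_def)
    next
      case False
      then show ?thesis using K2(2)[of \<tau> "fst v"] by (simp add: L_def)
    qed
    also have "\<dots> \<le> K2 * norm v" using norm_fst_le[of "fst v" "snd v"] K2(1) by (intro mult_left_mono) auto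
    also have "\<dots> \<le> K * norm v" using le[of K2] K1(1) by (simp add: K_def)
    finally show "norm (L \<tau> v) \<le> K * norm v" .
  qed
  moreover have eq: "W f \<tau> x = (\<integral>w. f ((0, - \<tau>) + A \<tau> x + (R \<tau> *v w, 0)) * gauss (w - L \<tau> x) \<partial>lborel)" if "\<tau> \<in> {0<..}" for \<tau> x
  proof (cases "\<tau> \<le> 1")
    case True
    then show ?thesis by (simp add: W_def A_def L_def add.commute)
  next
    case False
    let ?F = "\<lambda>w. f ((E \<tau> *v fst x, snd x - \<tau>) + (R \<tau> *v w, 0)) * gauss w"
    have m: "?F \<in> borel_measurable borel"
    proof -
      have "(\<lambda>w. (E \<tau> *v fst x, snd x - \<tau>) + (R \<tau> *v w, 0)) \<in> borel_measurable borel"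
        by (intro borel_measurable_continuous_onI continuous_intros linear_continuous_on) simp
      from measurable_compose[OF this bounded_smooth_measurable[OF f]] poly_gauss_measurable[OF poly_gauss_gauss]
      show ?thesis by measurable
    qed
    have "R \<tau> ** S \<tau> = mat 1" using matrix_left_right_inverse1[OF S_inv] that by simp
    \<comment> \<open>Hence translating \<open>w\<close> by \<open>L\<close> cancels the drifted
      point inside \<open>f\<close>.\<close>
    then have RL: "R \<tau> *v L \<tau> x = E \<tau> *v fst x" using False by (simp add: L_def matrix_vector_mul_assoc matrix_mul_assoc)
    have "(E \<tau> *v fst x, snd x - \<tau>) + (R \<tau> *v (w - L \<tau> x), 0) = (0, - \<tau>) + A \<tau> x + (R \<tau> *v w, 0)" for w
      using False by (simp add: A_def matrix_vector_mult_diff_distrib RL)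
    then show ?thesis
      unfolding W_def using lborel_translate(1)[OF m, of "- L \<tau> x"] by simp
  qed
  ultimately have "uniform_smooth_upto n {0<..} (W f)" for n
    by (subst uniform_smooth_upto_cong[where G="\<lambda>\<tau> x. \<integral>w. f ((0, - \<tau>) + A \<tau> x + (R \<tau> *v w, 0)) * gauss (w - L \<tau> x) \<partial>lborel"])
      (simp_all add: uniform_smooth_def)
  then show ?thesis unfolding uniform_smooth_def by blast
qed

lemma W_integrable:
  fixes f :: "(real^'n) \<times> real \<Rightarrow> real"
  assumes f: "bounded_smooth f"
  shows "integrable lborel (\<lambda>w. f (y + (R \<tau> *v w, 0)) * gauss w)"
proof -
  have blR: "bounded_linear (\<lambda>w. (R \<tau> *v w, 0 :: real))"
    by (rule bounded_linear_Pair[OF matrix_vector_mul_bounded_linear bounded_linear_zero])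
  show ?thesis
    using gaussian_shift_integral_has_derivative(1)[OF f poly_gauss_gauss bounded_linear_zero blR bounded_linear_zero,
        where c=y] by simp
qed

text \<open>Here all derivatives fall on \<open>f\<close>. The formula is exact, but its
  coefficients may grow with exp(\<tau> B), so it serves identities and not bounds.\<close>

lemma W_frechet_derivative:
  assumes f: "bounded_smooth f"
  shows "frechet_derivative (W f \<tau>) (at x) v = (\<Sum>i\<in>UNIV. (E \<tau> *v fst v) $ i * W (DX i f) \<tau> x) + snd v * W (DT f) \<tau> x"
proof -
  let ?A = "\<lambda>x :: (real^'n) \<times> real. (E \<tau> *v fst x, snd x)"
  have blA: "bounded_linear ?A"
    by (rule bounded_linear_Pair[OF bounded_linear_compose[OF matrix_vector_mul_bounded_linear bounded_linear_fst] bounded_linear_snd])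
  have blR: "bounded_linear (\<lambda>w. (R \<tau> *v w, 0 :: real))"
    by (rule bounded_linear_Pair[OF matrix_vector_mul_bounded_linear bounded_linear_zero])
  have We: "W g \<tau> x = (\<integral>w. g ((0, - \<tau>) + ?A x + (R \<tau> *v w, 0)) * gauss (w - 0) \<partial>lborel)" for g x
    unfolding W_def by simp
  have "(W f \<tau> has_derivative (\<lambda>v. (\<Sum>b\<in>Basis. (?A v \<bullet> b) * W (\<lambda>y. frechet_derivative f (at y) b) \<tau> x))) (at x)"
    using gaussian_shift_integral_has_derivative(2)[OF f poly_gauss_gauss blA blR bounded_linear_zero, of "(0, - \<tau>)" x]
    unfolding We[symmetric] by (simp add: We[abs_def])
  from frechet_derivative_at[OF this, symmetric] show ?thesis
    by (simp add: sum_Basis_prod_real inner_prod_def inner_axis)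
qed

text \<open>Chain rule along the curve of centre and root. The centre contributes the drift and the
  backward time shift; the root contributes the averaged second derivatives weighted by R R'^T, and
  their symmetry replaces this weight by the rate of the covariance.\<close>

lemma W_has_derivative_time:
  assumes f: "bounded_smooth f" and \<tau>: "\<tau> > 0"
  shows "((\<lambda>\<tau>. W f \<tau> x) has_real_derivative
     (\<Sum>i\<in>UNIV. (B *v (E \<tau> *v fst x)) $ i * W (DX i f) \<tau> x) - W (DT f) \<tau> x
     + (\<Sum>i\<in>UNIV. \<Sum>j\<in>UNIV. cov_rate Q B \<tau> $ i $ j * W (DX i (DX j f)) \<tau> x)) (at \<tau>)"
proof -
  obtain R' where R': "(R has_vector_derivative R') (at \<tau>)"
    using R_diff[OF \<tau>] vector_derivative_works by blast
  let ?\<gamma> = "\<lambda>\<tau>. ((E \<tau> *v fst x, snd x - \<tau>), R \<tau>)"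
  let ?y = "(E \<tau> *v fst x, snd x - \<tau>)"
  let ?D = "((B *v (E \<tau> *v fst x), - 1 :: real), R')"
  have dE: "((\<lambda>\<tau>. E \<tau> *v fst x) has_vector_derivative B *v (E \<tau> *v fst x)) (at \<tau>)"
    using bounded_linear.has_vector_derivative[OF bounded_bilinear.bounded_linear_left[OF bounded_bilinear_matrix_vector_mult]
        matrix_exp_has_vector_derivative[of B \<tau>], of "fst x"]
    by (simp add: matrix_vector_mul_assoc)
  have d\<gamma>: "(?\<gamma> has_vector_derivative ?D) (at \<tau>)"
  proof -
    have "((\<lambda>\<tau>. snd x - \<tau>) has_vector_derivative - 1) (at \<tau>)" by (auto intro!: derivative_eq_intros)
    then show ?thesis by (intro has_vector_derivative_Pair dE R')
  qed
  let ?\<Phi>' = "\<lambda>q. \<integral>w. frechet_derivative f (at (?y + (R \<tau> *v w, 0))) (fst q + (snd q *v w, 0)) * gauss w \<partial>lborel"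
  have "((\<lambda>\<tau>. W f \<tau> x) has_derivative (\<lambda>h. ?\<Phi>' (h *\<^sub>R ?D))) (at \<tau>)"
    using has_derivative_compose[OF d\<gamma>[unfolded has_vector_derivative_def] gaussian_matrix_has_derivative[OF f]]
    unfolding W_def by simp
  moreover have "?\<Phi>' (h *\<^sub>R ?D) = ?\<Phi>' ?D * h" for h
    using linear_cmul[OF has_derivative_linear[OF gaussian_matrix_has_derivative[OF f, of "(?y, R \<tau>)"]], of h ?D]
    by (simp add: mult.commute)
  ultimately have der: "((\<lambda>\<tau>. W f \<tau> x) has_real_derivative ?\<Phi>' ?D) (at \<tau>)"
    by (simp add: has_field_derivative_def mult.commute[of _ "?\<Phi>' ?D"])
  have lin: "linear ?\<Phi>'"
    using has_derivative_linear[OF gaussian_matrix_has_derivative[OF f, of "(?y, R \<tau>)"]] by simp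
  \<comment> \<open>Linearity separates the motion of the centre from that of the root.\<close>
  have "?\<Phi>' ?D = ?\<Phi>' (fst ?D, 0) + ?\<Phi>' (0, R')"
    using linear_add[OF lin, of "(fst ?D, 0)" "(0, R')"] by (simp del: fst_conv snd_conv, simp)
  moreover have "?\<Phi>' (fst ?D, 0) = (\<Sum>i\<in>UNIV. (B *v (E \<tau> *v fst x)) $ i * W (DX i f) \<tau> x) - W (DT f) \<tau> x"
  proof -
    let ?a = "B *v (E \<tau> *v fst x)"
    have "?\<Phi>' (fst ?D, 0) = (\<integral>w. (\<Sum>i\<in>UNIV. ?a $ i * (DX i f (?y + (R \<tau> *v w, 0)) * gauss w)) - DT f (?y + (R \<tau> *v w, 0)) * gauss w \<partial>lborel)"
    proof (intro Bochner_Integration.integral_cong refl)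
      fix w
      have "frechet_derivative f (at (?y + (R \<tau> *v w, 0))) (?a, - 1) = (\<Sum>i\<in>UNIV. ?a $ i * DX i f (?y + (R \<tau> *v w, 0))) - DT f (?y + (R \<tau> *v w, 0))"
        by (rule trans[OF frechet_derivative_prod[OF uniform_smooth_differentiable[OF f]]]) simp_all
      then show "frechet_derivative f (at (?y + (R \<tau> *v w, 0))) (fst (fst ?D, 0) + (snd (fst ?D, 0) *v w, 0)) * gauss w
        = (\<Sum>i\<in>UNIV. ?a $ i * (DX i f (?y + (R \<tau> *v w, 0)) * gauss w)) - DT f (?y + (R \<tau> *v w, 0)) * gauss w"
        by (simp add: left_diff_distrib sum_distrib_right mult.assoc)
    qed
    also have "\<dots> = (\<Sum>i\<in>UNIV. ?a $ i * W (DX i f) \<tau> x) - W (DT f) \<tau> x"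
      unfolding W_def using W_integrable[OF uniform_smooth_deriv[OF f], where y="?y" and \<tau>=\<tau>]
      by (simp add: Bochner_Integration.integral_diff Bochner_Integration.integral_sum Bochner_Integration.integrable_sum)
    finally show ?thesis .
  qed
  moreover have "?\<Phi>' (0, R') = (\<Sum>i\<in>UNIV. \<Sum>j\<in>UNIV. cov_rate Q B \<tau> $ i $ j * W (DX i (DX j f)) \<tau> x)"
  proof -
    let ?G = "\<lambda>i j. W (DX i (DX j f)) \<tau> x" and ?P = "R \<tau> ** transpose R'"
    have "?\<Phi>' (0, R') = (\<Sum>i\<in>UNIV. \<Sum>j\<in>UNIV. ?P $ i $ j * ?G i j)"
      using gaussian_second_order_identity[OF f, of ?y "R \<tau>" R'] unfolding W_def by simp
    \<comment> \<open>R R^T is differentiated in two ways: by the product rule, and as twice the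
      covariance.\<close>
    moreover have "?P $ i $ j + ?P $ j $ i = 2 * cov_rate Q B \<tau> $ i $ j" for i j
    proof -
      have "((\<lambda>t. R t ** transpose (R t)) has_vector_derivative (R \<tau> ** transpose R' + R' ** transpose (R \<tau>))) (at \<tau>)"
        by (intro bounded_bilinear.has_vector_derivative[OF bounded_bilinear_matrix_mult] R'
            bounded_linear.has_vector_derivative[OF bounded_linear_transpose])
      moreover have "((\<lambda>t. R t ** transpose (R t)) has_vector_derivative 2 *\<^sub>R cov_rate Q B \<tau>) (at \<tau>)"
        by (rule has_vector_derivative_transform_within_open[where S="{0<..}" and f="\<lambda>t. 2 *\<^sub>R covariance Q B t"])
          (use \<tau> in \<open>auto intro!: has_vector_derivative_scaleR[OF DERIV_const, simplified] bounded_linear.has_vector_derivative[OF bounded_linear_scaleR_right]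
            covariance_has_vector_derivative simp: R_root\<close>)
      ultimately have "R \<tau> ** transpose R' + R' ** transpose (R \<tau>) = 2 *\<^sub>R cov_rate Q B \<tau>"
        by (rule vector_derivative_unique_at)
      then have "(R \<tau> ** transpose R' + R' ** transpose (R \<tau>)) $ i $ j = (2 *\<^sub>R cov_rate Q B \<tau>) $ i $ j" by (simp only:)
      moreover have "R' ** transpose (R \<tau>) = transpose ?P" by (simp add: matrix_transpose_mul)
      ultimately show ?thesis by (simp add: transpose_def)
    qed
    moreover have "?G i j = ?G j i" for i j
      by (rule arg_cong[of _ _ "\<lambda>g. W g \<tau> x"], rule ext, rule frechet_derivative_commute[OF f])
    ultimately show ?thesis using sum_symmetric_part[of ?G ?P "cov_rate Q B \<tau>"] by simp
  qed
  ultimately show ?thesis using der by simp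
qed

text \<open>The time derivative with the derivatives of \<open>f\<close> inside the average.
  Continuity in \<tau> is visible in this form, while \<open>W_rate_eq\<close> moves the derivatives
  outside and exhibits the heat equation.\<close>

definition W_rate :: "((real^'n) \<times> real \<Rightarrow> real) \<Rightarrow> real \<Rightarrow> (real^'n) \<times> real \<Rightarrow> real" where
  "W_rate f \<tau> x = (\<Sum>i\<in>UNIV. (B *v (E \<tau> *v fst x)) $ i * W (DX i f) \<tau> x) - W (DT f) \<tau> x
     + (\<Sum>i\<in>UNIV. \<Sum>j\<in>UNIV. cov_rate Q B \<tau> $ i $ j * W (DX i (DX j f)) \<tau> x)"

lemma W_continuous_on_time: "bounded_smooth f \<Longrightarrow> continuous_on {0<..} (\<lambda>\<tau>. W f \<tau> x)"
  by (intro continuous_at_imp_continuous_on ballI DERIV_isCont[OF W_has_derivative_time]) auto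

lemma W_rate_continuous_on: 
  assumes f: "bounded_smooth f"
  shows "continuous_on {0<..} (\<lambda>\<tau>. W_rate f \<tau> x)"
proof -
  have "continuous_on {0<..} (\<lambda>\<tau>. B *v (E \<tau> *v fst x))"
    by (rule bounded_linear.continuous_on[OF matrix_vector_mul_bounded_linear])
      (rule bounded_linear.continuous_on[OF bounded_bilinear.bounded_linear_left[OF bounded_bilinear_matrix_vector_mult]
          continuous_on_matrix_exp])
  then have 1: "continuous_on {0<..} (\<lambda>\<tau>. (B *v (E \<tau> *v fst x)) $ i)" for i
    by (intro continuous_intros)
  have 2: "continuous_on {0<..} (\<lambda>\<tau>. cov_rate Q B \<tau> $ i $ j)" for i j
    using continuous_on_cov_rate[of "{0<..}" B Q] by (intro continuous_intros)
  show ?thesis unfolding W_rate_def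
    by (intro continuous_on_add continuous_on_diff continuous_on_sum continuous_on_mult 1 2
        W_continuous_on_time uniform_smooth_deriv f)
qed

text \<open>The chain rule puts one factor exp(\<tau> B) on every space derivative of W f, so Q
  contracted with the Hessian of W f equals \<open>cov_rate\<close> contracted with the averaged
  Hessian of \<open>f\<close>. For the drift term, B and exp(\<tau> B) commute.\<close>

lemma W_rate_eq:
  assumes f: "bounded_smooth f"
  shows "W_rate f \<tau> x = (\<Sum>i\<in>UNIV. \<Sum>j\<in>UNIV. Q $ i $ j * DX j (DX i (W f \<tau>)) x)
      + (\<Sum>i\<in>UNIV. (B *v fst x) $ i * DX i (W f \<tau>) x) - DT (W f \<tau>) x"
proof -
  let ?E = "E \<tau>"
  let ?G = "\<lambda>i j. W (DX i (DX j f)) \<tau> x"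
  have Ee: "(?E *v axis i 1) $ k = ?E $ k $ i" for i k by (simp add: matrix_vector_mult_basis column_def)
  have D1: "DX i (W g \<tau>) y = (\<Sum>k\<in>UNIV. ?E $ k $ i * W (DX k g) \<tau> y)" if "bounded_smooth g" for g i y
    by (rule trans[OF W_frechet_derivative[OF that]]) (simp add: Ee)
  have D1': "DX i (W f \<tau>) = (\<lambda>y. \<Sum>k\<in>UNIV. ?E $ k $ i * W (DX k f) \<tau> y)" for i
    by (rule ext) (rule D1[OF f])
  have Wd: "(W g \<tau> has_derivative frechet_derivative (W g \<tau>) (at y)) (at y)" if "bounded_smooth g" for g y
  proof -
    have blA: "bounded_linear (\<lambda>x :: (real^'n) \<times> real. (E \<tau> *v fst x, snd x))"
      by (rule bounded_linear_Pair[OF bounded_linear_compose[OF matrix_vector_mul_bounded_linear bounded_linear_fst] bounded_linear_snd])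
    have blR: "bounded_linear (\<lambda>w. (R \<tau> *v w, 0 :: real))"
      by (rule bounded_linear_Pair[OF matrix_vector_mul_bounded_linear bounded_linear_zero])
    have We: "W g \<tau> = (\<lambda>x. \<integral>w. g ((0, - \<tau>) + (E \<tau> *v fst x, snd x) + (R \<tau> *v w, 0)) * gauss (w - 0) \<partial>lborel)"
      unfolding W_def by (rule ext) simp
    have "W g \<tau> differentiable (at y)" unfolding We
      by (rule differentiableI, rule gaussian_shift_integral_has_derivative(2)[OF that poly_gauss_gauss blA blR bounded_linear_zero])
    then show ?thesis unfolding frechet_derivative_works .
  qed
  have D2: "DX j (DX i (W f \<tau>)) x = (\<Sum>k\<in>UNIV. \<Sum>l\<in>UNIV. ?E $ k $ i * (?E $ l $ j * ?G l k))" for i j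
  proof -
    have "((\<lambda>y. \<Sum>k\<in>UNIV. ?E $ k $ i * W (DX k f) \<tau> y) has_derivative
        (\<lambda>v. \<Sum>k\<in>UNIV. ?E $ k $ i * frechet_derivative (W (DX k f) \<tau>) (at x) v)) (at x)"
      by (intro has_derivative_sum has_derivative_mult_right Wd uniform_smooth_deriv f)
    from frechet_derivative_at[OF this, symmetric] have "DX j (DX i (W f \<tau>)) x
        = (\<Sum>k\<in>UNIV. ?E $ k $ i * DX j (W (DX k f) \<tau>) x)" unfolding D1' by (rule fun_cong)
    also have "\<dots> = (\<Sum>k\<in>UNIV. ?E $ k $ i * (\<Sum>l\<in>UNIV. ?E $ l $ j * ?G l k))"
      by (intro sum.cong refl arg_cong2[where f="(*)"] D1 uniform_smooth_deriv f)
    finally show ?thesis by (simp only: sum_distrib_left)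
  qed
  have G: "?G l k = ?G k l" for k l
    by (rule arg_cong[of _ _ "\<lambda>g. W g \<tau> x"], rule ext, rule frechet_derivative_commute[OF f])
  have "(\<Sum>i\<in>UNIV. \<Sum>j\<in>UNIV. Q $ i $ j * DX j (DX i (W f \<tau>)) x)
      = (\<Sum>i\<in>UNIV. \<Sum>j\<in>UNIV. \<Sum>k\<in>UNIV. \<Sum>l\<in>UNIV. (?E $ k $ i * Q $ i $ j * ?E $ l $ j) * ?G k l)"
    unfolding D2 sum_distrib_left by (intro sum.cong refl, subst G) (simp only: mult_ac)
  also have "\<dots> = (\<Sum>k\<in>UNIV. \<Sum>l\<in>UNIV. \<Sum>j\<in>UNIV. \<Sum>i\<in>UNIV. (?E $ k $ i * Q $ i $ j * ?E $ l $ j) * ?G k l)"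
  proof -
    have "(\<Sum>i\<in>UNIV. \<Sum>j\<in>UNIV. \<Sum>k\<in>UNIV. \<Sum>l\<in>UNIV. F i j k l) = (\<Sum>k\<in>UNIV. \<Sum>l\<in>UNIV. \<Sum>j\<in>UNIV. \<Sum>i\<in>UNIV. F i j k l)"
      for F :: "'n \<Rightarrow> 'n \<Rightarrow> 'n \<Rightarrow> 'n \<Rightarrow> real"
    proof -
      have "(\<Sum>i\<in>UNIV. \<Sum>j\<in>UNIV. \<Sum>k\<in>UNIV. \<Sum>l\<in>UNIV. F i j k l) = (\<Sum>i\<in>UNIV. \<Sum>k\<in>UNIV. \<Sum>j\<in>UNIV. \<Sum>l\<in>UNIV. F i j k l)"
        by (intro sum.cong refl sum.swap)
      also have "\<dots> = (\<Sum>k\<in>UNIV. \<Sum>i\<in>UNIV. \<Sum>j\<in>UNIV. \<Sum>l\<in>UNIV. F i j k l)" by (rule sum.swap)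
      also have "\<dots> = (\<Sum>k\<in>UNIV. \<Sum>i\<in>UNIV. \<Sum>l\<in>UNIV. \<Sum>j\<in>UNIV. F i j k l)"
        by (intro sum.cong refl sum.swap)
      also have "\<dots> = (\<Sum>k\<in>UNIV. \<Sum>l\<in>UNIV. \<Sum>i\<in>UNIV. \<Sum>j\<in>UNIV. F i j k l)"
        by (intro sum.cong refl sum.swap)
      also have "\<dots> = (\<Sum>k\<in>UNIV. \<Sum>l\<in>UNIV. \<Sum>j\<in>UNIV. \<Sum>i\<in>UNIV. F i j k l)"
        by (intro sum.cong refl sum.swap)
      finally show ?thesis .
    qed
    then show ?thesis .
  qed
  also have "\<dots> = (\<Sum>k\<in>UNIV. \<Sum>l\<in>UNIV. cov_rate Q B \<tau> $ k $ l * ?G k l)"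
    by (simp add: matrix_matrix_mult_def transpose_def sum_distrib_right)
  finally have second: "(\<Sum>i\<in>UNIV. \<Sum>j\<in>UNIV. Q $ i $ j * DX j (DX i (W f \<tau>)) x)
      = (\<Sum>k\<in>UNIV. \<Sum>l\<in>UNIV. cov_rate Q B \<tau> $ k $ l * ?G k l)" .
  have "B *v (?E *v fst x) = ?E *v (B *v fst x)"
    by (simp add: matrix_vector_mul_assoc matrix_exp_commute)
  moreover have "(\<Sum>k\<in>UNIV. (?E *v b) $ k * c k) = (\<Sum>k\<in>UNIV. \<Sum>i\<in>UNIV. b $ i * (?E $ k $ i * c k))" for b c
    by (simp add: matrix_vector_mult_def sum_distrib_right sum_distrib_left mult_ac)
  ultimately have "(\<Sum>k\<in>UNIV. (B *v (?E *v fst x)) $ k * W (DX k f) \<tau> x)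
      = (\<Sum>k\<in>UNIV. \<Sum>i\<in>UNIV. (B *v fst x) $ i * (?E $ k $ i * W (DX k f) \<tau> x))"
    by (simp only:)
  also have "\<dots> = (\<Sum>i\<in>UNIV. (B *v fst x) $ i * DX i (W f \<tau>) x)"
    unfolding D1[OF f] sum_distrib_left by (rule sum.swap)
  finally have first: "(\<Sum>k\<in>UNIV. (B *v (?E *v fst x)) $ k * W (DX k f) \<tau> x)
      = (\<Sum>i\<in>UNIV. (B *v fst x) $ i * DX i (W f \<tau>) x)" .
  have "DT (W f \<tau>) x = W (DT f) \<tau> x"
    by (rule trans[OF W_frechet_derivative[OF f]]) simp
  then show ?thesis unfolding W_rate_def first second by simp
qed

text \<open>Along the path \<open>\<theta> R\<close>, \<open>0 \<le> \<theta> \<le> 1\<close>, the derivative of the average is quadratic in \<open>R\<close>.\<close>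
lemma gaussian_average_near:
  fixes f :: "(real^'n) \<times> real \<Rightarrow> real"
  assumes f: "bounded_smooth f"
  shows "\<exists>C\<ge>0. \<forall>y. \<forall>\<tau>>0. \<bar>(\<integral>w. f (y + (R \<tau> *v w, 0)) * gauss w \<partial>lborel) - f y\<bar> \<le> C * norm (covariance Q B \<tau>)"
proof -
  have "\<forall>ij. \<exists>M. M \<ge> 0 \<and> (\<forall>x. \<bar>DX (fst ij) (DX (snd ij) f) x\<bar> \<le> M)"
    using uniform_smooth_bounded[OF uniform_smooth_deriv[OF uniform_smooth_deriv[OF f]]] by blast
  from choice[OF this] obtain M' where M': "\<forall>ij. M' ij \<ge> 0 \<and> (\<forall>x. \<bar>DX (fst ij) (DX (snd ij) f) x\<bar> \<le> M' ij)" by blast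
  define M where "M i j = M' (i, j)" for i j
  have M: "M i j \<ge> 0" "\<bar>DX i (DX j f) x\<bar> \<le> M i j" for i j x using M'[rule_format, of "(i, j)"] unfolding M_def fst_conv snd_conv by blast+
  have g: "gauss w \<ge> 0" for w :: "real^'n" unfolding gauss_def by simp
  have ig: "integrable lborel (gauss :: real^'n \<Rightarrow> real)" using poly_gauss_integrable[OF poly_gauss_gauss, of "0::real^'n"] by simp
  have avg: "\<bar>\<integral>w. DX i (DX j f) (y + (A *v w, 0)) * gauss w \<partial>lborel\<bar> \<le> M i j" for A :: "real^'n^'n" and i j y
  proof -
    have "\<bar>\<integral>w. DX i (DX j f) (y + (A *v w, 0)) * gauss w \<partial>lborel\<bar> \<le> (\<integral>w. \<bar>DX i (DX j f) (y + (A *v w, 0)) * gauss w\<bar> \<partial>lborel)"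
      by (rule integral_abs_bound)
    also have "\<dots> \<le> (\<integral>w. M i j * gauss (w :: real^'n) \<partial>lborel)"
    proof (rule Bochner_Integration.integral_mono')
      show "\<bar>DX i (DX j f) (y + (A *v w, 0)) * gauss w\<bar> \<le> M i j * gauss w" for w
        unfolding abs_mult abs_of_nonneg[OF g] by (rule mult_right_mono[OF M(2) g])
      show "0 \<le> M i j * gauss w" for w :: "real^'n" using M(1) g by simp
    qed (use ig in simp)
    also have "\<dots> = M i j" by (simp add: integral_gauss)
    finally show ?thesis .
  qed
  define C where "C = (\<Sum>i\<in>UNIV. \<Sum>j\<in>UNIV. 2 * M i j)"
  have C0: "C \<ge> 0" unfolding C_def by (intro sum_nonneg) (simp add: M)
  have "\<bar>(\<integral>w. f (y + (R \<tau> *v w, 0)) * gauss w \<partial>lborel) - f y\<bar> \<le> C * norm (covariance Q B \<tau>)" if \<tau>: "\<tau> > 0" for y \<tau>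
  proof -
    let ?\<phi> = "\<lambda>\<theta>. \<integral>w. f (y + ((\<theta> *\<^sub>R R \<tau>) *v w, 0)) * gauss w \<partial>lborel"
    let ?\<phi>' = "\<lambda>\<theta>. \<integral>w. frechet_derivative f (at (y + ((\<theta> *\<^sub>R R \<tau>) *v w, 0))) (R \<tau> *v w, 0) * gauss w \<partial>lborel"
    let ?c = "covariance Q B \<tau>"
    have der: "(?\<phi> has_real_derivative ?\<phi>' \<theta>) (at \<theta>)" for \<theta>
    proof -
      let ?L = "\<lambda>q :: ((real^'n) \<times> real) \<times> (real^'n^'n). \<integral>w. frechet_derivative f (at (y + ((\<theta> *\<^sub>R R \<tau>) *v w, 0))) (fst q + (snd q *v w, 0)) * gauss w \<partial>lborel"
      have d: "((\<lambda>\<theta>. (y, \<theta> *\<^sub>R R \<tau>)) has_derivative (\<lambda>h. (0, h *\<^sub>R R \<tau>))) (at \<theta>)"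
        by (auto intro!: derivative_eq_intros)
      have "(?\<phi> has_derivative (\<lambda>h. ?L (0, h *\<^sub>R R \<tau>))) (at \<theta>)"
        using has_derivative_compose[OF d gaussian_matrix_has_derivative[OF f]] by simp
      moreover have "?L (0, h *\<^sub>R R \<tau>) = h * ?L (0, R \<tau>)" for h
        using linear_cmul[OF has_derivative_linear[OF gaussian_matrix_has_derivative[OF f, of "(y, \<theta> *\<^sub>R R \<tau>)"]], of h "(0, R \<tau>)"]
        by simp
      then have "(\<lambda>h. ?L (0, h *\<^sub>R R \<tau>)) = (*) (?\<phi>' \<theta>)" by (simp add: fun_eq_iff mult.commute)
      ultimately show ?thesis by (simp only: has_field_derivative_def)
    qed
    obtain \<theta> where \<theta>: "0 < \<theta>" "\<theta> < 1" "?\<phi> 1 - ?\<phi> 0 = (1 - 0) * ?\<phi>' \<theta>"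
      using MVT2[of 0 1 ?\<phi> ?\<phi>'] der by auto
    \<comment> \<open>After integration by parts the matrix enters only through this product, so the
      bound is of first order in the covariance although R is of the order of its square
      root.\<close>
    have entry: "(\<theta> *\<^sub>R R \<tau>) ** transpose (R \<tau>) = (2 * \<theta>) *\<^sub>R ?c"
      unfolding bounded_bilinear.scaleR_left[OF bounded_bilinear_matrix_mult] R_root[OF \<tau>] by simp
    have "\<bar>?\<phi>' \<theta>\<bar> \<le> (\<Sum>i\<in>UNIV. \<Sum>j\<in>UNIV. 2 * norm ?c * M i j)"
      unfolding gaussian_second_order_identity[OF f] entry
    proof (intro order_trans[OF sum_abs] sum_mono)
      fix i j
      have "\<bar>?c $ i $ j\<bar> \<le> norm ?c"
        using component_le_norm_cart[of "?c $ i" j] Finite_Cartesian_Product.norm_nth_le[of ?c i] by linarith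
      then have "\<bar>((2 * \<theta>) *\<^sub>R ?c) $ i $ j\<bar> \<le> 2 * norm ?c"
        using \<theta> mult_mono[of \<theta> 1 "\<bar>?c $ i $ j\<bar>" "norm ?c"] by (simp add: abs_mult)
      then show "\<bar>((2 * \<theta>) *\<^sub>R ?c) $ i $ j * (\<integral>w. DX i (DX j f) (y + ((\<theta> *\<^sub>R R \<tau>) *v w, 0)) * gauss w \<partial>lborel)\<bar> \<le> 2 * norm ?c * M i j"
        unfolding abs_mult[of "((2 * \<theta>) *\<^sub>R ?c) $ i $ j"] by (intro mult_mono avg) auto
    qed
    also have "\<dots> = C * norm ?c" unfolding C_def by (simp add: sum_distrib_right sum_distrib_left mult_ac)
    finally have "\<bar>?\<phi> 1 - ?\<phi> 0\<bar> \<le> C * norm ?c" using \<theta>(3) by simp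
    moreover have "?\<phi> 0 = f y" by (simp add: integral_gauss zero_prod_def[symmetric])
    ultimately show ?thesis by simp
  qed
  with C0 show ?thesis by blast
qed

text \<open>The coefficient BX is unbounded; the seminorm with one power of |x| compensates
  it.\<close>

lemma schwartz_drift_bound:
  fixes u :: "(real^'n) \<times> real \<Rightarrow> real"
  assumes u: "u \<in> schwartz"
  shows "\<exists>C\<ge>0. \<forall>x. \<bar>frechet_derivative u (at x) (B *v fst x, - 1)\<bar> \<le> C"
proof -
  have bs: "bounded_smooth u" by (rule schwartz_bounded_smooth[OF u])
  obtain k where k: "k \<ge> 0" "\<And>z. norm (B *v z) \<le> norm z * k"
    using bounded_linear.nonneg_bounded[OF matrix_vector_mul_bounded_linear[of B]] by blast
  have "\<exists>M. \<forall>x. norm x * \<bar>DX i u x\<bar> \<le> M" for i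
  proof -
    have "[(axis i 1, 0)] \<in> lists (Basis :: ((real^'n) \<times> real) set)" by (simp add: Basis_prod_def)
    then have "bounded (range (\<lambda>x. norm x ^ 1 * iter_deriv [(axis i 1, 0)] u x))"
      using u unfolding schwartz_def by blast
    then show ?thesis by (auto simp: bounded_iff abs_mult)
  qed
  then obtain M where M: "\<And>i x. norm x * \<bar>DX i u x\<bar> \<le> M i" by metis
  obtain M0 where M0: "M0 \<ge> 0" "\<And>x. \<bar>DT u x\<bar> \<le> M0" using uniform_smooth_bounded[OF uniform_smooth_deriv[OF bs]] by blast
  define C where "C = (\<Sum>i\<in>UNIV. k * M i) + M0"
  have "\<bar>frechet_derivative u (at x) (B *v fst x, - 1)\<bar> \<le> C" for x
  proof -
    have "\<bar>(B *v fst x) $ i * DX i u x\<bar> \<le> k * M i" for i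
    proof -
      have "\<bar>(B *v fst x) $ i\<bar> \<le> norm x * k"
        using component_le_norm_cart[of "B *v fst x" i] k(2)[of "fst x"]
          mult_right_mono[OF norm_fst_le[of "fst x" "snd x"] k(1)] by simp
      then have "\<bar>(B *v fst x) $ i * DX i u x\<bar> \<le> (norm x * k) * \<bar>DX i u x\<bar>"
        unfolding abs_mult by (rule mult_right_mono) simp
      also have "\<dots> = k * (norm x * \<bar>DX i u x\<bar>)" by simp
      also have "\<dots> \<le> k * M i" by (rule mult_left_mono[OF M k(1)])
      finally show ?thesis .
    qed
    then have "\<bar>\<Sum>i\<in>UNIV. (B *v fst x) $ i * DX i u x\<bar> \<le> (\<Sum>i\<in>UNIV. k * M i)"
      by (intro order_trans[OF sum_abs] sum_mono)
    moreover have "frechet_derivative u (at x) (B *v fst x, - 1) = (\<Sum>i\<in>UNIV. (B *v fst x) $ i * DX i u x) - DT u x"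
      by (rule trans[OF frechet_derivative_prod[OF uniform_smooth_differentiable[OF bs]]]) simp_all
    ultimately show ?thesis using M0(2)[of x] unfolding C_def by linarith
  qed
  moreover from this[of 0] have "C \<ge> 0" by linarith
  ultimately show ?thesis by blast
qed

text \<open>The difference splits into the Gaussian spread about the drifted point, of the order of
  the covariance and hence of \<tau>, and the change of \<open>u\<close> along the drift curve. For
  \<tau> > 1 the suprema suffice.\<close>

lemma W_near:
  assumes u: "u \<in> schwartz"
  shows "\<exists>C\<ge>0. \<forall>\<tau>>0. \<forall>x. \<bar>W u \<tau> x - u x\<bar> \<le> C * min 1 \<tau>"
proof -
  have bs: "bounded_smooth u" by (rule schwartz_bounded_smooth[OF u])
  obtain C1 where C1: "C1 \<ge> 0" "\<And>y \<tau>. \<tau> > 0 \<Longrightarrow> \<bar>(\<integral>w. u (y + (R \<tau> *v w, 0)) * gauss w \<partial>lborel) - u y\<bar> \<le> C1 * norm (covariance Q B \<tau>)"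
    using gaussian_average_near[OF bs] by blast
  obtain K where K: "K \<ge> 0" "\<And>t. t \<in> {0..1} \<Longrightarrow> norm (covariance Q B t) \<le> K * t" using norm_covariance_le[of Q B] by blast
  obtain C2 where C2: "C2 \<ge> 0" "\<And>x. \<bar>frechet_derivative u (at x) (B *v fst x, - 1)\<bar> \<le> C2"
    using schwartz_drift_bound[OF u] by blast
  obtain M where M: "M \<ge> 0" "\<And>\<tau> x. \<tau> > 0 \<Longrightarrow> \<bar>W u \<tau> x\<bar> \<le> M"
    using uniform_smooth_bounded[OF W_uniform_smooth[OF bs]] by auto
  obtain M0 where M0: "M0 \<ge> 0" "\<And>x. \<bar>u x\<bar> \<le> M0" using uniform_smooth_bounded[OF bs] by auto
  define C where "C = C1 * K + C2 + M + M0"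
  have "\<bar>W u \<tau> x - u x\<bar> \<le> C * min 1 \<tau>" if \<tau>: "\<tau> > 0" for \<tau> x
  proof (cases "\<tau> \<le> 1")
    case False
    then have "\<bar>W u \<tau> x - u x\<bar> \<le> M + M0" using M(2)[OF \<tau>, of x] M0(2)[of x] by linarith
    also have "\<dots> \<le> C" using C1(1) K(1) C2(1) by (simp add: C_def)
    finally show ?thesis using False by simp
  next
    case True
    let ?\<gamma> = "\<lambda>\<sigma>. (E \<sigma> *v fst x, snd x - \<sigma>)"
    have "\<bar>W u \<tau> x - u (?\<gamma> \<tau>)\<bar> \<le> C1 * norm (covariance Q B \<tau>)" unfolding W_def by (rule C1(2)[OF \<tau>])
    also have "\<dots> \<le> C1 * (K * \<tau>)" using K(2)[of \<tau>] C1(1) \<tau> True by (intro mult_left_mono) auto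
    finally have 1: "\<bar>W u \<tau> x - u (?\<gamma> \<tau>)\<bar> \<le> C1 * K * \<tau>" by simp
    have der: "((\<lambda>\<sigma>. u (?\<gamma> \<sigma>)) has_real_derivative frechet_derivative u (at (?\<gamma> \<sigma>)) (B *v (E \<sigma> *v fst x), - 1)) (at \<sigma>)" for \<sigma>
    proof -
      have dE: "((\<lambda>\<tau>. E \<tau> *v fst x) has_vector_derivative B *v (E \<sigma> *v fst x)) (at \<sigma>)"
        using bounded_linear.has_vector_derivative[OF bounded_bilinear.bounded_linear_left[OF bounded_bilinear_matrix_vector_mult]
            matrix_exp_has_vector_derivative[of B \<sigma>], of "fst x"]
        by (simp add: matrix_vector_mul_assoc)
      have "((\<lambda>\<sigma>. snd x - \<sigma>) has_vector_derivative - 1) (at \<sigma>)" by (auto intro!: derivative_eq_intros)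
      from has_vector_derivative_Pair[OF dE this]
      have "(?\<gamma> has_vector_derivative (B *v (E \<sigma> *v fst x), - 1)) (at \<sigma>)" .
      from has_derivative_compose[OF this[unfolded has_vector_derivative_def] bounded_smooth_has_derivative[OF bs]]
      have "((\<lambda>\<sigma>. u (?\<gamma> \<sigma>)) has_derivative (\<lambda>h. frechet_derivative u (at (?\<gamma> \<sigma>)) (h *\<^sub>R (B *v (E \<sigma> *v fst x), - 1)))) (at \<sigma>)" .
      moreover have "frechet_derivative u (at (?\<gamma> \<sigma>)) (h *\<^sub>R (B *v (E \<sigma> *v fst x), - 1))
          = frechet_derivative u (at (?\<gamma> \<sigma>)) (B *v (E \<sigma> *v fst x), - 1) * h" for h
        using linear_cmul[OF linear_frechet_derivative[OF uniform_smooth_differentiable[OF bs UNIV_I]], of "?\<gamma> \<sigma>" h]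
        by (simp only: real_scaleR_def mult.commute)
      ultimately show ?thesis by (simp only: has_field_derivative_def)
    qed
    obtain \<sigma> where \<sigma>: "u (?\<gamma> \<tau>) - u (?\<gamma> 0) = (\<tau> - 0) * frechet_derivative u (at (?\<gamma> \<sigma>)) (B *v (E \<sigma> *v fst x), - 1)"
      using MVT2[OF \<tau> der] by blast
    moreover have "?\<gamma> 0 = x" by (simp only: matrix_exp_0 matrix_vector_mul_lid diff_zero prod.collapse)
    \<comment> \<open>The velocity B exp(\<sigma> B) X is the drift evaluated at the moving point
      itself, so the uniform drift bound applies at \<open>?\<gamma> \<sigma>\<close> without an
      estimate of exp(\<sigma> B).\<close>
    ultimately have "\<bar>u (?\<gamma> \<tau>) - u x\<bar> = \<tau> * \<bar>frechet_derivative u (at (?\<gamma> \<sigma>)) (B *v fst (?\<gamma> \<sigma>), - 1)\<bar>"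
      using \<tau> by (simp add: abs_mult)
    also have "\<dots> \<le> \<tau> * C2" using \<tau> by (intro mult_left_mono C2) simp
    finally have "\<bar>W u \<tau> x - u x\<bar> \<le> C1 * K * \<tau> + \<tau> * C2" using 1 by linarith
    also have "\<dots> \<le> C * \<tau>" using M(1) M0(1) \<tau> by (simp add: C_def algebra_simps)
    finally show ?thesis using True by simp
  qed
  moreover have "C \<ge> 0" using C1(1) K(1) C2(1) M(1) M0(1) by (simp add: C_def)
  ultimately show ?thesis by blast
qed

end

section \<open>The extension kernel\<close>

text \<open>The points of this measure space are the positive times, so \<tau> > 0 follows from
  membership in the space and lemmas for general measures apply unchanged.\<close>

abbreviation pos_lborel :: "real measure" where "pos_lborel \<equiv> restrict_space lborel {0<..}"

lemma space_pos_lborel: "space pos_lborel = {0<..}" by (simp add: space_restrict_space)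

lemma set_integral_pos_lborel: "(LINT \<tau>:{0<..}|lborel. f \<tau>) = (\<integral>\<tau>. f \<tau> \<partial>pos_lborel)" for f :: "real \<Rightarrow> real"
  unfolding set_lebesgue_integral_def by (subst integral_restrict_space) auto

lemma set_integrable_pos_lborel: "set_integrable lborel {0<..} f \<longleftrightarrow> integrable pos_lborel f" for f :: "real \<Rightarrow> real"
  unfolding set_integrable_def by (subst integrable_restrict_space) auto

lemma borel_measurable_pos_lborel: "f \<in> borel_measurable borel \<Longrightarrow> f \<in> borel_measurable pos_lborel"
  by (rule measurable_restrict_space1) simp

lemma continuous_on_measurable_pos_lborel:
  "continuous_on {0<..} f \<Longrightarrow> f \<in> borel_measurable pos_lborel" for f :: "real \<Rightarrow> real"
  using borel_measurable_continuous_on_restrict[of "{0<..}" f]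
  by (simp add: measurable_restrict_space_iff borel_measurable_restrict_space_iff)

text \<open>Bridge from the gauge integral, in which the Gamma integral and the substitution rule
  are stated, to the Lebesgue integral; Borel measurability permits leaving the completed
  measure.\<close>

lemma absolutely_integrable_on_pos_lborel:
  fixes f :: "real \<Rightarrow> real"
  assumes f: "f absolutely_integrable_on {0<..}" and m: "f \<in> borel_measurable borel"
  shows "integrable pos_lborel f" and "(\<integral>\<tau>. f \<tau> \<partial>pos_lborel) = integral {0<..} f"
proof -
  have "integrable lebesgue (\<lambda>x. indicator {0<..} x *\<^sub>R f x)" using f unfolding set_integrable_def .
  then have "integrable lborel (\<lambda>x. indicator {0<..} x *\<^sub>R f x)"
    by (subst (asm) integrable_completion) (use m in auto)
  then show i: "integrable pos_lborel f"
    unfolding set_integrable_pos_lborel[symmetric] set_integrable_def .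
  show "(\<integral>\<tau>. f \<tau> \<partial>pos_lborel) = integral {0<..} f"
    unfolding set_integral_pos_lborel[symmetric]
    by (rule set_borel_integral_eq_integral(2)) (use i in \<open>simp add: set_integrable_pos_lborel\<close>)
qed

text \<open>The substitution \<sigma> = c / \<tau> leads to Euler's integral for Gamma(\<beta> -
  1).\<close>

lemma inverse_gamma_integral:
  assumes \<beta>: "\<beta> > 1" and c: "c > 0"
  shows "has_bochner_integral pos_lborel (\<lambda>\<tau>. \<tau> powr (- \<beta>) * exp (- (c / \<tau>))) (c powr (1 - \<beta>) * Gamma (\<beta> - 1))"
proof -
  let ?S = "{0<..} :: real set"
  let ?f = "\<lambda>\<sigma>::real. \<sigma> powr (\<beta> - 2) * exp (- \<sigma>)"
  have fi: "(?f has_integral Gamma (\<beta> - 1)) ?S"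
  proof -
    have "((\<lambda>t. t powr ((\<beta> - 1) - 1) / exp t) has_integral Gamma (\<beta> - 1)) {0..}"
      by (rule Gamma_integral_real) (use \<beta> in simp)
    then have "(?f has_integral Gamma (\<beta> - 1)) {0..}" by (simp add: exp_minus field_simps)
    \<comment> \<open>The endpoint 0 is removed because c / \<tau> maps the open half line onto
      itself.\<close>
    moreover have "negligible {x \<in> {0..} - ?S. ?f x \<noteq> 0}" "negligible {x \<in> ?S - {0..}. ?f x \<noteq> 0}"
      by (rule negligible_subset[of "{0}"]; auto)+
    ultimately show ?thesis using has_integral_spike_set_eq[of "{0..}" ?S ?f] by blast
  qed
  have fa: "?f absolutely_integrable_on ?S"
    by (rule nonnegative_absolutely_integrable_1) (use fi in auto)
  have im: "(\<lambda>\<tau>. c / \<tau>) ` ?S = ?S"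
  proof
    show "?S \<subseteq> (\<lambda>\<tau>. c / \<tau>) ` ?S"
    proof
      fix x :: real assume "x \<in> ?S"
      then show "x \<in> (\<lambda>\<tau>. c / \<tau>) ` ?S" using c by (intro image_eqI[of _ _ "c / x"]) auto
    qed
  qed (use c in auto)
  have "(\<lambda>\<tau>. \<bar>- c / \<tau>\<^sup>2\<bar> * ?f (c / \<tau>)) absolutely_integrable_on ?S \<and>
      integral ?S (\<lambda>\<tau>. \<bar>- c / \<tau>\<^sup>2\<bar> * ?f (c / \<tau>)) = Gamma (\<beta> - 1)"
  proof (rule iffD2[OF has_absolute_integral_change_of_variables_1'[where S="?S" and g="\<lambda>\<tau>. c / \<tau>" and g'="\<lambda>\<tau>. - c / \<tau>\<^sup>2" and f="?f"]])
    show "((\<lambda>\<tau>. c / \<tau>) has_field_derivative - c / \<tau>\<^sup>2) (at \<tau> within ?S)" if "\<tau> \<in> ?S" for \<tau>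
      using that by (auto intro!: derivative_eq_intros simp: power2_eq_square)
    show "inj_on (\<lambda>\<tau>. c / \<tau>) ?S" using c by (auto simp: inj_on_def)
    show "?f absolutely_integrable_on (\<lambda>\<tau>. c / \<tau>) ` ?S \<and> integral ((\<lambda>\<tau>. c / \<tau>) ` ?S) ?f = Gamma (\<beta> - 1)"
      unfolding im using fa fi by blast
  qed simp
  note H = this
  have eq: "\<bar>- c / \<tau>\<^sup>2\<bar> * ?f (c / \<tau>) = c powr (\<beta> - 1) * (\<tau> powr (- \<beta>) * exp (- (c / \<tau>)))" if "\<tau> \<in> ?S" for \<tau>
  proof -
    have \<tau>: "\<tau> > 0" using that by simp
    have "c powr (\<beta> - 1) = c * c powr (\<beta> - 2)" using c powr_add[of c 1 "\<beta> - 2"] by simp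
    moreover have "\<tau> powr (- \<beta>) = \<tau> powr (2 - \<beta>) / \<tau>\<^sup>2"
      using \<tau> powr_add[of \<tau> "2 - \<beta>" "- 2"] powr_realpow[of \<tau> 2] by (simp add: powr_minus field_simps)
    moreover have "(c / \<tau>) powr (\<beta> - 2) = c powr (\<beta> - 2) * \<tau> powr (2 - \<beta>)"
      using c \<tau> powr_minus[of \<tau> "\<beta> - 2"] by (simp add: powr_divide field_simps)
    ultimately show ?thesis using c by simp
  qed
  have 1: "(\<lambda>\<tau>. c powr (\<beta> - 1) * (\<tau> powr (- \<beta>) * exp (- (c / \<tau>)))) absolutely_integrable_on ?S"
    by (rule iffD1[OF set_integrable_cong[OF refl refl eq] conjunct1[OF H]])
  have 2: "integral ?S (\<lambda>\<tau>. c powr (\<beta> - 1) * (\<tau> powr (- \<beta>) * exp (- (c / \<tau>)))) = Gamma (\<beta> - 1)"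
    by (rule trans[OF Henstock_Kurzweil_Integration.integral_cong[OF eq, symmetric] conjunct2[OF H]])
  have m: "(\<lambda>\<tau>. c powr (\<beta> - 1) * (\<tau> powr (- \<beta>) * exp (- (c / \<tau>)))) \<in> borel_measurable borel" by measurable
  note 3 = absolutely_integrable_on_pos_lborel[OF 1 m, unfolded 2]
  have cc: "c powr (1 - \<beta>) * c powr (\<beta> - 1) = 1" using c by (simp add: powr_add[symmetric])
  have "has_bochner_integral pos_lborel (\<lambda>\<tau>. c powr (1 - \<beta>) * (c powr (\<beta> - 1) * (\<tau> powr (- \<beta>) * exp (- (c / \<tau>))))) (c powr (1 - \<beta>) * Gamma (\<beta> - 1))"
    using 3 by (intro has_bochner_integral_mult_right) (simp add: has_bochner_integral_iff)
  then show ?thesis unfolding mult.assoc[symmetric] cc by simp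
qed

text \<open>The weight of the Poisson extension is the case \<open>\<alpha> = 2 s\<close>, \<open>\<beta> = 1 + s\<close> up to a constant; the
  derivatives in \<open>z\<close> and \<open>\<tau>\<close> stay in the family.\<close>
definition ext_kernel :: "real \<Rightarrow> real \<Rightarrow> real \<Rightarrow> real \<Rightarrow> real" where
  "ext_kernel \<alpha> \<beta> z \<tau> = z powr \<alpha> * (\<tau> powr (- \<beta>) * exp (- (z\<^sup>2 / 4 / \<tau>)))"

lemma ext_kernel_integral:
  assumes "\<beta> > 1" "z > 0"
  shows "has_bochner_integral pos_lborel (ext_kernel \<alpha> \<beta> z) (z powr \<alpha> * ((z\<^sup>2 / 4) powr (1 - \<beta>) * Gamma (\<beta> - 1)))"
  unfolding ext_kernel_def[abs_def] by (intro has_bochner_integral_mult_right inverse_gamma_integral) (use assms in auto)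

lemma ext_kernel_has_derivative_z:
  assumes "z > 0" "\<tau> > 0"
  shows "((\<lambda>z. ext_kernel \<alpha> \<beta> z \<tau>) has_real_derivative
     \<alpha> * ext_kernel (\<alpha> - 1) \<beta> z \<tau> - 1/2 * ext_kernel (\<alpha> + 1) (\<beta> + 1) z \<tau>) (at z)"
proof -
  have "((\<lambda>z. z powr \<alpha> * (\<tau> powr (- \<beta>) * exp (- (z\<^sup>2 / 4 / \<tau>)))) has_real_derivative
     (\<alpha> * z powr (\<alpha> - 1)) * (\<tau> powr (- \<beta>) * exp (- (z\<^sup>2 / 4 / \<tau>))) +
     (\<tau> powr (- \<beta>) * (exp (- (z\<^sup>2 / 4 / \<tau>)) * (- (2 * z / 4 / \<tau>)))) * z powr \<alpha>) (at z)"
    using assms by (auto intro!: derivative_eq_intros)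
  moreover have "z powr (\<alpha> + 1) = z powr \<alpha> * z" "\<tau> powr (- (\<beta> + 1)) = \<tau> powr (- \<beta>) / \<tau>"
    using assms powr_add[of z \<alpha> 1] powr_diff[of \<tau> "- \<beta>" 1] by simp_all
  ultimately show ?thesis unfolding ext_kernel_def[abs_def] by (simp add: algebra_simps)
qed

lemma ext_kernel_has_derivative_time:
  assumes "z > 0" "\<tau> > 0"
  shows "((\<lambda>\<tau>. ext_kernel \<alpha> \<beta> z \<tau>) has_real_derivative
     - \<beta> * ext_kernel \<alpha> (\<beta> + 1) z \<tau> + 1/4 * ext_kernel (\<alpha> + 2) (\<beta> + 2) z \<tau>) (at \<tau>)"
proof -
  have "((\<lambda>\<tau>. z powr \<alpha> * (\<tau> powr (- \<beta>) * exp (- (z\<^sup>2 / 4 / \<tau>)))) has_real_derivative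
     z powr \<alpha> * ((- \<beta> * \<tau> powr (- \<beta> - 1)) * exp (- (z\<^sup>2 / 4 / \<tau>)) +
      (exp (- (z\<^sup>2 / 4 / \<tau>)) * (z\<^sup>2 / 4 / \<tau>\<^sup>2)) * \<tau> powr (- \<beta>))) (at \<tau>)"
    using assms by (auto intro!: derivative_eq_intros simp: power2_eq_square)
  moreover have "z powr (\<alpha> + 2) = z powr \<alpha> * z\<^sup>2" "\<tau> powr (- (\<beta> + 2)) = \<tau> powr (- \<beta>) / \<tau>\<^sup>2"
    using assms powr_add[of z \<alpha> 2] powr_diff[of \<tau> "- \<beta>" 2] powr_realpow[of z 2] powr_realpow[of \<tau> 2] by simp_all
  moreover have "\<tau> powr (- 1 - \<beta>) = \<tau> powr (- \<beta> - 1)" by (rule arg_cong[where f="\<lambda>r. \<tau> powr r"]) simp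
  ultimately show ?thesis unfolding ext_kernel_def[abs_def] by (simp add: algebra_simps)
qed

lemma ext_kernel_measurable: "ext_kernel \<alpha> \<beta> z \<in> borel_measurable pos_lborel"
  by (rule borel_measurable_pos_lborel) (unfold ext_kernel_def[abs_def], measurable)

text \<open>On the ball, z lies between z0 / 2 and 3 z0 / 2. Adding the powers at both endpoints
  covers either sign of \<alpha>, and z \<ge> z0 / 2 gives the exponent z0^2 / 16.\<close>

lemma ext_kernel_local_bound:
  assumes z0: "z0 > 0"
  shows "\<exists>C\<ge>0. \<forall>z\<in>ball z0 (z0 / 2). \<forall>\<tau>>0. \<bar>ext_kernel \<alpha> \<beta> z \<tau>\<bar> \<le> C * (\<tau> powr (- \<beta>) * exp (- (z0\<^sup>2 / 16 / \<tau>)))"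
proof (intro exI[of _ "(z0 / 2) powr \<alpha> + (3 * z0 / 2) powr \<alpha>"] conjI ballI allI impI)
  fix z \<tau> :: real assume z: "z \<in> ball z0 (z0 / 2)" and \<tau>: "\<tau> > 0"
  have z': "z0 / 2 \<le> z" "z \<le> 3 * z0 / 2" "z > 0" using z z0 by (auto simp: dist_real_def abs_real_def split: if_splits)
  have 1: "z powr \<alpha> \<le> (z0 / 2) powr \<alpha> + (3 * z0 / 2) powr \<alpha>"
  proof (cases "\<alpha> \<ge> 0")
    case True
    then have "z powr \<alpha> \<le> (3 * z0 / 2) powr \<alpha>" using z' by (intro powr_mono2) auto
    then show ?thesis by (simp add: add_increasing)
  next
    case False
    then have "z powr \<alpha> \<le> (z0 / 2) powr \<alpha>" using z' z0 by (intro powr_mono2') auto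
    then show ?thesis by (simp add: add_increasing2)
  qed
  have "(z0 / 2)\<^sup>2 \<le> z\<^sup>2" using z' z0 by (intro power_mono) auto
  then have "z0\<^sup>2 / 16 / \<tau> \<le> z\<^sup>2 / 4 / \<tau>" using \<tau> by (intro divide_right_mono) (auto simp: power_divide)
  then have 2: "exp (- (z\<^sup>2 / 4 / \<tau>)) \<le> exp (- (z0\<^sup>2 / 16 / \<tau>))" by simp
  show "\<bar>ext_kernel \<alpha> \<beta> z \<tau>\<bar> \<le> ((z0 / 2) powr \<alpha> + (3 * z0 / 2) powr \<alpha>) * (\<tau> powr (- \<beta>) * exp (- (z0\<^sup>2 / 16 / \<tau>)))"
    unfolding ext_kernel_def abs_mult by (intro mult_mono) (use 1 2 in auto)
qed simp

lemma ext_kernel_local_dominator: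
  assumes "\<beta> > 1" "z0 > 0"
  shows "\<exists>g. integrable pos_lborel g \<and> (\<forall>z\<in>ball z0 (z0 / 2). \<forall>\<tau>>0. \<bar>ext_kernel \<alpha> \<beta> z \<tau>\<bar> \<le> g \<tau>)"
proof -
  obtain C where "\<forall>z\<in>ball z0 (z0 / 2). \<forall>\<tau>>0. \<bar>ext_kernel \<alpha> \<beta> z \<tau>\<bar> \<le> C * (\<tau> powr (- \<beta>) * exp (- (z0\<^sup>2 / 16 / \<tau>)))"
    using ext_kernel_local_bound[OF assms(2)] by blast
  moreover have "integrable pos_lborel (\<lambda>\<tau>. C * (\<tau> powr (- \<beta>) * exp (- (z0\<^sup>2 / 16 / \<tau>))))"
    by (intro integrable_mult_right integrable.intros[OF inverse_gamma_integral] ) (use assms in auto)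
  ultimately show ?thesis by (intro exI[of _ "\<lambda>\<tau>. C * (\<tau> powr (- \<beta>) * exp (- (z0\<^sup>2 / 16 / \<tau>)))"]) auto
qed

text \<open>\<open>uniform_smooth\<close> says nothing about regularity in the index, so
  measurability in \<tau> is added for the sake of the time integral.\<close>

definition admissible :: "(real \<Rightarrow> 'a::euclidean_space \<Rightarrow> real) \<Rightarrow> bool" where
  "admissible G \<longleftrightarrow> uniform_smooth {0<..} G \<and> (\<forall>x. (\<lambda>\<tau>. G \<tau> x) \<in> borel_measurable pos_lborel)"

text \<open>Measurability in \<tau> survives because the derivative is a pointwise limit of
  difference quotients with increments 1/(n + 1).\<close>

lemma admissible_deriv:
  assumes G: "admissible G"
  shows "admissible (\<lambda>\<tau> x. frechet_derivative (G \<tau>) (at x) v)"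
  unfolding admissible_def
proof (intro conjI allI)
  have us: "uniform_smooth {0<..} G" and m: "\<And>x. (\<lambda>\<tau>. G \<tau> x) \<in> borel_measurable pos_lborel"
    using G unfolding admissible_def by auto
  show "uniform_smooth {0<..} (\<lambda>\<tau> x. frechet_derivative (G \<tau>) (at x) v)" by (rule uniform_smooth_deriv[OF us])
  fix x
  show "(\<lambda>\<tau>. frechet_derivative (G \<tau>) (at x) v) \<in> borel_measurable pos_lborel"
  proof (rule borel_measurable_LIMSEQ_real)
    let ?q = "\<lambda>n \<tau>. (G \<tau> (x + inverse (real (Suc n)) *\<^sub>R v) - G \<tau> x) / inverse (real (Suc n))"
    show "?q n \<in> borel_measurable pos_lborel" for n using m by measurable
    fix \<tau> assume "\<tau> \<in> space pos_lborel"
    then have \<tau>: "\<tau> \<in> {0<..}" by (simp add: space_pos_lborel)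
    have d: "(G \<tau> has_derivative frechet_derivative (G \<tau>) (at x)) (at x)"
      using uniform_smooth_differentiable[OF us \<tau>] frechet_derivative_works by blast
    have "((\<lambda>h. G \<tau> (x + h *\<^sub>R v)) has_derivative (\<lambda>h. frechet_derivative (G \<tau>) (at x) (h *\<^sub>R v))) (at 0)"
    proof (rule has_derivative_compose[of "\<lambda>h. x + h *\<^sub>R v"])
      show "((\<lambda>h. x + h *\<^sub>R v) has_derivative (\<lambda>h. h *\<^sub>R v)) (at 0)" by (auto intro!: derivative_eq_intros)
    qed (use d in simp)
    moreover have "frechet_derivative (G \<tau>) (at x) (h *\<^sub>R v) = frechet_derivative (G \<tau>) (at x) v * h" for h
      using linear_cmul[OF has_derivative_linear[OF d], of h v] by simp
    ultimately have "((\<lambda>h. G \<tau> (x + h *\<^sub>R v)) has_real_derivative frechet_derivative (G \<tau>) (at x) v) (at 0)"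
      by (simp add: has_field_derivative_def)
    then have "((\<lambda>h. (G \<tau> (x + h *\<^sub>R v) - G \<tau> x) / h) \<longlongrightarrow> frechet_derivative (G \<tau>) (at x) v) (at 0)"
      by (simp add: has_field_derivative_iff)
    moreover have "filterlim (\<lambda>n. inverse (real (Suc n))) (at 0) sequentially"
      using LIMSEQ_inverse_real_of_nat by (simp add: filterlim_at)
    ultimately show "(\<lambda>n. ?q n \<tau>) \<longlonglongrightarrow> frechet_derivative (G \<tau>) (at x) v"
      by (rule filterlim_compose)
  qed
qed

text \<open>The arguments X, t and z form a single point \<open>y\<close>, so that joint smoothness
  is one induction; the exponents are parameters because differentiation in z shifts them.\<close>

definition ext_integral ::
    "real \<Rightarrow> real \<Rightarrow> (real \<Rightarrow> ('a::euclidean_space \<times> real) \<Rightarrow> real) \<Rightarrow> 'a \<times> real \<times> real \<Rightarrow> real" where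
  "ext_integral \<alpha> \<beta> G y = (\<integral>\<tau>. ext_kernel \<alpha> \<beta> (snd (snd y)) \<tau> * G \<tau> (fst y, fst (snd y)) \<partial>pos_lborel)"

lemma ext_integral_integrable:
  assumes \<beta>: "\<beta> > 1" and z: "z > 0" and m: "H \<in> borel_measurable pos_lborel" and M: "\<And>\<tau>. \<tau> > 0 \<Longrightarrow> \<bar>H \<tau>\<bar> \<le> M"
  shows "integrable pos_lborel (\<lambda>\<tau>. ext_kernel \<alpha> \<beta> z \<tau> * H \<tau>)"
proof (rule Bochner_Integration.integrable_bound)
  show "integrable pos_lborel (\<lambda>\<tau>. M * ext_kernel \<alpha> \<beta> z \<tau>)"
    by (intro integrable_mult_right integrable.intros[OF ext_kernel_integral] \<beta> z)
  show "(\<lambda>\<tau>. ext_kernel \<alpha> \<beta> z \<tau> * H \<tau>) \<in> borel_measurable pos_lborel"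
    using ext_kernel_measurable m by measurable
  show "AE \<tau> in pos_lborel. norm (ext_kernel \<alpha> \<beta> z \<tau> * H \<tau>) \<le> norm (M * ext_kernel \<alpha> \<beta> z \<tau>)"
  proof (rule AE_I2)
    fix \<tau> assume "\<tau> \<in> space pos_lborel"
    then have "\<tau> > 0" by (simp add: space_pos_lborel)
    then have "\<bar>H \<tau>\<bar> \<le> \<bar>M\<bar>" using M[of \<tau>] by linarith
    then show "norm (ext_kernel \<alpha> \<beta> z \<tau> * H \<tau>) \<le> norm (M * ext_kernel \<alpha> \<beta> z \<tau>)"
      by (simp add: abs_mult mult.commute[of "\<bar>H \<tau>\<bar>"] mult.commute[of "\<bar>M\<bar>"] mult_left_mono)
  qed
qed

lemma admissible_integrable:
  assumes "\<beta> > 1" "z > 0" "admissible G"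
  shows "integrable pos_lborel (\<lambda>\<tau>. ext_kernel \<alpha> \<beta> z \<tau> * G \<tau> x)"
proof -
  obtain M where "\<forall>\<tau>\<in>{0<..}. \<forall>x. \<bar>G \<tau> x\<bar> \<le> M"
    using uniform_smooth_bounded[of "{0<..}" G] assms(3) unfolding admissible_def by blast
  then show ?thesis
    using assms by (intro ext_integral_integrable[where M=M]) (auto simp: admissible_def)
qed

text \<open>Derivatives stay in the family: the z-direction shifts the exponents of the kernel, an
  (X,t)-direction replaces \<open>G\<close> by its directional derivative. The kernel majorants are
  local in z, the bounds on \<open>G\<close> uniform in \<tau>.\<close>

lemma ext_integral_has_derivative:
  fixes G :: "real \<Rightarrow> ('a::euclidean_space \<times> real) \<Rightarrow> real"
  assumes \<beta>: "\<beta> > 1" and G: "admissible G" and z: "snd (snd y) > 0"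
  shows "(ext_integral \<alpha> \<beta> G has_derivative
    (\<lambda>v. snd (snd v) * (\<alpha> * ext_integral (\<alpha> - 1) \<beta> G y - 1/2 * ext_integral (\<alpha> + 1) (\<beta> + 1) G y)
       + ext_integral \<alpha> \<beta> (\<lambda>\<tau> x. frechet_derivative (G \<tau>) (at x) (fst v, fst (snd v))) y)) (at y)"
proof -
  have us: "uniform_smooth {0<..} G" and m: "\<And>x. (\<lambda>\<tau>. G \<tau> x) \<in> borel_measurable pos_lborel"
    using G unfolding admissible_def by auto
  obtain M where M: "M \<ge> 0" "\<And>\<tau> x. \<tau> > 0 \<Longrightarrow> \<bar>G \<tau> x\<bar> \<le> M" using uniform_smooth_bounded[OF us] by auto
  obtain M' where M': "M' \<ge> 0" "\<And>\<tau> x v. \<tau> > 0 \<Longrightarrow> \<bar>frechet_derivative (G \<tau>) (at x) v\<bar> \<le> M' * norm v"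
    using uniform_smooth_deriv_bound[OF us] by auto
  define z0 where "z0 = snd (snd y)"
  have z0: "z0 > 0" using z by (simp add: z0_def)
  obtain g0 where g0: "integrable pos_lborel g0" "\<And>z \<tau>. z \<in> ball z0 (z0/2) \<Longrightarrow> \<tau> > 0 \<Longrightarrow> \<bar>ext_kernel \<alpha> \<beta> z \<tau>\<bar> \<le> g0 \<tau>"
    using ext_kernel_local_dominator[OF \<beta> z0, of \<alpha>] by blast
  obtain g1 where g1: "integrable pos_lborel g1" "\<And>z \<tau>. z \<in> ball z0 (z0/2) \<Longrightarrow> \<tau> > 0 \<Longrightarrow> \<bar>ext_kernel (\<alpha> - 1) \<beta> z \<tau>\<bar> \<le> g1 \<tau>"
    using ext_kernel_local_dominator[OF \<beta> z0, of "\<alpha> - 1"] by blast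
  have \<beta>1: "\<beta> + 1 > 1" using \<beta> by simp
  obtain g2 where g2: "integrable pos_lborel g2" "\<And>z \<tau>. z \<in> ball z0 (z0/2) \<Longrightarrow> \<tau> > 0 \<Longrightarrow> \<bar>ext_kernel (\<alpha> + 1) (\<beta> + 1) z \<tau>\<bar> \<le> g2 \<tau>"
    using ext_kernel_local_dominator[OF \<beta>1 z0, of "\<alpha> + 1"] by blast
  let ?X = "\<lambda>y :: 'a \<times> real \<times> real. (fst y, fst (snd y))" and ?Z = "\<lambda>y :: 'a \<times> real \<times> real. snd (snd y)"
  let ?dk = "\<lambda>y \<tau>. \<alpha> * ext_kernel (\<alpha> - 1) \<beta> (?Z y) \<tau> - 1/2 * ext_kernel (\<alpha> + 1) (\<beta> + 1) (?Z y) \<tau>"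
  let ?f = "\<lambda>y \<tau>. ext_kernel \<alpha> \<beta> (?Z y) \<tau> * G \<tau> (?X y)"
  let ?f' = "\<lambda>y \<tau> v. ext_kernel \<alpha> \<beta> (?Z y) \<tau> * frechet_derivative (G \<tau>) (at (?X y)) (?X v) + (?dk y \<tau> * ?Z v) * G \<tau> (?X y)"
  have blX: "bounded_linear ?X"
    by (rule bounded_linear_Pair[OF bounded_linear_fst bounded_linear_compose[OF bounded_linear_fst bounded_linear_snd]])
  have blZ: "bounded_linear ?Z" by (rule bounded_linear_compose[OF bounded_linear_snd bounded_linear_snd])
  have nX: "norm (?X v) \<le> norm v" for v :: "'a \<times> real \<times> real"
    unfolding norm_prod_def[of v] norm_prod_def[of "?X v"] by (intro real_sqrt_le_mono) (auto simp: norm_prod_def)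
  have nZ: "\<bar>?Z v\<bar> \<le> norm v" for v :: "'a \<times> real \<times> real"
    using norm_snd_le[of "snd v" "fst v"] norm_snd_le[of "snd (snd v)" "fst (snd v)"] by simp
  have ball: "?Z w \<in> ball z0 (z0/2)" if "w \<in> ball y (z0/2)" for w
    using that nZ[of "y - w"] by (simp add: dist_norm z0_def)
  have pos: "?Z w > 0" if "w \<in> ball y (z0/2)" for w
  proof -
    have "\<bar>z0 - ?Z w\<bar> < z0 / 2" using ball[OF that] by (simp add: dist_real_def)
    then show ?thesis using z0 by linarith
  qed
  have main: "((\<lambda>y. \<integral>\<tau>. ?f y \<tau> \<partial>pos_lborel) has_derivative (\<lambda>v. \<integral>\<tau>. ?f' y \<tau> v \<partial>pos_lborel)) (at y)"
  proof (rule has_derivative_integral(1)[where e="z0/2" and g="\<lambda>\<tau>. M' * g0 \<tau> + (\<bar>\<alpha>\<bar> * g1 \<tau> + g2 \<tau>) * M"])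
    show "z0 / 2 > 0" using z0 by simp
    show "((\<lambda>y. ?f y \<tau>) has_derivative ?f' w \<tau>) (at w)" if w: "w \<in> ball y (z0/2)" and "\<tau> \<in> space pos_lborel" for w \<tau>
    proof (rule has_derivative_mult)
      have \<tau>: "\<tau> > 0" using that(2) by (simp add: space_pos_lborel)
      then have "G \<tau> differentiable (at x)" for x by (intro uniform_smooth_differentiable[OF us]) simp
      then have "(G \<tau> has_derivative frechet_derivative (G \<tau>) (at x)) (at x)" for x
        unfolding frechet_derivative_works .
      from has_derivative_compose[OF bounded_linear_imp_has_derivative[OF blX] this]
      show "((\<lambda>y. G \<tau> (?X y)) has_derivative (\<lambda>v. frechet_derivative (G \<tau>) (at (?X w)) (?X v))) (at w)" .
      from has_derivative_compose[OF bounded_linear_imp_has_derivative[OF blZ]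
          ext_kernel_has_derivative_z[OF pos[OF w] \<tau>, unfolded has_field_derivative_def]]
      show "((\<lambda>y. ext_kernel \<alpha> \<beta> (?Z y) \<tau>) has_derivative (\<lambda>v. ?dk w \<tau> * ?Z v)) (at w)" .
    qed
    show "integrable pos_lborel (?f w)" if "w \<in> ball y (z0/2)" for w
      by (rule admissible_integrable[OF \<beta> pos[OF that] G])
    show "(\<lambda>\<tau>. ?f' y \<tau> v) \<in> borel_measurable pos_lborel" for v
    proof -
      have "(\<lambda>\<tau>. frechet_derivative (G \<tau>) (at (?X y)) (?X v)) \<in> borel_measurable pos_lborel"
        using admissible_deriv[OF G] unfolding admissible_def by blast
      then show ?thesis
        by (intro borel_measurable_add borel_measurable_times borel_measurable_diff borel_measurable_const m ext_kernel_measurable)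
    qed
    show "integrable pos_lborel (\<lambda>\<tau>. M' * g0 \<tau> + (\<bar>\<alpha>\<bar> * g1 \<tau> + g2 \<tau>) * M)"
      by (intro Bochner_Integration.integrable_add integrable_mult_left integrable_mult_right g0 g1 g2)
    show "\<bar>?f' w \<tau> v\<bar> \<le> (M' * g0 \<tau> + (\<bar>\<alpha>\<bar> * g1 \<tau> + g2 \<tau>) * M) * norm v"
      if w: "w \<in> ball y (z0/2)" and "\<tau> \<in> space pos_lborel" for w \<tau> v
    proof -
      have \<tau>: "\<tau> > 0" using that(2) by (simp add: space_pos_lborel)
      note b = g0(2)[OF ball[OF w] \<tau>] g1(2)[OF ball[OF w] \<tau>] g2(2)[OF ball[OF w] \<tau>]
      have "\<bar>?dk w \<tau>\<bar> \<le> \<bar>\<alpha>\<bar> * \<bar>ext_kernel (\<alpha> - 1) \<beta> (?Z w) \<tau>\<bar> + 1/2 * \<bar>ext_kernel (\<alpha> + 1) (\<beta> + 1) (?Z w) \<tau>\<bar>"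
        by (rule order_trans[OF abs_triangle_ineq4]) (simp add: abs_mult)
      also have "\<dots> \<le> \<bar>\<alpha>\<bar> * g1 \<tau> + g2 \<tau>"
        using b(3) by (intro add_mono mult_left_mono b(2)) auto
      finally have dk: "\<bar>?dk w \<tau>\<bar> \<le> \<bar>\<alpha>\<bar> * g1 \<tau> + g2 \<tau>" .
      have "\<bar>?f' w \<tau> v\<bar> \<le> \<bar>ext_kernel \<alpha> \<beta> (?Z w) \<tau>\<bar> * \<bar>frechet_derivative (G \<tau>) (at (?X w)) (?X v)\<bar> + (\<bar>?dk w \<tau>\<bar> * \<bar>?Z v\<bar>) * \<bar>G \<tau> (?X w)\<bar>"
        by (rule order_trans[OF abs_triangle_ineq]) (simp add: abs_mult)
      also have "\<dots> \<le> g0 \<tau> * (M' * norm v) + ((\<bar>\<alpha>\<bar> * g1 \<tau> + g2 \<tau>) * norm v) * M"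
      proof (intro add_mono mult_mono b(1) dk nZ M(2)[OF \<tau>])
        show "\<bar>frechet_derivative (G \<tau>) (at (?X w)) (?X v)\<bar> \<le> M' * norm v"
          by (rule order_trans[OF M'(2)[OF \<tau>]]) (intro mult_left_mono nX M'(1))
        show "0 \<le> g0 \<tau>" by (rule order_trans[OF abs_ge_zero b(1)])
        show dk0: "0 \<le> \<bar>\<alpha>\<bar> * g1 \<tau> + g2 \<tau>" by (rule order_trans[OF abs_ge_zero dk])
        show "0 \<le> (\<bar>\<alpha>\<bar> * g1 \<tau> + g2 \<tau>) * norm v" by (rule mult_nonneg_nonneg[OF dk0]) simp
      qed auto
      finally show ?thesis by (simp add: algebra_simps)
    qed
  qed
  moreover have "(\<integral>\<tau>. ?f' y \<tau> v \<partial>pos_lborel) = ?Z v * (\<alpha> * ext_integral (\<alpha> - 1) \<beta> G y - 1/2 * ext_integral (\<alpha> + 1) (\<beta> + 1) G y)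
       + ext_integral \<alpha> \<beta> (\<lambda>\<tau> x. frechet_derivative (G \<tau>) (at x) (?X v)) y" for v
  proof -
    have i0: "integrable pos_lborel (\<lambda>\<tau>. ext_kernel \<alpha> \<beta> (?Z y) \<tau> * frechet_derivative (G \<tau>) (at (?X y)) (?X v))"
      by (rule admissible_integrable[OF \<beta> z admissible_deriv[OF G]])
    have i1: "integrable pos_lborel (\<lambda>\<tau>. ext_kernel (\<alpha> - 1) \<beta> (?Z y) \<tau> * G \<tau> (?X y))"
      by (rule admissible_integrable[OF \<beta> z G])
    have i2: "integrable pos_lborel (\<lambda>\<tau>. ext_kernel (\<alpha> + 1) (\<beta> + 1) (?Z y) \<tau> * G \<tau> (?X y))"
      by (rule admissible_integrable[OF \<beta>1 z G])
    have "(\<integral>\<tau>. ?f' y \<tau> v \<partial>pos_lborel) = (\<integral>\<tau>. ext_kernel \<alpha> \<beta> (?Z y) \<tau> * frechet_derivative (G \<tau>) (at (?X y)) (?X v)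
       + (?Z v * \<alpha> * (ext_kernel (\<alpha> - 1) \<beta> (?Z y) \<tau> * G \<tau> (?X y)) - ?Z v * (1/2) * (ext_kernel (\<alpha> + 1) (\<beta> + 1) (?Z y) \<tau> * G \<tau> (?X y))) \<partial>pos_lborel)"
      by (intro Bochner_Integration.integral_cong refl) (simp add: algebra_simps)
    also have "\<dots> = ext_integral \<alpha> \<beta> (\<lambda>\<tau> x. frechet_derivative (G \<tau>) (at x) (?X v)) y
        + (?Z v * \<alpha> * ext_integral (\<alpha> - 1) \<beta> G y - ?Z v * (1/2) * ext_integral (\<alpha> + 1) (\<beta> + 1) G y)"
      unfolding ext_integral_def using i0 i1 i2 by simp
    finally show ?thesis by (simp add: algebra_simps)
  qed
  ultimately show ?thesis unfolding ext_integral_def[abs_def] by simp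
qed

lemma open_upper_half: "open {y :: 'a::euclidean_space \<times> real \<times> real. snd (snd y) > 0}"
  by (intro open_Collect_less continuous_intros)

text \<open>Closure of the family under differentiation gives all orders. Differentiation never
  lowers \<beta>, so \<beta> > 1 and with it the integrability at infinity persist.\<close>

lemma ext_integral_higher_differentiable:
  fixes G :: "real \<Rightarrow> ('a::euclidean_space \<times> real) \<Rightarrow> real"
  assumes "\<beta> > 1" "admissible G"
  shows "higher_differentiable_on {y. snd (snd y) > 0} (ext_integral \<alpha> \<beta> G) n"
  using assms
proof (induction n arbitrary: \<alpha> \<beta> G)
  case 0
  then show ?case
    by (auto intro!: continuous_at_imp_continuous_on has_derivative_continuous[OF ext_integral_has_derivative])
next
  case (Suc n)
  let ?S = "{y :: 'a \<times> real \<times> real. snd (snd y) > 0}"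
  note d = ext_integral_has_derivative[OF Suc.prems]
  have "higher_differentiable_on ?S (\<lambda>y. frechet_derivative (ext_integral \<alpha> \<beta> G) (at y) v) n" for v
  proof -
    let ?D = "\<lambda>\<tau> x. frechet_derivative (G \<tau>) (at x) (fst v, fst (snd v))"
    have "higher_differentiable_on ?S (\<lambda>y. snd (snd v) * (\<alpha> * ext_integral (\<alpha> - 1) \<beta> G y + (- (1/2)) * ext_integral (\<alpha> + 1) (\<beta> + 1) G y)
       + ext_integral \<alpha> \<beta> ?D y) n"
      using Suc.prems
      by (intro higher_differentiable_on_add higher_differentiable_on_cmult open_upper_half Suc.IH admissible_deriv) auto
    then show ?thesis
      by (subst higher_differentiable_on_cong[OF open_upper_half]) (auto simp: frechet_derivative_at[OF d, symmetric])
  qed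
  moreover have "\<forall>y\<in>?S. ext_integral \<alpha> \<beta> G differentiable (at y)" using d differentiableI by blast
  ultimately show ?case by simp
qed

section \<open>The extension equation\<close>

text \<open>The operators are written with derivatives in one group of variables at a time; these
  are read off from the joint derivative.\<close>

lemma has_derivative_slices:
  fixes H :: "'a::real_normed_vector \<times> real \<times> real \<Rightarrow> real"
  assumes "(H has_derivative H') (at (X, t, z))"
  shows "((\<lambda>X. H (X, t, z)) has_derivative (\<lambda>v. H' (v, 0, 0))) (at X)"
    and "((\<lambda>t. H (X, t, z)) has_real_derivative H' (0, 1, 0)) (at t)"
    and "((\<lambda>z. H (X, t, z)) has_real_derivative H' (0, 0, 1)) (at z)"
proof -
  interpret bounded_linear H' by (rule has_derivative_bounded_linear[OF assms])
  show "((\<lambda>X. H (X, t, z)) has_derivative (\<lambda>v. H' (v, 0, 0))) (at X)"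
  proof -
    have "((\<lambda>X. (X, t, z)) has_derivative (\<lambda>v. (v, 0, 0))) (at X)" by (auto intro!: derivative_eq_intros simp: zero_prod_def)
    from has_derivative_compose[OF this assms] show ?thesis .
  qed
  have "((\<lambda>t. H (X, t, z)) has_derivative (\<lambda>h. H' (0, h, 0))) (at t)"
  proof -
    have "((\<lambda>t. (X, t, z)) has_derivative (\<lambda>h. (0, h, 0))) (at t)" by (auto intro!: derivative_eq_intros)
    from has_derivative_compose[OF this assms] show ?thesis .
  qed
  moreover have "(\<lambda>h. H' (0, h, 0)) = (*) (H' (0, 1, 0))"
  proof (rule ext)
    show "H' (0, h, 0) = H' (0, 1, 0) * h" for h using scaleR[of h "(0, 1, 0)"] by (simp add: mult.commute)
  qed
  ultimately show "((\<lambda>t. H (X, t, z)) has_real_derivative H' (0, 1, 0)) (at t)"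
    by (simp only: has_field_derivative_def)
  have "((\<lambda>z. H (X, t, z)) has_derivative (\<lambda>h. H' (0, 0, h))) (at z)"
  proof -
    have "((\<lambda>z. (X, t, z)) has_derivative (\<lambda>h. (0, 0, h))) (at z)" by (auto intro!: derivative_eq_intros)
    from has_derivative_compose[OF this assms] show ?thesis .
  qed
  moreover have "(\<lambda>h. H' (0, 0, h)) = (*) (H' (0, 0, 1))"
  proof (rule ext)
    show "H' (0, 0, h) = H' (0, 0, 1) * h" for h using scaleR[of h "(0, 0, 1)"] by (simp add: mult.commute)
  qed
  ultimately show "((\<lambda>z. H (X, t, z)) has_real_derivative H' (0, 0, 1)) (at z)"
    by (simp only: has_field_derivative_def)
qed

lemma ext_integral_slices:
  fixes G :: "real \<Rightarrow> ((real^'n) \<times> real) \<Rightarrow> real"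
  assumes \<beta>: "\<beta> > 1" and G: "admissible G" and z: "z > 0"
  shows "frechet_derivative (\<lambda>X. c * ext_integral \<alpha> \<beta> G (X, t, z)) (at X) (axis i 1)
      = c * ext_integral \<alpha> \<beta> (\<lambda>\<tau>. DX i (G \<tau>)) (X, t, z)"
    and "((\<lambda>t. c * ext_integral \<alpha> \<beta> G (X, t, z)) has_real_derivative
      c * ext_integral \<alpha> \<beta> (\<lambda>\<tau>. DT (G \<tau>)) (X, t, z)) (at t)"
    and "((\<lambda>z. c * ext_integral \<alpha> \<beta> G (X, t, z)) has_real_derivative
      c * (\<alpha> * ext_integral (\<alpha> - 1) \<beta> G (X, t, z) - 1/2 * ext_integral (\<alpha> + 1) (\<beta> + 1) G (X, t, z))) (at z)"
proof -
  have Z: "snd (snd (X, t, z)) > 0" using z by simp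
  note d = has_derivative_slices[OF ext_integral_has_derivative[OF \<beta> G Z, of \<alpha>]]
  have G0: "ext_integral \<alpha> \<beta> (\<lambda>\<tau> x. frechet_derivative (G \<tau>) (at x) 0) (X, t, z) = 0"
  proof -
    have "frechet_derivative (G \<tau>) (at x) 0 = 0" if "\<tau> \<in> space pos_lborel" for \<tau> x
      using linear_0[OF linear_frechet_derivative[OF uniform_smooth_differentiable[of "{0<..}" G]]] G that
      by (simp add: admissible_def space_pos_lborel)
    then have "ext_integral \<alpha> \<beta> (\<lambda>\<tau> x. frechet_derivative (G \<tau>) (at x) 0) (X, t, z) = (\<integral>\<tau>. 0 \<partial>pos_lborel)"
      unfolding ext_integral_def by (intro Bochner_Integration.integral_cong) auto
    then show ?thesis by simp
  qed
  show "frechet_derivative (\<lambda>X. c * ext_integral \<alpha> \<beta> G (X, t, z)) (at X) (axis i 1)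
      = c * ext_integral \<alpha> \<beta> (\<lambda>\<tau>. DX i (G \<tau>)) (X, t, z)"
    by (subst frechet_derivative_at[OF has_derivative_mult_right[OF d(1)], symmetric]) simp
  show "((\<lambda>t. c * ext_integral \<alpha> \<beta> G (X, t, z)) has_real_derivative
      c * ext_integral \<alpha> \<beta> (\<lambda>\<tau>. DT (G \<tau>)) (X, t, z)) (at t)"
    using DERIV_cmult[OF d(2), of c] by simp
  show "((\<lambda>z. c * ext_integral \<alpha> \<beta> G (X, t, z)) has_real_derivative
      c * (\<alpha> * ext_integral (\<alpha> - 1) \<beta> G (X, t, z) - 1/2 * ext_integral (\<alpha> + 1) (\<beta> + 1) G (X, t, z))) (at z)"
    using DERIV_cmult[OF d(3), of c] G0 by (simp add: zero_prod_def)
qed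

lemma ext_kernel_shift: "z > 0 \<Longrightarrow> ext_kernel \<alpha> \<beta> z \<tau> = z * ext_kernel (\<alpha> - 1) \<beta> z \<tau>"
  using powr_add[of z 1 "\<alpha> - 1"] by (simp add: ext_kernel_def)

text \<open>Absorbs the factor 1/z of the Bessel operator into the exponent of the kernel.\<close>

lemma ext_integral_shift:
  "z > 0 \<Longrightarrow> ext_integral \<alpha> \<beta> G (X, t, z) = z * ext_integral (\<alpha> - 1) \<beta> G (X, t, z)"
proof -
  assume z: "z > 0"
  have "ext_integral \<alpha> \<beta> G (X, t, z) = (\<integral>\<tau>. z * (ext_kernel (\<alpha> - 1) \<beta> z \<tau> * G \<tau> (X, t)) \<partial>pos_lborel)"
    unfolding ext_integral_def fst_conv snd_conv
    by (intro Bochner_Integration.integral_cong refl, subst ext_kernel_shift[OF z]) simp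
  then show ?thesis unfolding ext_integral_def by simp
qed

text \<open>Supplies the vanishing boundary terms of the integration in \<tau>: the exponential wins
  at 0, the negative power at infinity.\<close>

lemma ext_kernel_limits:
  assumes "\<beta> > 0" "z > 0"
  shows "(ext_kernel \<alpha> \<beta> z \<longlongrightarrow> 0) (at_right 0)" and "(ext_kernel \<alpha> \<beta> z \<longlongrightarrow> 0) at_top"
proof -
  have c: "z\<^sup>2 / 4 > 0" using assms by simp
  have "((\<lambda>\<tau>. z powr \<alpha> * (\<tau> powr (- \<beta>) * exp (- (c / \<tau>)))) \<longlongrightarrow> 0) (at_right 0)" if "c > 0" for c
    using that assms(1) by real_asymp
  from this[OF c] show "(ext_kernel \<alpha> \<beta> z \<longlongrightarrow> 0) (at_right 0)" unfolding ext_kernel_def[abs_def] .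
  have "((\<lambda>\<tau>. z powr \<alpha> * (\<tau> powr (- \<beta>) * exp (- (c / \<tau>)))) \<longlongrightarrow> 0) at_top" if "c > 0" for c
    using that assms(1) by real_asymp
  from this[OF c] show "(ext_kernel \<alpha> \<beta> z \<longlongrightarrow> 0) at_top" unfolding ext_kernel_def[abs_def] .
qed

section \<open>Essential suprema and the integrals behind the boundary limits\<close>

lemma Linf_norm_le:
  assumes "f \<in> borel_measurable lebesgue" "\<And>x. \<bar>f x\<bar> \<le> K"
  shows "Linf_norm f \<le> ereal K"
  unfolding Linf_norm_def by (rule esssup_I) (use assms in auto)

text \<open>A negative essential supremum of |f| would make the whole space a null set.\<close>

lemma Linf_norm_nonneg: "0 \<le> Linf_norm (f :: 'a::euclidean_space \<Rightarrow> real)"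
proof (rule ccontr)
  assume "\<not> 0 \<le> Linf_norm f"
  then have n: "Linf_norm f < 0" by simp
  have "AE x in lebesgue. ereal \<bar>f x\<bar> \<le> Linf_norm f" unfolding Linf_norm_def by (rule esssup_AE)
  then have "AE x in (lebesgue :: 'a measure). False"
  proof eventually_elim
    case (elim x)
    then have "ereal \<bar>f x\<bar> < 0" using n by (rule le_less_trans)
    then show ?case by simp
  qed
  then show False by (simp add: AE_iff_null null_sets_def)
qed

lemma continuous_measurable_lebesgue:
  "continuous_on UNIV f \<Longrightarrow> f \<in> borel_measurable lebesgue" for f :: "'a::euclidean_space \<Rightarrow> real"
  by (intro measurable_completion) (simp add: borel_measurable_continuous_onI)

text \<open>Near 0 the integrand is \<tau>^(-s), integrable because s < 1; beyond 1 it is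
  \<tau>^(-1-s), integrable because s > 0.\<close>

lemma integrable_powr_min:
  assumes "0 < s" "s < 1"
  shows "integrable pos_lborel (\<lambda>\<tau>. \<tau> powr (- 1 - s) * min 1 \<tau>)"
proof -
  have 1: "integrable lborel (\<lambda>\<tau>. indicator {0..1} \<tau> * \<tau> powr (- s))"
  proof -
    have "((\<lambda>x. x powr (- s)) has_integral (1 powr (- s + 1) / (- s + 1))) {0..1}"
      by (rule has_integral_powr_from_0) (use assms in auto)
    then have "(\<lambda>x. x powr (- s)) absolutely_integrable_on {0..1::real}"
      by (intro nonnegative_absolutely_integrable_1) auto
    then have "integrable lebesgue (\<lambda>\<tau>. indicator {0..1} \<tau> * \<tau> powr (- s))" unfolding set_integrable_def by simp
    then show ?thesis by (subst (asm) integrable_completion) auto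
  qed
  have 2: "integrable lborel (\<lambda>\<tau>. indicator {1..} \<tau> * \<tau> powr (- 1 - s))"
  proof -
    have "((\<lambda>x. x powr (- 1 - s)) has_integral - (1 powr (- 1 - s + 1)) / (- 1 - s + 1)) {1..}"
      by (rule has_integral_powr_to_inf) (use assms in auto)
    then have "(\<lambda>x. x powr (- 1 - s)) absolutely_integrable_on {1::real..}"
      by (intro nonnegative_absolutely_integrable_1) auto
    then have "integrable lebesgue (\<lambda>\<tau>. indicator {1..} \<tau> * \<tau> powr (- 1 - s))" unfolding set_integrable_def by simp
    then show ?thesis by (subst (asm) integrable_completion) auto
  qed
  have "integrable lborel (\<lambda>\<tau>. indicator {0<..} \<tau> *\<^sub>R (\<tau> powr (- 1 - s) * min 1 \<tau>))"
  proof (rule Bochner_Integration.integrable_bound[OF Bochner_Integration.integrable_add[OF 1 2]])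
    show "AE \<tau> in lborel. norm (indicator {0<..} \<tau> *\<^sub>R (\<tau> powr (- 1 - s) * min 1 \<tau>))
        \<le> norm (indicator {0..1} \<tau> * \<tau> powr (- s) + indicator {1..} \<tau> * \<tau> powr (- 1 - s))"
    proof (rule AE_I2)
      fix \<tau> :: real
      have "\<tau> powr (- 1 - s) * \<tau> = \<tau> powr (- s)" if "\<tau> > 0"
        using powr_add[of \<tau> "- 1 - s" 1] that by simp
      then show "norm (indicator {0<..} \<tau> *\<^sub>R (\<tau> powr (- 1 - s) * min 1 \<tau>))
        \<le> norm (indicator {0..1} \<tau> * \<tau> powr (- s) + indicator {1..} \<tau> * \<tau> powr (- 1 - s))"
        by (auto simp: indicator_def min_def)
    qed
  qed measurable
  then show ?thesis unfolding set_integrable_pos_lborel[symmetric] set_integrable_def .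
qed

text \<open>With x = z^2 / (4 \<tau>) the factor after \<open>m\<close> is c (1 - e^(-x)) + 2 x
  e^(-x), which is bounded by |c| + 2 and tends to 0 with z for fixed \<tau>. For c = 2 s it is the
  error, relative to \<tau>^(-1-s), of replacing z^a times the z-derivative of the weight by its
  limit.\<close>

lemma dominated_remainder_tendsto_0:
  assumes m: "integrable pos_lborel m"
  shows "((\<lambda>z::real. \<integral>\<tau>. m \<tau> * (c * (1 - exp (- (z\<^sup>2 / 4 / \<tau>))) + 2 * (z\<^sup>2 / 4 / \<tau>) * exp (- (z\<^sup>2 / 4 / \<tau>))) \<partial>pos_lborel) \<longlongrightarrow> 0) (at_right 0)"
  unfolding tendsto_at_iff_sequentially
proof (intro allI impI)
  fix Z :: "nat \<Rightarrow> real" assume Z: "\<forall>i. Z i \<in> {0<..} - {0}" "Z \<longlonglongrightarrow> 0"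
  let ?h = "\<lambda>x::real. c * (1 - exp (- x)) + 2 * x * exp (- x)"
  have hb: "\<bar>?h x\<bar> \<le> \<bar>c\<bar> + 2" if "x \<ge> 0" for x
  proof -
    have "x * exp (- x) \<le> 1"
    proof -
      have "x \<le> exp x" using exp_ge_add_one_self[of x] by linarith
      then show ?thesis by (simp add: exp_minus field_simps)
    qed
    moreover have "\<bar>c * (1 - exp (- x))\<bar> \<le> \<bar>c\<bar> * 1" unfolding abs_mult using that by (intro mult_left_mono) auto
    moreover have "0 \<le> x * exp (- x)" using that by simp
    ultimately show ?thesis by linarith
  qed
  have "(\<lambda>n. \<integral>\<tau>. m \<tau> * ?h ((Z n)\<^sup>2 / 4 / \<tau>) \<partial>pos_lborel) \<longlonglongrightarrow> (\<integral>\<tau>. 0 \<partial>pos_lborel)"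
  proof (rule integral_dominated_convergence[where w="\<lambda>\<tau>. (\<bar>c\<bar> + 2) * \<bar>m \<tau>\<bar>"])
    show "integrable pos_lborel (\<lambda>\<tau>. (\<bar>c\<bar> + 2) * \<bar>m \<tau>\<bar>)" using m by simp
    show "(\<lambda>\<tau>. m \<tau> * ?h ((Z n)\<^sup>2 / 4 / \<tau>)) \<in> borel_measurable pos_lborel" for n
    proof (rule borel_measurable_times)
      show "m \<in> borel_measurable pos_lborel" using m by simp
      show "(\<lambda>\<tau>. ?h ((Z n)\<^sup>2 / 4 / \<tau>)) \<in> borel_measurable pos_lborel"
        by (rule borel_measurable_pos_lborel) measurable
    qed
    show "AE \<tau> in pos_lborel. (\<lambda>n. m \<tau> * ?h ((Z n)\<^sup>2 / 4 / \<tau>)) \<longlonglongrightarrow> 0"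
    proof (rule AE_I2)
      fix \<tau>
      have "(\<lambda>n. m \<tau> * ?h ((Z n)\<^sup>2 / 4 / \<tau>)) \<longlonglongrightarrow> m \<tau> * ?h (0\<^sup>2 / 4 / \<tau>)"
        unfolding divide_inverse by (intro tendsto_intros Z(2))
      then show "(\<lambda>n. m \<tau> * ?h ((Z n)\<^sup>2 / 4 / \<tau>)) \<longlonglongrightarrow> 0" by simp
    qed
    show "AE \<tau> in pos_lborel. norm (m \<tau> * ?h ((Z n)\<^sup>2 / 4 / \<tau>)) \<le> (\<bar>c\<bar> + 2) * \<bar>m \<tau>\<bar>" for n
    proof (rule AE_I2)
      fix \<tau> assume "\<tau> \<in> space pos_lborel"
      then have "(Z n)\<^sup>2 / 4 / \<tau> \<ge> 0" by (simp add: space_pos_lborel)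
      from mult_right_mono[OF hb[OF this], of "\<bar>m \<tau>\<bar>"]
      show "norm (m \<tau> * ?h ((Z n)\<^sup>2 / 4 / \<tau>)) \<le> (\<bar>c\<bar> + 2) * \<bar>m \<tau>\<bar>"
        unfolding real_norm_def abs_mult[of "m \<tau>"] by (subst mult.commute) simp
    qed
  qed simp
  then show "((\<lambda>z::real. \<integral>\<tau>. m \<tau> * (c * (1 - exp (- (z\<^sup>2 / 4 / \<tau>))) + 2 * (z\<^sup>2 / 4 / \<tau>) * exp (- (z\<^sup>2 / 4 / \<tau>))) \<partial>pos_lborel) \<circ> Z) \<longlonglongrightarrow> 0"
    by (simp add: comp_def)
qed

context hypoelliptic
begin

lemma W_admissible: "bounded_smooth f \<Longrightarrow> admissible (W f)"
  unfolding admissible_def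
  by (intro conjI allI W_uniform_smooth continuous_on_measurable_pos_lborel W_continuous_on_time)

text \<open>Fundamental theorem of calculus for the product of kernel and W f as a function of
  \<tau>: the derivative of W f supplies the terms with Q, B and \<open>DT\<close> by
  \<open>W_rate_eq\<close>, that of the kernel the last two, and both boundary values are 0.\<close>

lemma W_heat_identity:
  assumes f: "bounded_smooth f" and \<beta>: "\<beta> > 1" and z: "z > 0"
  shows "(\<Sum>i\<in>UNIV. \<Sum>j\<in>UNIV. Q $ i $ j * ext_integral \<alpha> \<beta> (\<lambda>\<tau>. DX j (DX i (W f \<tau>))) (X, t, z))
      + (\<Sum>i\<in>UNIV. (B *v X) $ i * ext_integral \<alpha> \<beta> (\<lambda>\<tau>. DX i (W f \<tau>)) (X, t, z))
      - ext_integral \<alpha> \<beta> (\<lambda>\<tau>. DT (W f \<tau>)) (X, t, z)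
      - \<beta> * ext_integral \<alpha> (\<beta> + 1) (W f) (X, t, z) + 1/4 * ext_integral (\<alpha> + 2) (\<beta> + 2) (W f) (X, t, z) = 0"
proof -
  let ?x = "(X, t)"
  note A0 = W_admissible[OF f]
  note A1 = admissible_deriv[OF A0]
  note A2 = admissible_deriv[OF A1]
  have \<beta>1: "\<beta> + 1 > 1" and \<beta>2: "\<beta> + 2 > 1" using \<beta> by simp_all
  have int1: "integrable pos_lborel (\<lambda>\<tau>. ext_kernel \<alpha> \<beta> z \<tau> * frechet_derivative (W f \<tau>) (at y) v)" for y v
    by (rule admissible_integrable[OF \<beta> z A1])
  have int2: "integrable pos_lborel (\<lambda>\<tau>. ext_kernel \<alpha> \<beta> z \<tau> * frechet_derivative (\<lambda>y. frechet_derivative (W f \<tau>) (at y) v) (at y) v')" for y v v'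
    by (rule admissible_integrable[OF \<beta> z A2])
  have int3: "integrable pos_lborel (\<lambda>\<tau>. ext_kernel \<alpha> (\<beta> + 1) z \<tau> * W f \<tau> y)" for y
    by (rule admissible_integrable[OF \<beta>1 z A0])
  have int4: "integrable pos_lborel (\<lambda>\<tau>. ext_kernel (\<alpha> + 2) (\<beta> + 2) z \<tau> * W f \<tau> y)" for y
    by (rule admissible_integrable[OF \<beta>2 z A0])
  note int = int1 int2 int3 int4
  let ?F = "\<lambda>\<tau>. ext_kernel \<alpha> \<beta> z \<tau> * W f \<tau> ?x"
  let ?dk = "\<lambda>\<tau>. - \<beta> * ext_kernel \<alpha> (\<beta> + 1) z \<tau> + 1/4 * ext_kernel (\<alpha> + 2) (\<beta> + 2) z \<tau>"
  let ?F' = "\<lambda>\<tau>. ext_kernel \<alpha> \<beta> z \<tau> * W_rate f \<tau> ?x + ?dk \<tau> * W f \<tau> ?x"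
  let ?S = "\<lambda>\<tau>. (\<Sum>i\<in>UNIV. \<Sum>j\<in>UNIV. Q $ i $ j * (ext_kernel \<alpha> \<beta> z \<tau> * DX j (DX i (W f \<tau>)) ?x))
      + (\<Sum>i\<in>UNIV. (B *v X) $ i * (ext_kernel \<alpha> \<beta> z \<tau> * DX i (W f \<tau>) ?x))
      - ext_kernel \<alpha> \<beta> z \<tau> * DT (W f \<tau>) ?x
      - \<beta> * (ext_kernel \<alpha> (\<beta> + 1) z \<tau> * W f \<tau> ?x) + 1/4 * (ext_kernel (\<alpha> + 2) (\<beta> + 2) z \<tau> * W f \<tau> ?x)"
  \<comment> \<open>Distributes the derivative over the single integrands of the claim, each of
    which is integrable on its own.\<close>
  have FS: "?F' \<tau> = ?S \<tau>" for \<tau>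
    unfolding W_rate_eq[OF f] fst_conv
    by (simp add: algebra_simps sum_distrib_left)
  have iS: "integrable pos_lborel ?S"
    by (intro Bochner_Integration.integrable_add Bochner_Integration.integrable_diff
        Bochner_Integration.integrable_sum integrable_mult_right int)
  have iF: "set_integrable lborel {0<..} ?F'"
    unfolding set_integrable_pos_lborel FS by (rule iS)
  have ein: "einterval 0 \<infinity> = {0<..}" by (auto simp: einterval_def)
  have der: "(?F has_real_derivative ?F' \<tau>) (at \<tau>)" if "\<tau> > 0" for \<tau>
    using DERIV_mult[OF ext_kernel_has_derivative_time[OF z that, of \<alpha> \<beta>] W_has_derivative_time[OF f that, of ?x]]
    unfolding W_rate_def by (simp add: algebra_simps)
  have ck: "continuous_on {0<..} (ext_kernel \<alpha>' \<beta>' z)" for \<alpha>' \<beta>'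
    using ext_kernel_has_derivative_time[OF z] by (intro continuous_at_imp_continuous_on ballI) (auto intro: DERIV_isCont)
  have cont: "isCont ?F' \<tau>" if "\<tau> > 0" for \<tau>
  proof -
    have "continuous_on {0<..} ?F'"
      by (intro continuous_on_add continuous_on_mult continuous_on_const ck W_rate_continuous_on[OF f] W_continuous_on_time[OF f])
    then show ?thesis using that by (simp add: continuous_on_eq_continuous_at)
  qed
  obtain M where M: "\<And>\<tau>. \<tau> > 0 \<Longrightarrow> \<bar>W f \<tau> ?x\<bar> \<le> M"
    using uniform_smooth_bounded[OF W_uniform_smooth[OF f]] by auto
  \<comment> \<open>A filter as parameter treats both ends of the half line at once: W f is bounded,
    so the product vanishes with the kernel.\<close>
  have lim: "(?F \<longlongrightarrow> 0) F" if "(ext_kernel \<alpha> \<beta> z \<longlongrightarrow> 0) F" "\<forall>\<^sub>F \<tau> in F. \<tau> > 0" for F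
  proof (rule Lim_null_comparison)
    show "\<forall>\<^sub>F \<tau> in F. norm (?F \<tau>) \<le> \<bar>ext_kernel \<alpha> \<beta> z \<tau>\<bar> * M"
      using that(2) by eventually_elim (auto simp: abs_mult intro!: mult_left_mono M)
    show "((\<lambda>\<tau>. \<bar>ext_kernel \<alpha> \<beta> z \<tau>\<bar> * M) \<longlongrightarrow> 0) F"
      using tendsto_mult_left_zero[OF tendsto_rabs_zero[OF that(1)], of M] by simp
  qed
  have "(LBINT \<tau>=0..\<infinity>. ?F' \<tau>) = 0 - 0"
  proof (rule interval_integral_FTC_integrable)
    show "(?F has_vector_derivative ?F' \<tau>) (at \<tau>)" if "0 < ereal \<tau>" for \<tau>
      using der[of \<tau>] that by (simp add: has_real_derivative_iff_has_vector_derivative)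
    show "isCont ?F' \<tau>" if "0 < ereal \<tau>" for \<tau> using cont[of \<tau>] that by simp
    show "set_integrable lborel (einterval 0 \<infinity>) ?F'" unfolding ein by (rule iF)
    show "((?F \<circ> real_of_ereal) \<longlongrightarrow> 0) (at_right 0)"
      unfolding zero_ereal_def ereal_tendsto_simps
      by (rule lim) (use ext_kernel_limits(1)[of \<beta> z \<alpha>] \<beta> z in \<open>auto simp: eventually_at_right_less\<close>)
    show "((?F \<circ> real_of_ereal) \<longlongrightarrow> 0) (at_left \<infinity>)"
      unfolding ereal_tendsto_simps
      by (rule lim) (use ext_kernel_limits(2)[of \<beta> z \<alpha>] \<beta> z in \<open>auto simp: eventually_gt_at_top\<close>)
  qed simp
  then have "(LINT \<tau>:{0<..}|lborel. ?F' \<tau>) = 0"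
    by (simp add: interval_lebesgue_integral_def ein)
  then have "(\<integral>\<tau>. ?S \<tau> \<partial>pos_lborel) = 0" unfolding set_integral_pos_lborel FS .
  moreover have "(\<integral>\<tau>. ?S \<tau> \<partial>pos_lborel) = (\<Sum>i\<in>UNIV. \<Sum>j\<in>UNIV. Q $ i $ j * ext_integral \<alpha> \<beta> (\<lambda>\<tau>. DX j (DX i (W f \<tau>))) (X, t, z))
      + (\<Sum>i\<in>UNIV. (B *v X) $ i * ext_integral \<alpha> \<beta> (\<lambda>\<tau>. DX i (W f \<tau>)) (X, t, z))
      - ext_integral \<alpha> \<beta> (\<lambda>\<tau>. DT (W f \<tau>)) (X, t, z)
      - \<beta> * ext_integral \<alpha> (\<beta> + 1) (W f) (X, t, z) + 1/4 * ext_integral (\<alpha> + 2) (\<beta> + 2) (W f) (X, t, z)"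
    unfolding ext_integral_def fst_conv snd_conv
    using int by (simp add: Bochner_Integration.integral_add Bochner_Integration.integral_diff Bochner_Integration.integral_sum
        Bochner_Integration.integrable_sum Bochner_Integration.integrable_add Bochner_Integration.integrable_diff)
  ultimately show ?thesis by simp
qed

text \<open>The Bessel operator applied to the kernel reproduces its \<tau>-derivative, after which
  \<open>W_heat_identity\<close> applies. The formula for \<open>U\<close> is assumed on z > 0, so
  the z-derivatives are transferred on that open half line.\<close>

lemma extension_op_ext_integral:
  assumes f: "bounded_smooth f" and s: "s > 0" and z: "z > 0"
    and U: "\<And>X t z. z > 0 \<Longrightarrow> U X t z = c * ext_integral (2 * s) (1 + s) (W f) (X, t, z)"
  shows "extension_op Q B (1 - 2 * s) U X t z = 0"
proof -
  let ?e = "\<lambda>\<alpha> \<beta> G. ext_integral \<alpha> \<beta> G (X, t, z)"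
  note A0 = W_admissible[OF f]
  note A1 = admissible_deriv[OF A0]
  have \<beta>: "1 + s > 1" using s by simp
  have \<beta>1: "1 + s + 1 > 1" using s by simp
  have w: "(\<lambda>X'. U X' t z) = (\<lambda>X'. c * ext_integral (2 * s) (1 + s) (W f) (X', t, z))" using U[OF z] by simp
  have grad: "gradient (\<lambda>X'. U X' t z) Y $ i = c * ext_integral (2 * s) (1 + s) (\<lambda>\<tau>. DX i (W f \<tau>)) (Y, t, z)" for Y i
    unfolding gradient_def w vec_lambda_beta by (rule ext_integral_slices(1)[OF \<beta> A0 z])
  have hess: "hessian (\<lambda>X'. U X' t z) X $ i $ j = c * ?e (2 * s) (1 + s) (\<lambda>\<tau>. DX i (DX j (W f \<tau>)))" for i j
    unfolding hessian_def vec_lambda_beta grad by (rule ext_integral_slices(1)[OF \<beta> A1 z])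
  have tr: "trace (Q ** hessian (\<lambda>X'. U X' t z) X) = c * (\<Sum>i\<in>UNIV. \<Sum>j\<in>UNIV. Q $ i $ j * ?e (2 * s) (1 + s) (\<lambda>\<tau>. DX j (DX i (W f \<tau>))))"
    by (simp add: trace_def matrix_matrix_mult_def hess sum_distrib_left mult_ac)
  have dr: "(B *v X) \<bullet> gradient (\<lambda>X'. U X' t z) X = c * (\<Sum>i\<in>UNIV. (B *v X) $ i * ?e (2 * s) (1 + s) (\<lambda>\<tau>. DX i (W f \<tau>)))"
    by (simp add: inner_vec_def grad sum_distrib_left mult_ac)
  have dt: "deriv (\<lambda>t'. U X t' z) t = c * ?e (2 * s) (1 + s) (\<lambda>\<tau>. DT (W f \<tau>))"
    unfolding U[OF z] by (rule DERIV_imp_deriv[OF ext_integral_slices(2)[OF \<beta> A0 z]])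
  let ?D = "\<lambda>z. c * (2 * s) * ext_integral (2 * s - 1) (1 + s) (W f) (X, t, z) + (- c / 2) * ext_integral (2 * s + 1) (1 + s + 1) (W f) (X, t, z)"
  have dz: "deriv (\<lambda>z'. U X t z') z' = ?D z'" if z': "z' > 0" for z'
  proof (rule DERIV_imp_deriv)
    have "((\<lambda>z. c * ext_integral (2 * s) (1 + s) (W f) (X, t, z)) has_real_derivative ?D z') (at z')"
      using ext_integral_slices(3)[OF \<beta> A0 z', of c "2 * s" X t] by (simp add: algebra_simps)
    then show "((\<lambda>z. U X t z) has_real_derivative ?D z') (at z')"
      by (rule has_field_derivative_transform_within_open[of _ _ _ "{0<..}"]) (use z' U in auto)
  qed
  have "deriv (deriv (\<lambda>z'. U X t z')) z
      = c * (2 * s) * ((2 * s - 1) * ?e (2 * s - 2) (1 + s) (W f) - 1/2 * ?e (2 * s) (1 + s + 1) (W f))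
      + (- c / 2) * ((2 * s + 1) * ?e (2 * s) (1 + s + 1) (W f) - 1/2 * ?e (2 * s + 2) (1 + s + 2) (W f))"
  proof (rule DERIV_imp_deriv)
    have "(?D has_real_derivative c * (2 * s) * ((2 * s - 1) * ?e (2 * s - 2) (1 + s) (W f) - 1/2 * ?e (2 * s) (1 + s + 1) (W f))
      + (- c / 2) * ((2 * s + 1) * ?e (2 * s) (1 + s + 1) (W f) - 1/2 * ?e (2 * s + 2) (1 + s + 2) (W f))) (at z)"
      using DERIV_add[OF ext_integral_slices(3)[OF \<beta> A0 z, of "c * (2 * s)" "2 * s - 1" X t]
          ext_integral_slices(3)[OF \<beta>1 A0 z, of "- c / 2" "2 * s + 1" X t]] by (simp add: add.commute)
    then show "(deriv (\<lambda>z'. U X t z') has_real_derivative c * (2 * s) * ((2 * s - 1) * ?e (2 * s - 2) (1 + s) (W f) - 1/2 * ?e (2 * s) (1 + s + 1) (W f))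
      + (- c / 2) * ((2 * s + 1) * ?e (2 * s) (1 + s + 1) (W f) - 1/2 * ?e (2 * s + 2) (1 + s + 2) (W f))) (at z)"
      by (rule has_field_derivative_transform_within_open[of _ _ _ "{0<..}"]) (use z dz in auto)
  qed
  moreover have "(1 - 2 * s) / z * deriv (\<lambda>z'. U X t z') z
      = (1 - 2 * s) * (c * (2 * s) * ?e (2 * s - 2) (1 + s) (W f) + (- c / 2) * ?e (2 * s) (1 + s + 1) (W f))"
    unfolding dz[OF z]
    using z ext_integral_shift[OF z, of "2 * s - 1" "1 + s" "W f" X t] ext_integral_shift[OF z, of "2 * s + 1" "1 + s + 1" "W f" X t]
    by (simp add: field_simps)
  \<comment> \<open>The terms with exponent 2 s - 2 cancel: 2 s (2 s - 1) + (1 - 2 s) 2 s = 0. The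
    middle coefficients add up to -s - (2 s + 1)/2 - (1 - 2 s)/2 = -(1 + s), the coefficient in the
    \<tau>-derivative of the kernel.\<close>
  ultimately have bes: "bessel_op (1 - 2 * s) (\<lambda>z'. U X t z') z
      = c * (- (1 + s) * ?e (2 * s) (1 + s + 1) (W f) + 1/4 * ?e (2 * s + 2) (1 + s + 2) (W f))"
    unfolding bessel_op_def by (simp only:) (simp add: field_simps)
  have "op_A Q B (\<lambda>X'. U X' t z) X + bessel_op (1 - 2 * s) (\<lambda>z'. U X t z') z - deriv (\<lambda>t'. U X t' z) t
     = c * ((\<Sum>i\<in>UNIV. \<Sum>j\<in>UNIV. Q $ i $ j * ?e (2 * s) (1 + s) (\<lambda>\<tau>. DX j (DX i (W f \<tau>))))
      + (\<Sum>i\<in>UNIV. (B *v X) $ i * ?e (2 * s) (1 + s) (\<lambda>\<tau>. DX i (W f \<tau>)))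
      - ?e (2 * s) (1 + s) (\<lambda>\<tau>. DT (W f \<tau>))
      - (1 + s) * ?e (2 * s) (1 + s + 1) (W f) + 1/4 * ?e (2 * s + 2) (1 + s + 2) (W f))"
    unfolding op_A_def tr dr bes dt by (simp add: algebra_simps)
  then show ?thesis unfolding extension_op_def W_heat_identity[OF f \<beta> z] by simp
qed

end

section \<open>Boundary behaviour\<close>

context hypoelliptic
begin

text \<open>For a = 1 - 2 s the exponents 1 - a and (3 - a)/2 are 2 s and 1 + s, which selects the
  member of the kernel family.\<close>

lemma poisson_kernel_integral:
  assumes u: "bounded_smooth u" and \<tau>: "\<tau> > 0" and z: "z > 0"
  shows "(LINT Y|lborel. poisson_kernel Q B (1 - 2 * s) z X Y \<tau> * u (Y, t - \<tau>))
    = 1 / (2 powr (2 * s) * Gamma s) * (ext_kernel (2 * s) (1 + s) z \<tau> * W u \<tau> (X, t))"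
proof -
  have e: "poisson_kernel Q B (1 - 2 * s) z X Y \<tau> = 1 / (2 powr (2 * s) * Gamma s) * ext_kernel (2 * s) (1 + s) z \<tau> * p_kernel Q B X Y \<tau>" for Y
  proof -
    have "(3 - (1 - 2 * s)) / 2 = 1 + s" "1 - (1 - 2 * s) = 2 * s" "(1 - (1 - 2 * s)) / 2 = s" by (simp_all add: field_simps)
    moreover have "- z\<^sup>2 / (4 * \<tau>) = - (z\<^sup>2 / 4 / \<tau>)" by simp
    ultimately show ?thesis
      unfolding poisson_kernel_def ext_kernel_def powr_minus_divide[of \<tau>] by (simp only:) simp
  qed
  show ?thesis
    unfolding e semigroup_P_eq_W[OF u \<tau>, symmetric] semigroup_P_def by (simp add: mult.assoc)
qed

lemma poisson_extension_eq_time_reversed: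
  "poisson_extension Q B a u X t z
    = (LINT \<tau>:{0<..}|lborel. LINT Y|lborel. poisson_kernel Q B a z X Y \<tau> * u (Y, t - \<tau>))"
proof -
  let ?J = "\<lambda>\<tau>. LINT Y|lborel. poisson_kernel Q B a z X Y \<tau> * u (Y, t - \<tau>)"
  have "poisson_extension Q B a u X t z = (\<integral>\<tau>. indicator {..<t} \<tau> *\<^sub>R ?J (t - \<tau>) \<partial>lborel)"
    unfolding poisson_extension_def set_lebesgue_integral_def by simp
  also have "\<dots> = (\<integral>\<tau>. indicator {..<t} (t + (- 1) * \<tau>) *\<^sub>R ?J (t - (t + (- 1) * \<tau>)) \<partial>lborel)"
    by (subst lborel_integral_real_affine[of "- 1" _ t]) simp_all
  also have "\<dots> = (\<integral>\<tau>. indicator {0<..} \<tau> *\<^sub>R ?J \<tau> \<partial>lborel)"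
    by (intro Bochner_Integration.integral_cong refl) (simp add: indicator_def)
  finally show ?thesis unfolding set_lebesgue_integral_def .
qed

lemma poisson_extension_eq_ext_integral:
  assumes u: "bounded_smooth u" and z: "z > 0"
  shows "poisson_extension Q B (1 - 2 * s) u X t z
    = 1 / (2 powr (2 * s) * Gamma s) * ext_integral (2 * s) (1 + s) (W u) (X, t, z)"
proof -
  have "poisson_extension Q B (1 - 2 * s) u X t z
    = (\<integral>\<tau>. (LINT Y|lborel. poisson_kernel Q B (1 - 2 * s) z X Y \<tau> * u (Y, t - \<tau>)) \<partial>pos_lborel)"
    unfolding poisson_extension_eq_time_reversed set_integral_pos_lborel ..
  also have "\<dots> = (\<integral>\<tau>. 1 / (2 powr (2 * s) * Gamma s) * (ext_kernel (2 * s) (1 + s) z \<tau> * W u \<tau> (X, t)) \<partial>pos_lborel)"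
    by (intro Bochner_Integration.integral_cong refl poisson_kernel_integral[OF u _ z]) (simp add: space_pos_lborel)
  finally show ?thesis unfolding ext_integral_def by simp
qed

text \<open>The weight has mass 2^(2 s) Gamma(s), so u(X,t) can be moved under the integral.
  Bounding the exponential by 1 then leaves \<tau>^(-1-s) min(1,\<tau>) and the rate z^(2 s),
  uniformly in (X,t).\<close>

lemma ext_integral_near:
  assumes u: "u \<in> schwartz" and s: "0 < s" "s < 1"
    and C: "\<And>\<tau> x. \<tau> > 0 \<Longrightarrow> \<bar>W u \<tau> x - u x\<bar> \<le> C * min 1 \<tau>" and z: "z > 0"
  shows "\<bar>1 / (2 powr (2 * s) * Gamma s) * ext_integral (2 * s) (1 + s) (W u) (X, t, z) - u (X, t)\<bar>
    \<le> 1 / (2 powr (2 * s) * Gamma s) * C * (\<integral>\<tau>. \<tau> powr (- 1 - s) * min 1 \<tau> \<partial>pos_lborel) * z powr (2 * s)"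
proof -
  let ?c = "1 / (2 powr (2 * s) * Gamma s)" and ?k = "ext_kernel (2 * s) (1 + s) z"
  have \<beta>: "1 + s > 1" using s by simp
  have G: "Gamma s > 0" using s by (simp add: Gamma_real_pos)
  note kint = ext_kernel_integral[OF \<beta> z, of "2 * s"]
  have "(z\<^sup>2 / 4) powr (1 - (1 + s)) = 2 powr (2 * s) * z powr (- (2 * s))"
  proof -
    have "(z\<^sup>2 / 4) powr (- s) = ((z / 2) powr 2) powr (- s)" using z by (simp add: powr_realpow power_divide)
    also have "\<dots> = (z / 2) powr (- (2 * s))" by (simp add: powr_powr)
    also have "\<dots> = 2 powr (2 * s) * z powr (- (2 * s))" using z by (simp add: powr_divide powr_minus_divide)
    finally show ?thesis by simp
  qed
  then have "z powr (2 * s) * ((z\<^sup>2 / 4) powr (1 - (1 + s)) * Gamma (1 + s - 1)) = 2 powr (2 * s) * Gamma s"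
    using z by (simp add: powr_minus)
  then have k1: "integrable pos_lborel ?k" "(\<integral>\<tau>. ?k \<tau> \<partial>pos_lborel) = 2 powr (2 * s) * Gamma s"
    using kint by (auto simp: has_bochner_integral_iff)
  have iW: "integrable pos_lborel (\<lambda>\<tau>. ?k \<tau> * W u \<tau> (X, t))"
    by (rule admissible_integrable[OF \<beta> z W_admissible[OF schwartz_bounded_smooth[OF u]]])
  have eq: "ext_integral (2 * s) (1 + s) (W u) (X, t, z) - (2 powr (2 * s) * Gamma s) * u (X, t)
      = (\<integral>\<tau>. ?k \<tau> * W u \<tau> (X, t) - ?k \<tau> * u (X, t) \<partial>pos_lborel)"
    unfolding k1(2)[symmetric] ext_integral_def using iW k1(1) by simp
  have "\<bar>ext_integral (2 * s) (1 + s) (W u) (X, t, z) - (2 powr (2 * s) * Gamma s) * u (X, t)\<bar>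
      \<le> (\<integral>\<tau>. \<bar>?k \<tau> * W u \<tau> (X, t) - ?k \<tau> * u (X, t)\<bar> \<partial>pos_lborel)" unfolding eq by (rule integral_abs_bound)
  also have "\<dots> \<le> (\<integral>\<tau>. (C * z powr (2 * s)) * (\<tau> powr (- 1 - s) * min 1 \<tau>) \<partial>pos_lborel)"
  proof (rule integral_mono)
    show "integrable pos_lborel (\<lambda>\<tau>. \<bar>?k \<tau> * W u \<tau> (X, t) - ?k \<tau> * u (X, t)\<bar>)" using iW k1(1) by simp
    show "integrable pos_lborel (\<lambda>\<tau>. (C * z powr (2 * s)) * (\<tau> powr (- 1 - s) * min 1 \<tau>))"
      by (rule integrable_mult_right[OF integrable_powr_min[OF s]])
    fix \<tau> assume "\<tau> \<in> space pos_lborel"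
    then have \<tau>: "\<tau> > 0" by (simp add: space_pos_lborel)
    have k0: "0 \<le> ?k \<tau>" "?k \<tau> \<le> z powr (2 * s) * \<tau> powr (- 1 - s)"
    proof -
      show "0 \<le> ?k \<tau>" by (simp add: ext_kernel_def)
      have m: "- (1 + s) = - 1 - s" by simp
      have "\<tau> powr (- 1 - s) * exp (- (z\<^sup>2 / 4 / \<tau>)) \<le> \<tau> powr (- 1 - s) * 1"
        using \<tau> by (intro mult_left_mono) auto
      then show "?k \<tau> \<le> z powr (2 * s) * \<tau> powr (- 1 - s)"
        unfolding ext_kernel_def m mult_1_right by (rule mult_left_mono) simp
    qed
    have "\<bar>?k \<tau> * W u \<tau> (X, t) - ?k \<tau> * u (X, t)\<bar> = ?k \<tau> * \<bar>W u \<tau> (X, t) - u (X, t)\<bar>"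
      unfolding right_diff_distrib[symmetric] abs_mult using k0(1) by simp
    also have "\<dots> \<le> (z powr (2 * s) * \<tau> powr (- 1 - s)) * (C * min 1 \<tau>)"
      using k0 by (intro mult_mono C[OF \<tau>]) auto
    finally show "\<bar>?k \<tau> * W u \<tau> (X, t) - ?k \<tau> * u (X, t)\<bar> \<le> (C * z powr (2 * s)) * (\<tau> powr (- 1 - s) * min 1 \<tau>)"
      by (simp add: mult_ac)
  qed
  finally have b: "\<bar>ext_integral (2 * s) (1 + s) (W u) (X, t, z) - (2 powr (2 * s) * Gamma s) * u (X, t)\<bar>
      \<le> (C * z powr (2 * s)) * (\<integral>\<tau>. \<tau> powr (- 1 - s) * min 1 \<tau> \<partial>pos_lborel)" by simp
  have c: "?c > 0" "?c * (2 powr (2 * s) * Gamma s) = 1" using G by simp_all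
  have "\<bar>?c * ext_integral (2 * s) (1 + s) (W u) (X, t, z) - u (X, t)\<bar>
      = ?c * \<bar>ext_integral (2 * s) (1 + s) (W u) (X, t, z) - (2 powr (2 * s) * Gamma s) * u (X, t)\<bar>"
  proof -
    have "?c * e - v = ?c * (e - (2 powr (2 * s) * Gamma s) * v)" for e v :: real
    proof -
      have "?c * (e - (2 powr (2 * s) * Gamma s) * v) = ?c * e - (?c * (2 powr (2 * s) * Gamma s)) * v"
        by (simp only: right_diff_distrib mult.assoc)
      then show ?thesis unfolding c(2) by simp
    qed
    then show ?thesis using c(1) by (simp only: abs_mult abs_of_pos)
  qed
  also have "\<dots> \<le> ?c * ((C * z powr (2 * s)) * (\<integral>\<tau>. \<tau> powr (- 1 - s) * min 1 \<tau> \<partial>pos_lborel))"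
    using b c(1) by (intro mult_left_mono) auto
  finally show ?thesis by (simp only: mult_ac)
qed

text \<open>The factor z^(1 - 2 s) normalises the powers of z in the two kernels to 0 and 2. Their
  combination has total mass zero, being this factor times the z-derivative of a weight of constant
  mass, so subtracting \<open>u\<close> changes nothing.\<close>

lemma weighted_derivative_eq:
  assumes u: "u \<in> schwartz" and s: "0 < s" "s < 1" and z: "z > 0"
  shows "z powr (1 - 2 * s) * (2 * s * ext_integral (2 * s - 1) (1 + s) (W u) (X, t, z)
        - 1/2 * ext_integral (2 * s + 1) (1 + s + 1) (W u) (X, t, z))
    = (\<integral>\<tau>. (2 * s * ext_kernel 0 (1 + s) z \<tau> - 1/2 * ext_kernel 2 (2 + s) z \<tau>) * (W u \<tau> (X, t) - u (X, t)) \<partial>pos_lborel)"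
    and "integrable pos_lborel (\<lambda>\<tau>. (2 * s * ext_kernel 0 (1 + s) z \<tau> - 1/2 * ext_kernel 2 (2 + s) z \<tau>) * (W u \<tau> (X, t) - u (X, t)))"
proof -
  let ?k0 = "ext_kernel 0 (1 + s) z" and ?k2 = "ext_kernel 2 (2 + s) z" and ?w = "\<lambda>\<tau>. W u \<tau> (X, t)"
  have \<beta>: "1 + s > 1" "2 + s > 1" using s by simp_all
  note adm = W_admissible[OF schwartz_bounded_smooth[OF u]]
  have i: "integrable pos_lborel (\<lambda>\<tau>. ?k0 \<tau> * ?w \<tau>)" "integrable pos_lborel (\<lambda>\<tau>. ?k2 \<tau> * ?w \<tau>)"
    by (rule admissible_integrable[OF \<beta>(1) z adm], rule admissible_integrable[OF \<beta>(2) z adm])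
  have k0: "integrable pos_lborel ?k0" "(\<integral>\<tau>. ?k0 \<tau> \<partial>pos_lborel) = (z\<^sup>2 / 4) powr (- s) * Gamma s"
    using ext_kernel_integral[OF \<beta>(1) z, of 0] z by (auto simp: has_bochner_integral_iff)
  have k2: "integrable pos_lborel ?k2" "(\<integral>\<tau>. ?k2 \<tau> \<partial>pos_lborel) = 4 * s * ((z\<^sup>2 / 4) powr (- s) * Gamma s)"
  proof -
    have "(z\<^sup>2 / 4) powr (1 - (2 + s)) = (z\<^sup>2 / 4) powr (- s - 1)"
      by (rule arg_cong[where f="\<lambda>r. (z\<^sup>2 / 4) powr r"]) simp
    also have "\<dots> = (z\<^sup>2 / 4) powr (- s) / (z\<^sup>2 / 4)"
      using z powr_diff[of "z\<^sup>2 / 4" "- s" 1] by simp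
    finally have "(z\<^sup>2 / 4) powr (1 - (2 + s)) = (z\<^sup>2 / 4) powr (- s) / (z\<^sup>2 / 4)" .
    moreover have "Gamma (2 + s - 1) = s * Gamma s"
    proof -
      have "s \<notin> \<int>\<^sub>\<le>\<^sub>0" using s by (auto elim!: nonpos_Ints_cases)
      from Gamma_plus1[OF this] show ?thesis by (simp add: add.commute)
    qed
    moreover have "z powr 2 = z\<^sup>2" using z by (simp add: powr_realpow)
    ultimately have "z powr 2 * ((z\<^sup>2 / 4) powr (1 - (2 + s)) * Gamma (2 + s - 1)) = 4 * s * ((z\<^sup>2 / 4) powr (- s) * Gamma s)"
      using z by (simp add: field_simps)
    then show "integrable pos_lborel ?k2" "(\<integral>\<tau>. ?k2 \<tau> \<partial>pos_lborel) = 4 * s * ((z\<^sup>2 / 4) powr (- s) * Gamma s)"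
      using ext_kernel_integral[OF \<beta>(2) z, of 2] by (auto simp: has_bochner_integral_iff)
  qed
  have z1: "z powr (1 - 2 * s) * ext_integral (2 * s - 1) (1 + s) (W u) (X, t, z) = (\<integral>\<tau>. ?k0 \<tau> * ?w \<tau> \<partial>pos_lborel)"
  proof -
    have "z powr (1 - 2 * s) * ext_kernel (2 * s - 1) (1 + s) z \<tau> = ?k0 \<tau>" for \<tau>
      using z by (simp add: ext_kernel_def mult.assoc[symmetric] powr_add[symmetric])
    then show ?thesis unfolding ext_integral_def by (simp add: integral_mult_right_zero[symmetric] mult.assoc[symmetric] del: integral_mult_right_zero)
  qed
  have z2: "z powr (1 - 2 * s) * ext_integral (2 * s + 1) (1 + s + 1) (W u) (X, t, z) = (\<integral>\<tau>. ?k2 \<tau> * ?w \<tau> \<partial>pos_lborel)"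
  proof -
    have "1 + s + 1 = 2 + s" by simp
    then have "z powr (1 - 2 * s) * ext_kernel (2 * s + 1) (1 + s + 1) z \<tau> = ?k2 \<tau>" for \<tau>
      using z by (simp add: ext_kernel_def mult.assoc[symmetric] powr_add[symmetric])
    then show ?thesis unfolding ext_integral_def by (simp add: integral_mult_right_zero[symmetric] mult.assoc[symmetric] del: integral_mult_right_zero)
  qed
  have e: "(2 * s * ?k0 \<tau> - 1/2 * ?k2 \<tau>) * (?w \<tau> - u (X, t))
      = 2 * s * (?k0 \<tau> * ?w \<tau>) - 1/2 * (?k2 \<tau> * ?w \<tau>) - (2 * s * ?k0 \<tau> * u (X, t) - 1/2 * ?k2 \<tau> * u (X, t))" for \<tau>
    by (simp add: field_simps)
  show "integrable pos_lborel (\<lambda>\<tau>. (2 * s * ?k0 \<tau> - 1/2 * ?k2 \<tau>) * (?w \<tau> - u (X, t)))"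
    unfolding e by (intro Bochner_Integration.integrable_diff integrable_mult_right integrable_mult_left i k0 k2)
  have "(\<integral>\<tau>. (2 * s * ?k0 \<tau> - 1/2 * ?k2 \<tau>) * (?w \<tau> - u (X, t)) \<partial>pos_lborel)
      = 2 * s * (\<integral>\<tau>. ?k0 \<tau> * ?w \<tau> \<partial>pos_lborel) - 1/2 * (\<integral>\<tau>. ?k2 \<tau> * ?w \<tau> \<partial>pos_lborel)
       - (2 * s * (\<integral>\<tau>. ?k0 \<tau> \<partial>pos_lborel) * u (X, t) - 1/2 * (\<integral>\<tau>. ?k2 \<tau> \<partial>pos_lborel) * u (X, t))"
    unfolding e using i k0(1) k2(1) by simp
  \<comment> \<open>The masses of the kernels are m and 4 s m, and 2 s m - (1/2) 4 s m = 0 removes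
    the terms with \<open>u\<close>.\<close>
  also have "\<dots> = 2 * s * (\<integral>\<tau>. ?k0 \<tau> * ?w \<tau> \<partial>pos_lborel) - 1/2 * (\<integral>\<tau>. ?k2 \<tau> * ?w \<tau> \<partial>pos_lborel)"
    unfolding k0(2) k2(2) by simp
  finally show "z powr (1 - 2 * s) * (2 * s * ext_integral (2 * s - 1) (1 + s) (W u) (X, t, z)
        - 1/2 * ext_integral (2 * s + 1) (1 + s + 1) (W u) (X, t, z))
    = (\<integral>\<tau>. (2 * s * ?k0 \<tau> - 1/2 * ?k2 \<tau>) * (?w \<tau> - u (X, t)) \<partial>pos_lborel)"
    unfolding right_diff_distrib z1[symmetric] z2[symmetric] by (simp add: mult_ac)
qed

text \<open>As z tends to 0 the weight tends to 2 s \<tau>^(-1-s). The difference is \<tau>^(-1-s)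
  times the factor studied in \<open>dominated_remainder_tendsto_0\<close>; with the bound C
  min(1,\<tau>) on |W u - u| the error no longer depends on (X,t), which makes the limit
  uniform.\<close>

lemma weighted_derivative_near:
  assumes u: "u \<in> schwartz" and s: "0 < s" "s < 1" and z: "z > 0"
    and C: "C \<ge> 0" "\<And>\<tau> x. \<tau> > 0 \<Longrightarrow> \<bar>W u \<tau> x - u x\<bar> \<le> C * min 1 \<tau>"
  shows "\<bar>z powr (1 - 2 * s) * (2 * s * ext_integral (2 * s - 1) (1 + s) (W u) (X, t, z)
        - 1/2 * ext_integral (2 * s + 1) (1 + s + 1) (W u) (X, t, z))
      - 2 * s * (\<integral>\<tau>. \<tau> powr (- 1 - s) * (W u \<tau> (X, t) - u (X, t)) \<partial>pos_lborel)\<bar>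
    \<le> C * (\<integral>\<tau>. \<tau> powr (- 1 - s) * min 1 \<tau> * (2 * s * (1 - exp (- (z\<^sup>2 / 4 / \<tau>))) + 2 * (z\<^sup>2 / 4 / \<tau>) * exp (- (z\<^sup>2 / 4 / \<tau>))) \<partial>pos_lborel)"
    and "\<bar>\<integral>\<tau>. \<tau> powr (- 1 - s) * (W u \<tau> (X, t) - u (X, t)) \<partial>pos_lborel\<bar> \<le> C * (\<integral>\<tau>. \<tau> powr (- 1 - s) * min 1 \<tau> \<partial>pos_lborel)"
proof -
  let ?D = "\<lambda>\<tau>. 2 * s * ext_kernel 0 (1 + s) z \<tau> - 1/2 * ext_kernel 2 (2 + s) z \<tau>"
  let ?v = "\<lambda>\<tau>. W u \<tau> (X, t) - u (X, t)" and ?m = "\<lambda>\<tau>. \<tau> powr (- 1 - s) * min 1 \<tau>"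
  let ?h = "\<lambda>\<tau>. 2 * s * (1 - exp (- (z\<^sup>2 / 4 / \<tau>))) + 2 * (z\<^sup>2 / 4 / \<tau>) * exp (- (z\<^sup>2 / 4 / \<tau>))"
  have m: "integrable pos_lborel ?m" by (rule integrable_powr_min[OF s])
  have "(\<lambda>\<tau>. W u \<tau> (X, t)) \<in> borel_measurable pos_lborel"
    using W_admissible[OF schwartz_bounded_smooth[OF u]] unfolding admissible_def by blast
  then have vm: "?v \<in> borel_measurable pos_lborel" by (intro borel_measurable_diff borel_measurable_const)
  have pv: "\<bar>\<tau> powr (- 1 - s) * ?v \<tau>\<bar> \<le> C * ?m \<tau>" if "\<tau> > 0" for \<tau>
    using mult_left_mono[OF C(2)[OF that, of "(X, t)"], of "\<tau> powr (- 1 - s)"] by (simp add: abs_mult mult_ac)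
  have iv: "integrable pos_lborel (\<lambda>\<tau>. \<tau> powr (- 1 - s) * ?v \<tau>)"
  proof (rule Bochner_Integration.integrable_bound)
    show "integrable pos_lborel (\<lambda>\<tau>. C * ?m \<tau>)" by (rule integrable_mult_right[OF m])
    have "(\<lambda>\<tau>. \<tau> powr (- 1 - s)) \<in> borel_measurable pos_lborel" by (rule borel_measurable_pos_lborel) measurable
    then show "(\<lambda>\<tau>. \<tau> powr (- 1 - s) * ?v \<tau>) \<in> borel_measurable pos_lborel" using vm by (rule borel_measurable_times)
    show "AE \<tau> in pos_lborel. norm (\<tau> powr (- 1 - s) * ?v \<tau>) \<le> norm (C * ?m \<tau>)"
    proof (rule AE_I2)
      fix \<tau> assume "\<tau> \<in> space pos_lborel"
      then show "norm (\<tau> powr (- 1 - s) * ?v \<tau>) \<le> norm (C * ?m \<tau>)"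
        using order_trans[OF pv abs_ge_self, of \<tau>] by (simp add: space_pos_lborel)
    qed
  qed
  show "\<bar>\<integral>\<tau>. \<tau> powr (- 1 - s) * ?v \<tau> \<partial>pos_lborel\<bar> \<le> C * (\<integral>\<tau>. ?m \<tau> \<partial>pos_lborel)"
  proof -
    have "\<bar>\<integral>\<tau>. \<tau> powr (- 1 - s) * ?v \<tau> \<partial>pos_lborel\<bar> \<le> (\<integral>\<tau>. \<bar>\<tau> powr (- 1 - s) * ?v \<tau>\<bar> \<partial>pos_lborel)" by (rule integral_abs_bound)
    also have "\<dots> \<le> (\<integral>\<tau>. C * ?m \<tau> \<partial>pos_lborel)"
      by (rule integral_mono[OF integrable_abs[OF iv] integrable_mult_right[OF m]]) (rule pv, simp add: space_pos_lborel)
    finally show ?thesis by simp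
  qed
  \<comment> \<open>The quotient z^2 / (2 \<tau>) appears as twice z^2 / (4 \<tau>), the variable of
    the exponential.\<close>
  have D: "2 * s * \<tau> powr (- 1 - s) - ?D \<tau> = \<tau> powr (- 1 - s) * ?h \<tau>" if \<tau>: "\<tau> > 0" for \<tau>
  proof -
    have "\<tau> powr (- (2 + s)) = \<tau> powr (- 1 - s) / \<tau>" using \<tau> powr_diff[of \<tau> "- 1 - s" 1] by simp
    moreover have "z powr 2 = z\<^sup>2" using z by (simp add: powr_realpow)
    moreover have "\<tau> powr (- (1 + s)) = \<tau> powr (- 1 - s)" by (rule arg_cong[where f="\<lambda>r. \<tau> powr r"]) simp
    ultimately show ?thesis unfolding ext_kernel_def using z by (simp only:) (simp add: field_simps)
  qed
  have h0: "0 \<le> ?h \<tau>" if "\<tau> > 0" for \<tau> using that s by simp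
  have hb: "\<bar>?h \<tau>\<bar> \<le> 2 * s + 2" if "\<tau> > 0" for \<tau>
  proof -
    have "x * exp (- x) \<le> 1" for x :: real
    proof -
      have "x \<le> exp x" using exp_ge_add_one_self[of x] by linarith
      then show ?thesis by (simp add: exp_minus field_simps)
    qed
    from this[of "z\<^sup>2 / 4 / \<tau>"] have "2 * (z\<^sup>2 / 4 / \<tau>) * exp (- (z\<^sup>2 / 4 / \<tau>)) \<le> 2" by linarith
    moreover have "2 * s * (1 - exp (- (z\<^sup>2 / 4 / \<tau>))) \<le> 2 * s * 1" using s by (intro mult_left_mono) auto
    ultimately show ?thesis using h0[OF that] by linarith
  qed
  have imh: "integrable pos_lborel (\<lambda>\<tau>. ?m \<tau> * ?h \<tau>)"
  proof (rule Bochner_Integration.integrable_bound)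
    show "integrable pos_lborel (\<lambda>\<tau>. ?m \<tau> * (2 * s + 2))" by (rule integrable_mult_left[OF m])
    show "(\<lambda>\<tau>. ?m \<tau> * ?h \<tau>) \<in> borel_measurable pos_lborel" by (rule borel_measurable_pos_lborel) measurable
    show "AE \<tau> in pos_lborel. norm (?m \<tau> * ?h \<tau>) \<le> norm (?m \<tau> * (2 * s + 2))"
    proof (rule AE_I2)
      fix \<tau> assume "\<tau> \<in> space pos_lborel"
      then have "\<bar>?h \<tau>\<bar> \<le> \<bar>2 * s + 2\<bar>" using hb[of \<tau>] by (simp add: space_pos_lborel)
      then show "norm (?m \<tau> * ?h \<tau>) \<le> norm (?m \<tau> * (2 * s + 2))"
        unfolding real_norm_def abs_mult[of "?m \<tau>"] by (rule mult_left_mono) simp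
    qed
  qed
  note wd = weighted_derivative_eq[OF u s z, of X t]
  have "\<bar>(\<integral>\<tau>. ?D \<tau> * ?v \<tau> \<partial>pos_lborel) - 2 * s * (\<integral>\<tau>. \<tau> powr (- 1 - s) * ?v \<tau> \<partial>pos_lborel)\<bar>
      = \<bar>\<integral>\<tau>. ?D \<tau> * ?v \<tau> - 2 * s * (\<tau> powr (- 1 - s) * ?v \<tau>) \<partial>pos_lborel\<bar>"
    using wd(2) iv by simp
  also have "\<dots> \<le> (\<integral>\<tau>. \<bar>?D \<tau> * ?v \<tau> - 2 * s * (\<tau> powr (- 1 - s) * ?v \<tau>)\<bar> \<partial>pos_lborel)" by (rule integral_abs_bound)
  also have "\<dots> \<le> (\<integral>\<tau>. C * (?m \<tau> * ?h \<tau>) \<partial>pos_lborel)"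
  proof (rule integral_mono)
    show "integrable pos_lborel (\<lambda>\<tau>. \<bar>?D \<tau> * ?v \<tau> - 2 * s * (\<tau> powr (- 1 - s) * ?v \<tau>)\<bar>)"
      by (intro integrable_abs Bochner_Integration.integrable_diff wd(2) integrable_mult_right iv)
    show "integrable pos_lborel (\<lambda>\<tau>. C * (?m \<tau> * ?h \<tau>))" by (rule integrable_mult_right[OF imh])
    fix \<tau> assume "\<tau> \<in> space pos_lborel"
    then have \<tau>: "\<tau> > 0" by (simp add: space_pos_lborel)
    have "?D \<tau> * ?v \<tau> - 2 * s * (\<tau> powr (- 1 - s) * ?v \<tau>) = - (2 * s * \<tau> powr (- 1 - s) - ?D \<tau>) * ?v \<tau>"
      by (simp add: algebra_simps)
    also have "\<dots> = - (?h \<tau> * (\<tau> powr (- 1 - s) * ?v \<tau>))" unfolding D[OF \<tau>] by (simp only: mult_ac mult_minus_left mult_minus_right)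
    also have "\<bar>\<dots>\<bar> = ?h \<tau> * \<bar>\<tau> powr (- 1 - s) * ?v \<tau>\<bar>" using h0[OF \<tau>] by (simp only: abs_minus_cancel abs_mult[of "?h \<tau>"] abs_of_nonneg)
    also have "\<dots> \<le> ?h \<tau> * (C * ?m \<tau>)" by (rule mult_left_mono[OF pv[OF \<tau>] h0[OF \<tau>]])
    finally show "\<bar>?D \<tau> * ?v \<tau> - 2 * s * (\<tau> powr (- 1 - s) * ?v \<tau>)\<bar> \<le> C * (?m \<tau> * ?h \<tau>)" by (simp only: mult_ac)
  qed
  finally show "\<bar>z powr (1 - 2 * s) * (2 * s * ext_integral (2 * s - 1) (1 + s) (W u) (X, t, z)
        - 1/2 * ext_integral (2 * s + 1) (1 + s + 1) (W u) (X, t, z))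
      - 2 * s * (\<integral>\<tau>. \<tau> powr (- 1 - s) * ?v \<tau> \<partial>pos_lborel)\<bar>
    \<le> C * (\<integral>\<tau>. ?m \<tau> * ?h \<tau> \<partial>pos_lborel)"
    unfolding wd(1) by simp
qed

end

section \<open>Measurable slices, existence of the root, and the final assembly\<close>

lemma continuous_on_slice:
  assumes "\<beta> > 1" "admissible G" "z > 0"
  shows "continuous_on UNIV (\<lambda>(X, t). ext_integral \<alpha> \<beta> G (X, t, z))"
proof -
  have "continuous_on {y. snd (snd y) > 0} (ext_integral \<alpha> \<beta> G)"
    using ext_integral_higher_differentiable[OF assms(1,2), of \<alpha> 0] by simp
  then have "continuous_on UNIV (\<lambda>x. ext_integral \<alpha> \<beta> G (fst x, snd x, z))"
    by (rule continuous_on_compose2) (use assms(3) in \<open>auto intro!: continuous_intros\<close>)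
  then show ?thesis by (simp add: case_prod_beta)
qed

text \<open>Positivity of K(t) is rescaled to 2 t K(t); the root is chosen for all t > 0 at once, as
  a function of t, so that it can be differentiated.\<close>

lemma hypoelliptic_exists:
  fixes Q B :: "real^'n^'n"
  assumes "Q = transpose Q" "pos_semidef Q" "\<And>t. t > 0 \<Longrightarrow> pos_def (K_mat Q B t)"
  shows "\<exists>R S. hypoelliptic Q B R S"
proof -
  have pd: "pos_def (covariance Q B t)" if "t > 0" for t
    using assms(3)[OF that] that unfolding scaleR_K_mat[OF that, symmetric] pos_def_def
    by (simp add: scaleR_matrix_vector_assoc[symmetric])
  have pd2: "pos_def (2 *\<^sub>R covariance Q B t)" if "t > 0" for t
    using pd[OF that] unfolding pos_def_def by (simp add: scaleR_matrix_vector_assoc[symmetric])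
  have "\<exists>(R :: real \<Rightarrow> real^'n^'n) S. \<forall>t\<in>{0<..}. R differentiable (at t) \<and> R t ** transpose (R t) = 2 *\<^sub>R covariance Q B t \<and> S t ** R t = mat 1"
  proof (rule differentiable_matrix_root[where T="{0<..}" and M="\<lambda>t. 2 *\<^sub>R covariance Q B t"])
    fix t :: real assume t: "t \<in> {0<..}"
    have "(covariance Q B has_derivative (\<lambda>h. h *\<^sub>R cov_rate Q B t)) (at t)"
      using covariance_has_vector_derivative t unfolding has_vector_derivative_def by auto
    from has_derivative_scaleR_right[OF this, of 2] show "(\<lambda>t. 2 *\<^sub>R covariance Q B t) differentiable at t"
      by (rule differentiableI)
    show "transpose (2 *\<^sub>R covariance Q B t) = 2 *\<^sub>R covariance Q B t"
      using transpose_covariance[OF assms(1)] linear_cmul[OF bounded_linear.linear[OF bounded_linear_transpose], of 2 "covariance Q B t"] by simp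
    show "pos_def (2 *\<^sub>R covariance Q B t)" using pd2 t by simp
  qed
  then obtain R :: "real \<Rightarrow> real^'n^'n" and S where "\<forall>t\<in>{0<..}. R differentiable (at t) \<and> R t ** transpose (R t) = 2 *\<^sub>R covariance Q B t \<and> S t ** R t = mat 1"
    by blast
  then have "hypoelliptic Q B R S" using assms(1,2) pd by unfold_locales auto
  then show ?thesis by blast
qed

theorem theorem4p1:
  fixes s a :: real
    and Q B :: "real^'n^'n"
    and u :: "(real^'n) \<times> real \<Rightarrow> real"
    and U :: "real^'n \<Rightarrow> real \<Rightarrow> real \<Rightarrow> real"
  assumes "0 < s" and "s < 1" and "a = 1 - 2 * s"
    and "Q = transpose Q" and "pos_semidef Q"
    and "\<And>t. t > 0 \<Longrightarrow> pos_def (K_mat Q B t)"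
    and "u \<in> schwartz"
    and "\<And>X t z. z > 0 \<Longrightarrow> U X t z = poisson_extension Q B a u X t z"
  shows "(\<forall>X t. \<forall>z>0. U X t z =
            (LINT \<tau>:{0<..}|lborel. LINT Y|lborel. poisson_kernel Q B a z X Y \<tau> * u (Y, t - \<tau>))) \<and>
         smooth_on {(X, t, z). z > 0} (\<lambda>(X, t, z). U X t z) \<and>
         (\<forall>X t. \<forall>z>0. extension_op Q B a U X t z = 0) \<and>
         ((\<lambda>z. Linf_norm (\<lambda>(X, t). U X t z - u (X, t))) \<longlongrightarrow> 0) (at_right 0) \<and>
         (\<exists>g. Linf_limit (\<lambda>z (X, t). z powr a * deriv (\<lambda>z'. U X t z') z) g (at_right 0) \<and>
              (\<forall>X t. - (2 powr (- a) * Gamma ((1 - a) / 2) / Gamma ((1 + a) / 2)) * g (X, t) =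
                     frac_power Q B s u X t))"
proof -
  obtain R S where "hypoelliptic Q B R S" using hypoelliptic_exists[OF assms(4-6)] by blast
  then interpret hypoelliptic Q B R S .
  let ?c = "1 / (2 powr (2 * s) * Gamma s)" and ?F = "ext_integral (2 * s) (1 + s) (W u)"
  note s = assms(1,2) and u = assms(7)
  have bs: "bounded_smooth u" by (rule schwartz_bounded_smooth[OF u])
  note adm = W_admissible[OF bs]
  have \<beta>: "1 + s > 1" "1 + s + 1 > 1" using s by simp_all
  have G: "Gamma s > 0" "Gamma (1 - s) > 0" using s by (simp_all add: Gamma_real_pos)
  then have c: "?c > 0" by simp
  have s2: "2 * s > 0" using s by simp
  have U: "U X t z = ?c * ?F (X, t, z)" if "z > 0" for X t z
    unfolding assms(8)[OF that] assms(3) by (rule poisson_extension_eq_ext_integral[OF bs that])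
  obtain C where C: "C \<ge> 0" "\<And>\<tau> x. \<tau> > 0 \<Longrightarrow> \<bar>W u \<tau> x - u x\<bar> \<le> C * min 1 \<tau>" using W_near[OF u] by blast
  define I where "I = (\<integral>\<tau>. \<tau> powr (- 1 - s) * min 1 \<tau> \<partial>pos_lborel)"
  have pos: "\<forall>\<^sub>F z::real in at_right 0. z > 0" by (rule eventually_at_right_less)
  have mu: "u \<in> borel_measurable lebesgue" by (rule continuous_measurable_lebesgue[OF bounded_smooth_continuous[OF bs]])

  have 1: "U X t z = (LINT \<tau>:{0<..}|lborel. LINT Y|lborel. poisson_kernel Q B a z X Y \<tau> * u (Y, t - \<tau>))" if "z > 0" for X t z
    unfolding assms(8)[OF that] by (rule poisson_extension_eq_time_reversed)

  have set: "{(X, t, z). z > 0} = {y :: (real^'n) \<times> real \<times> real. snd (snd y) > 0}" by auto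
  have 2: "smooth_on {(X, t, z). z > 0} (\<lambda>(X, t, z). U X t z)"
    unfolding smooth_on_def set
  proof
    fix n
    have "higher_differentiable_on {y. snd (snd y) > 0} (\<lambda>y. ?c * ?F y) n"
      by (rule higher_differentiable_on_cmult[OF open_upper_half ext_integral_higher_differentiable[OF \<beta>(1) adm]])
    then show "higher_differentiable_on {y :: (real^'n) \<times> real \<times> real. snd (snd y) > 0} (\<lambda>(X, t, z). U X t z) n"
      by (rule iffD1[OF higher_differentiable_on_cong[OF open_upper_half], rotated]) (auto simp: U)
  qed

  have 3: "extension_op Q B a U X t z = 0" if "z > 0" for X t z
    unfolding assms(3) by (rule extension_op_ext_integral[OF bs s(1) that U])

  have 4: "((\<lambda>z. Linf_norm (\<lambda>(X, t). U X t z - u (X, t))) \<longlongrightarrow> 0) (at_right 0)"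
  proof (rule tendsto_sandwich[where f="\<lambda>_. 0" and h="\<lambda>z. ereal (?c * C * I * z powr (2 * s))"])
    show "\<forall>\<^sub>F z in at_right 0. Linf_norm (\<lambda>(X, t). U X t z - u (X, t)) \<le> ereal (?c * C * I * z powr (2 * s))"
    proof (rule eventually_mono[OF pos], rule Linf_norm_le)
      fix z :: real assume z: "z > 0"
      have "(\<lambda>x. ?c * (\<lambda>(X, t). ?F (X, t, z)) x - u x) \<in> borel_measurable lebesgue"
        by (intro borel_measurable_diff borel_measurable_times borel_measurable_const mu
            continuous_measurable_lebesgue[OF continuous_on_slice[OF \<beta>(1) adm z]])
      moreover have "(\<lambda>(X, t). U X t z - u (X, t)) = (\<lambda>x. ?c * (\<lambda>(X, t). ?F (X, t, z)) x - u x)"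
        by (simp add: fun_eq_iff U[OF z])
      ultimately show "(\<lambda>(X, t). U X t z - u (X, t)) \<in> borel_measurable lebesgue"
        by (simp only:)
      show "\<bar>(\<lambda>(X, t). U X t z - u (X, t)) x\<bar> \<le> ?c * C * I * z powr (2 * s)" for x
        using ext_integral_near[OF u s C(2) z, of "fst x" "snd x"]
        by (simp only: case_prod_beta U[OF z] I_def)
    qed
    have "((\<lambda>z. ?c * C * I * z powr (2 * s)) \<longlongrightarrow> ?c * C * I * 0) (at_right 0)"
    proof (intro tendsto_mult_left)
      show "((\<lambda>z::real. z powr (2 * s)) \<longlongrightarrow> 0) (at_right 0)" using s by real_asymp
    qed
    then show "((\<lambda>z. ereal (?c * C * I * z powr (2 * s))) \<longlongrightarrow> 0) (at_right 0)"
      unfolding zero_ereal_def by (intro tendsto_ereal) simp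
  qed (auto simp: Linf_norm_nonneg)

  \<comment> \<open>The limit of the weighted derivative in closed form: the integral that defines
    the fractional power, times 2 s from the limit weight and the normalisation
    \<open>?c\<close>.\<close>
  define g where "g = (\<lambda>x. ?c * (2 * s * (\<integral>\<tau>. \<tau> powr (- 1 - s) * (W u \<tau> x - u x) \<partial>pos_lborel)))"
  define d where "d z = (\<lambda>(X, t). z powr a * deriv (\<lambda>z'. U X t z') z)" for z
  define \<epsilon> where "\<epsilon> z = (\<integral>\<tau>. \<tau> powr (- 1 - s) * min 1 \<tau> * (2 * s * (1 - exp (- (z\<^sup>2 / 4 / \<tau>))) + 2 * (z\<^sup>2 / 4 / \<tau>) * exp (- (z\<^sup>2 / 4 / \<tau>))) \<partial>pos_lborel)" for z
  let ?H = "\<lambda>z X t. 2 * s * ext_integral (2 * s - 1) (1 + s) (W u) (X, t, z) - 1/2 * ext_integral (2 * s + 1) (1 + s + 1) (W u) (X, t, z)"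
  have dU: "deriv (\<lambda>z'. U X t z') z = ?c * ?H z X t" if z: "z > 0" for X t z
    by (rule DERIV_imp_deriv, rule has_field_derivative_transform_within_open[OF ext_integral_slices(3)[OF \<beta>(1) adm z, of ?c "2 * s" X t], of "{0<..}"])
      (use z U in auto)
  have d: "d z (X, t) = ?c * (z powr (1 - 2 * s) * ?H z X t)" if "z > 0" for X t z
    unfolding d_def dU[OF that] assms(3) prod.case by (simp only: mult_ac)
  have near: "\<bar>d z x - g x\<bar> \<le> ?c * C * \<epsilon> z" if z: "z > 0" for z x
  proof -
    obtain X t where x: "x = (X, t)" by (cases x)
    have "\<bar>d z x - g x\<bar> = ?c * \<bar>z powr (1 - 2 * s) * ?H z X t - 2 * s * (\<integral>\<tau>. \<tau> powr (- 1 - s) * (W u \<tau> (X, t) - u (X, t)) \<partial>pos_lborel)\<bar>"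
      unfolding x d[OF z] g_def right_diff_distrib[symmetric, of ?c] abs_mult[of ?c] abs_of_pos[OF c] ..
    also have "\<dots> \<le> ?c * (C * \<epsilon> z)"
      unfolding \<epsilon>_def by (rule mult_left_mono[OF weighted_derivative_near(1)[OF u s z C] less_imp_le[OF c]])
    finally show ?thesis by (simp only: mult.assoc)
  qed
  have \<epsilon>: "(\<epsilon> \<longlongrightarrow> 0) (at_right 0)"
    unfolding \<epsilon>_def[abs_def] by (rule dominated_remainder_tendsto_0[OF integrable_powr_min[OF s]])
  have gb: "\<bar>g x\<bar> \<le> ?c * (2 * s * (C * I))" for x
  proof -
    obtain X t where x: "x = (X, t)" by (cases x)
    have "\<bar>g x\<bar> = ?c * (2 * s * \<bar>\<integral>\<tau>. \<tau> powr (- 1 - s) * (W u \<tau> (X, t) - u (X, t)) \<partial>pos_lborel\<bar>)"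
      unfolding g_def abs_mult[of ?c] abs_mult[of "2 * s"] x abs_of_pos[OF c] abs_of_pos[OF s2] ..
    \<comment> \<open>The estimate used is free of z; its positive parameter is filled with
      1.\<close>
    also have "\<dots> \<le> ?c * (2 * s * (C * I))"
      unfolding I_def
      by (intro mult_left_mono weighted_derivative_near(2)[OF u s zero_less_one C] less_imp_le[OF c] less_imp_le[OF s2])
    finally show ?thesis .
  qed
  have dm: "d z \<in> borel_measurable lebesgue" if z: "z > 0" for z
  proof -
    have "(\<lambda>x. ?c * (z powr (1 - 2 * s) * (2 * s * (\<lambda>(X, t). ext_integral (2 * s - 1) (1 + s) (W u) (X, t, z)) x
        - 1/2 * (\<lambda>(X, t). ext_integral (2 * s + 1) (1 + s + 1) (W u) (X, t, z)) x))) \<in> borel_measurable lebesgue"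
      by (intro borel_measurable_diff borel_measurable_times borel_measurable_const
          continuous_measurable_lebesgue[OF continuous_on_slice[OF \<beta>(1) adm z]]
          continuous_measurable_lebesgue[OF continuous_on_slice[OF \<beta>(2) adm z]])
    moreover have "d z = (\<lambda>x. ?c * (z powr (1 - 2 * s) * (2 * s * (\<lambda>(X, t). ext_integral (2 * s - 1) (1 + s) (W u) (X, t, z)) x
        - 1/2 * (\<lambda>(X, t). ext_integral (2 * s + 1) (1 + s + 1) (W u) (X, t, z)) x)))"
    proof (rule ext)
      fix x :: "(real^'n) \<times> real"
      obtain X t where x: "x = (X, t)" by (cases x)
      show "d z x = ?c * (z powr (1 - 2 * s) * (2 * s * (\<lambda>(X, t). ext_integral (2 * s - 1) (1 + s) (W u) (X, t, z)) x
        - 1/2 * (\<lambda>(X, t). ext_integral (2 * s + 1) (1 + s + 1) (W u) (X, t, z)) x))"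
        unfolding x d[OF z] prod.case ..
    qed
    ultimately show ?thesis by (simp only:)
  qed
  \<comment> \<open>\<open>g\<close> inherits measurability as the pointwise limit of
    \<open>d\<close> along z = 1/(n + 1).\<close>
  have gm: "g \<in> borel_measurable lebesgue"
  proof (rule borel_measurable_LIMSEQ_real)
    let ?z = "\<lambda>n. inverse (real (Suc n))"
    have fl: "filterlim ?z (at_right 0) sequentially"
      using LIMSEQ_inverse_real_of_nat by (auto simp: filterlim_at)
    show "d (?z n) \<in> borel_measurable lebesgue" for n by (rule dm) simp
    fix x
    have "(\<lambda>n. ?c * C * \<epsilon> (?z n)) \<longlonglongrightarrow> ?c * C * 0"
      by (intro tendsto_mult_left filterlim_compose[OF \<epsilon> fl])
    then have "(\<lambda>n. ?c * C * \<epsilon> (?z n)) \<longlonglongrightarrow> 0" by simp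
    then have "(\<lambda>n. d (?z n) x - g x) \<longlonglongrightarrow> 0"
      by (rule Lim_null_comparison[rotated])
        (rule always_eventually, rule allI, unfold real_norm_def, rule near, simp)
    then show "(\<lambda>n. d (?z n) x) \<longlonglongrightarrow> g x" by (rule LIM_zero_cancel)
  qed
  have Linf_I: "f \<in> Linf" if "f \<in> borel_measurable lebesgue" "\<And>x. \<bar>f x\<bar> \<le> K" for f :: "(real^'n) \<times> real \<Rightarrow> real" and K
  proof -
    have "Linf_norm f < \<infinity>" by (rule le_less_trans[OF Linf_norm_le[OF that]]) simp
    with that(1) show ?thesis by (simp add: Linf_def)
  qed
  have gL: "g \<in> Linf" by (rule Linf_I[OF gm gb])
  have dL: "d z \<in> Linf" if z: "z > 0" for z
  proof -
    \<comment> \<open>Boundedness of \<open>d z\<close> is borrowed from \<open>g\<close> and the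
      error estimate.\<close>
    have "\<bar>d z x\<bar> \<le> ?c * (2 * s * (C * I)) + ?c * C * \<epsilon> z" for x using gb[of x] near[OF z, of x] by linarith
    then show ?thesis by (rule Linf_I[OF dm[OF z]])
  qed
  have lim: "((\<lambda>z. Linf_norm (\<lambda>x. d z x - g x)) \<longlongrightarrow> 0) (at_right 0)"
  proof (rule tendsto_sandwich[where f="\<lambda>_. 0" and h="\<lambda>z. ereal (?c * C * \<epsilon> z)"])
    show "\<forall>\<^sub>F z in at_right 0. Linf_norm (\<lambda>x. d z x - g x) \<le> ereal (?c * C * \<epsilon> z)"
      by (rule eventually_mono[OF pos], rule Linf_norm_le[OF borel_measurable_diff[OF dm gm] near])
    have "((\<lambda>z. ?c * C * \<epsilon> z) \<longlongrightarrow> ?c * C * 0) (at_right 0)" by (intro tendsto_mult_left \<epsilon>)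
    then show "((\<lambda>z. ereal (?c * C * \<epsilon> z)) \<longlongrightarrow> 0) (at_right 0)"
      unfolding zero_ereal_def by (intro tendsto_ereal) simp
  qed (auto simp: Linf_norm_nonneg)
  have 5: "Linf_limit (\<lambda>z (X, t). z powr a * deriv (\<lambda>z'. U X t z') z) g (at_right 0)"
    using conjI[OF eventually_mono[OF pos dL] conjI[OF gL lim]] unfolding Linf_limit_def d_def .

  have 6: "- (2 powr (- a) * Gamma ((1 - a) / 2) / Gamma ((1 + a) / 2)) * g (X, t) = frac_power Q B s u X t" for X t
  proof -
    let ?I = "\<integral>\<tau>. \<tau> powr (- 1 - s) * (W u \<tau> (X, t) - u (X, t)) \<partial>pos_lborel"
    have fp: "frac_power Q B s u X t = - (s / Gamma (1 - s)) * ?I"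
    proof -
      \<comment> \<open>\<open>semigroup_P\<close> and W are identified for \<tau> > 0, which is the
        whole of \<open>pos_lborel\<close>.\<close>
      have "(\<integral>\<tau>. \<tau> powr (- 1 - s) * (semigroup_P Q B \<tau> u X t - u (X, t)) \<partial>pos_lborel) = ?I"
        by (intro Bochner_Integration.integral_cong refl) (simp add: space_pos_lborel semigroup_P_eq_W[OF bs])
      then show ?thesis unfolding frac_power_def set_integral_pos_lborel by (simp only:)
    qed
    have e: "(1 - a) / 2 = s" "(1 + a) / 2 = 1 - s" "- a = 2 * s - 1" unfolding assms(3) by (simp_all add: field_simps)
    \<comment> \<open>The prefactor 2^(2 s - 1) Gamma(s) / Gamma(1 - s) meets 2 s / (2^(2 s)
      Gamma(s)) from \<open>g\<close>; their product is s / Gamma(1 - s), the constant of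
      \<open>frac_power\<close>.\<close>
    have "2 powr (2 * s - 1) = 2 powr (2 * s) / 2" by (simp add: powr_diff)
    then show ?thesis unfolding fp e g_def using G by (simp add: field_simps)
  qed
  show ?thesis
    by (intro conjI allI impI exI[of _ g] 1 2 3 4 5 6)
qed

end
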